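(* Let $A\subset\mathbb{R}^n$ be a nonempty bounded closed set and let $g:\partial A\to\mathbb{R}$ be admissible. Then the following hold, where a function $u$ on $\mathbb{R}^n\setminus A$ with $u=g$ on $\partial A$ is regarded as a function on $(\mathbb{R}^n\setminus A)\cup\partial A$ with values $g$ on $\partial A$. (i) For every $x_0\in A$, there exists an area maximizing function $u$ on $\mathbb{R}^n\setminus A$ such that $u=g$ on $\partial A$ and $u(x)-|x-x_0|$ attains its maximum and its minimum on $\partial A$. (ii) For every $x_0\in A$, there exists an area maximizing function $u$ on $\mathbb{R}^n\setminus A$ such that $u=g$ on $\partial A$ and $u(x)+|x-x_0|$ attains its maximum and its minimum on $\partial A$. (iii) For every unit vector $a\in\mathbb{R}^n$, there exists an area maximizing function $u$ on $\mathbb{R}^n\setminus A$ such that $u=g$ on $\partial A$ and $u(x)-a\cdot x$ attains its maximum and its minimum on $\partial A$.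
   Context: Let $\Omega\subset\mathbb{R}^n$ be open. A function $u\in C^{0,1}(\Omega)$ is weakly spacelike if $|Du|\le 1$ a.e. in $\Omega$. Boundary values: for a function $v$ on an open set $\Omega$ and a function $\varphi$ on $\partial\Omega$, "$v=\varphi$ on $\partial\Omega$" means that for every $y\in\partial\Omega$ and every open straight line segment $\ell\subset\Omega$ with endpoint $y$, $\lim_{x\to y,\,x\in\ell}v(x)=\varphi(y)$. (For $\Omega=\mathbb{R}^n\setminus A$ with $A$ closed, $\partial\Omega=\partial A$.) A weakly spacelike function $u$ on $\Omega$ ($\Omega$ not necessarily bounded) is called area maximizing on $\Omega$ if for every bounded subdomain $\Omega'\subset\Omega$, $u$ maximizes $\int_{\Omega'}\sqrt{1-|Dv|^2}\,dx$ among all $v\in C^{0,1}(\Omega')$ with $|Dv|\le 1$ a.e. in $\Omega'$ having the same boundary values as $u$ on $\partial\Omega'$ (that is, for every $y\in\partial\Omega'$ and every open straight line segment $\ell\subset\Omega'$ with endpoint $y$, $\lim_{x\to y,\,x\in\ell}(v(x)-u(x))=0$). A function $g:\partial A\to\mathbb{R}$ is admissible if $g$ is bounded and there exists a weakly spacelike function $\psi$ in $\mathbb{R}^n\setminus A$ such that $\psi=g$ on $\partial A$, i.e. for every $y\in\partial A$ and every open straight line segment $\ell\subset\mathbb{R}^n\setminus A$ with endpoint $y$, $\lim_{x\to y,\,x\in\ell}\psi(x)=g(y)$.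
   Formalization: An admissible g may be discontinuous, so its difference from the cone or linear function may have no maximum or minimum on ∂A; proved: supremum and infimum over the whole set equal those over ∂A and are attained on ∂A whenever the boundary values attain them. *)

theory Defs
  imports "HOL-Analysis.Analysis"
begin

text \<open>
  The class $C^{0,1}(\Omega)$ for open $\Omega$: Lipschitz on each compact subset, with no uniform
  constant. Functions are total, and only their values on $\Omega$ matter.
\<close>

definition C01 :: "'a::euclidean_space set \<Rightarrow> ('a \<Rightarrow> real) \<Rightarrow> bool" where
  "C01 \<Omega> u \<longleftrightarrow> (\<forall>K. compact K \<and> K \<subseteq> \<Omega> \<longrightarrow> (\<exists>L. L-lipschitz_on K u))"

definition grad :: "('a::euclidean_space \<Rightarrow> real) \<Rightarrow> 'a \<Rightarrow> 'a" where
  "grad u x = (THE D. GDERIV u x :> D)"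

text \<open>
  The bound $|Du| \le 1$ a.e. includes the existence of $Du$ a.e., so the arbitrary value of
  \<^const>\<open>grad\<close> at points of non-differentiability is irrelevant. (For functions in
  $C^{0,1}(\Omega)$ existence a.e. is automatic by Rademacher's theorem.)
\<close>

definition weakly_spacelike :: "'a::euclidean_space set \<Rightarrow> ('a \<Rightarrow> real) \<Rightarrow> bool" where
  "weakly_spacelike \<Omega> u \<longleftrightarrow>
     C01 \<Omega> u \<and>
     (AE x in lebesgue. x \<in> \<Omega> \<longrightarrow> u differentiable (at x) \<and> norm (grad u x) \<le> 1)"

definition bdry_values :: "'a::euclidean_space set \<Rightarrow> ('a \<Rightarrow> real) \<Rightarrow> ('a \<Rightarrow> real) \<Rightarrow> bool" where
  "bdry_values \<Omega> v \<phi> \<longleftrightarrow>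
     (\<forall>y\<in>frontier \<Omega>. \<forall>z. z \<noteq> y \<and> open_segment y z \<subseteq> \<Omega> \<longrightarrow>
        (v \<longlongrightarrow> \<phi> y) (at y within open_segment y z))"

definition area :: "'a::euclidean_space set \<Rightarrow> ('a \<Rightarrow> real) \<Rightarrow> real" where
  "area \<Omega> v = (LINT x:\<Omega>|lebesgue. sqrt (1 - (norm (grad v x))\<^sup>2))"

definition area_maximizing :: "'a::euclidean_space set \<Rightarrow> ('a \<Rightarrow> real) \<Rightarrow> bool" where
  "area_maximizing \<Omega> u \<longleftrightarrow>
     weakly_spacelike \<Omega> u \<and>
     (\<forall>\<Omega>'. open \<Omega>' \<and> connected \<Omega>' \<and> bounded \<Omega>' \<and> \<Omega>' \<subseteq> \<Omega> \<longrightarrow>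
        (\<forall>v. weakly_spacelike \<Omega>' v \<and> bdry_values \<Omega>' (\<lambda>x. v x - u x) (\<lambda>_. 0) \<longrightarrow>
           area \<Omega>' v \<le> area \<Omega>' u))"

definition admissible :: "'a::euclidean_space set \<Rightarrow> ('a \<Rightarrow> real) \<Rightarrow> bool" where
  "admissible A g \<longleftrightarrow>
     bounded (g ` frontier A) \<and> (\<exists>\<psi>. weakly_spacelike (- A) \<psi> \<and> bdry_values (- A) \<psi> g)"

definition attains_max_on :: "('a \<Rightarrow> real) \<Rightarrow> 'a set \<Rightarrow> 'a set \<Rightarrow> bool" where
  "attains_max_on f S T \<longleftrightarrow> (\<exists>y\<in>T. \<forall>x\<in>S. f x \<le> f y)"

definition attains_min_on :: "('a \<Rightarrow> real) \<Rightarrow> 'a set \<Rightarrow> 'a set \<Rightarrow> bool" where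
  "attains_min_on f S T \<longleftrightarrow> (\<exists>y\<in>T. \<forall>x\<in>S. f y \<le> f x)"

text \<open>
  ``\<open>f\<close> on \<open>S\<close> attains its maximum and its minimum on the subset \<open>T\<close>''. An admissible \<open>g\<close> need not be
  continuous: its values at boundary points that are not endpoints of a segment in the complement of
  \<open>A\<close> are not restricted by a weakly spacelike extension. So the values on $\partial A$ alone may
  have no maximum (let \<open>A\<close> be the Cantor set and take a bounded \<open>g\<close> that is nonzero only at a suitable
  sequence of non-endpoints). The extrema are therefore suprema and infima, which are attained
  on \<open>T\<close> whenever the values on \<open>T\<close> themselves have a maximum or a minimum; in particular for
  compact \<open>T\<close> and \<open>f\<close> continuous on \<open>T\<close>.
\<close>

definition extrema_on :: "('a \<Rightarrow> real) \<Rightarrow> 'a set \<Rightarrow> 'a set \<Rightarrow> bool" where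
  "extrema_on f S T \<longleftrightarrow>
     bounded (f ` S) \<and>
     (SUP x\<in>S. f x) = (SUP y\<in>T. f y) \<and> (INF x\<in>S. f x) = (INF y\<in>T. f y) \<and>
     (attains_max_on f T T \<longrightarrow> attains_max_on f S T) \<and>
     (attains_min_on f T T \<longrightarrow> attains_min_on f S T)"

end

theory Submission
  imports Defs "HOL-Complex_Analysis.Great_Picard"
begin

text \<open>
  Weakly spacelike functions are exactly those that are 1-Lipschitz along segments of the domain; one
  direction is Rademacher's theorem. Let \<open>p\<close> be the cone \<open>\<plusminus>|x - x\<^sub>0|\<close> or the linear function \<open>a \<bullet> x\<close>, and
  let \<open>m\<close> and \<open>M\<close> be the infimum and the supremum of \<open>g - p\<close> on \<open>\<partial>A\<close>. Truncating an extension of \<open>g\<close> yields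
  one, \<open>\<phi>\<close>, with \<open>p + m \<le> \<phi> \<le> p + M\<close>. From every point a straight path along which \<open>p\<close> increases with
  slope one, and another along which it decreases, leads to \<open>A\<close> or to infinity. Hence an extension of \<open>g\<close> that agrees with
  \<open>\<phi>\<close> outside a ball of radius \<open>k\<close> satisfies the same two bounds. Choose an almost area maximizing one
  among them for each \<open>k\<close>; by Arzela--Ascoli a subsequence converges locally uniformly as \<open>k \<rightarrow> \<infinity>\<close>. The
  area integrand is concave, so the area is upper semicontinuous, and truncated competitors show that
  the limit is area maximizing.
\<close>

subsection \<open>Porous sets\<close>

text \<open>Convergence is uniform only on compact subsets of the complement of \<open>A\<close>,
  whereas a test subdomain may reach \<open>A\<close> and its boundary data are fixed only along
  segments. A competitor \<open>v\<close> is therefore compared with the limit \<open>u0\<close> at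
  a level \<open>c > 0\<close>: the points where they differ by more than \<open>c\<close> keep a
  positive distance from the boundary of the subdomain, and the remaining points with
  \<open>v \<noteq> u0\<close> form a set whose measure tends to 0 with \<open>c\<close>.

  The area of an unbounded domain may be infinite, so the \<open>k\<close>-th problem lives in a
  ball; almost maximizers suffice because the deficits \<open>1 / Suc k\<close> vanish.

  The square root has unbounded slope where the gradient has length one. Semicontinuity is therefore
  proved through the radicand \<open>1 + r\<^sup>2 - |Du|\<^sup>2\<close>, at a cost of at most
  \<open>r\<close> per unit volume.

  Porous sets serve twice: they carry Rademacher's theorem, and they show that functions agreeing on
  an arbitrary set have equal gradients at almost all points of that set where both are
  differentiable, which is what allows areas to be compared piece by piece.\<close>

definition porous_at :: "real \<Rightarrow> 'a::euclidean_space set \<Rightarrow> 'a \<Rightarrow> bool" where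
  "porous_at k S x \<longleftrightarrow>
     (\<forall>d>0. \<exists>r y. 0 < r \<and> r < d \<and> ball y (k * r) \<subseteq> ball x r \<and> ball y (k * r) \<inter> S = {})"

lemma emeasure_ball_scale:
  fixes x y :: "'a::euclidean_space"
  assumes "0 \<le> c" "0 \<le> r"
  shows "emeasure lebesgue (ball y (c * r)) = ennreal (c ^ DIM('a)) * emeasure lebesgue (ball x r)"
proof -
  have "measure lebesgue (ball y (c * r)) = c ^ DIM('a) * measure lebesgue (ball x r)"
    using content_ball_conv_unit_ball[of "c*r" y] content_ball_conv_unit_ball[of r x] assms
    by (simp add: power_mult_distrib mult_ac)
  then show ?thesis
    using assms by (simp add: emeasure_eq_measure2 ennreal_mult)
qed

text \<open>A Vitali covering of the porous points shrinks their outer measure by a fixed factor.\<close>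

lemma negligible_porous:
  fixes S :: "'a::euclidean_space set"
  assumes "0 < k"
  shows "negligible {x\<in>S. porous_at k S x}"
proof -
  \<comment> \<open>The unit ball makes the outer measure finite, so that a bound
    \<open>m \<le> c * m\<close> with \<open>c < 1\<close> forces \<open>m = 0\<close>.\<close>
  define P where "P z = {x\<in>S. porous_at k S x} \<inter> ball z 1" for z
  have "negligible (P z)" for z
  proof -
    \<comment> \<open>The share of a ball that is left when its hole is removed. Subtraction in
      \<open>ennreal\<close> is truncated, so \<open>c = 0\<close> for \<open>k \<ge> 1\<close>, and
      \<open>c < 1\<close> in every case.\<close>
    define c where "c = 1 - ennreal (k ^ DIM('a))"
    have c1: "c < 1" unfolding c_def using assms
      by (intro ennreal_between) (auto simp: zero_less_power)
    have step: "\<exists>T. P z \<subseteq> T \<and> T \<in> sets lebesgue \<and> emeasure lebesgue T \<le> c * emeasure lebesgue V"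
      if V: "open V" "P z \<subseteq> V" "emeasure lebesgue V < \<infinity>" for V
    proof -
      define K where "K = {(x, r). 0 < r \<and> ball x r \<subseteq> V \<and>
          (\<exists>y. ball y (k * r) \<subseteq> ball x r \<and> ball y (k * r) \<inter> S = {})}"
      have "\<exists>i. i \<in> K \<and> x \<in> ball (fst i) (snd i) \<and> snd i < d" if xP: "x \<in> P z" and d0: "0 < d" for x d
      proof -
        obtain e where e: "e > 0" "ball x e \<subseteq> V" using openE[OF V(1), of x] V(2) xP by blast
        have "porous_at k S x" using xP by (auto simp: P_def)
        then obtain r y where r: "0 < r" "r < min d e" "ball y (k * r) \<subseteq> ball x r"
           "ball y (k * r) \<inter> S = {}"
          unfolding porous_at_def using e(1) d0 by (metis min_less_iff_conj)
        have "ball x r \<subseteq> V" using r(2) e(2) subset_ball[of r e x] by auto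
        then have "(x, r) \<in> K" using r by (auto simp: K_def)
        then show ?thesis using r by (intro exI[of _ "(x,r)"]) auto
      qed
      then obtain C where C: "countable C" "C \<subseteq> K"
         "pairwise (\<lambda>i j. disjnt (ball (fst i) (snd i)) (ball (fst j) (snd j))) C"
         "negligible (P z - (\<Union>i \<in> C. ball (fst i) (snd i)))"
        by (rule Vitali_covering_theorem_balls)
      have "\<forall>i\<in>C. \<exists>y. ball y (k * snd i) \<subseteq> ball (fst i) (snd i) \<and> ball y (k * snd i) \<inter> S = {}"
        using C(2) by (auto simp: K_def)
      then obtain y where y: "\<And>i. i \<in> C \<Longrightarrow> ball (y i) (k * snd i) \<subseteq> ball (fst i) (snd i)"
           "\<And>i. i \<in> C \<Longrightarrow> ball (y i) (k * snd i) \<inter> S = {}" by metis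
      define B where "B i = ball (fst i) (snd i)" for i :: "'a \<times> real"
      define H where "H i = B i - ball (y i) (k * snd i)" for i
      let ?N = "P z - (\<Union>i \<in> C. B i)"
      \<comment> \<open>The covering balls without their holes, plus the null set that the Vitali
        cover misses. The holes avoid \<open>S\<close>, so \<open>T\<close> still covers
        \<open>P z\<close>.\<close>
      define T where "T = (\<Union>i\<in>C. H i) \<union> ?N"
      have N: "?N \<in> null_sets lebesgue" using C(4) by (simp add: negligible_iff_null_sets B_def)
      have Hs: "(\<Union>i\<in>C. H i) \<in> sets lebesgue" using C(1)
        by (intro sets.countable_UN') (auto simp: H_def B_def)
      have dB: "disjoint_family_on B C" using C(3)
        by (auto simp: disjoint_family_on_def pairwise_def disjnt_def B_def)
      then have dH: "disjoint_family_on H C" unfolding disjoint_family_on_def H_def by blast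
      have eH: "emeasure lebesgue (H i) = c * emeasure lebesgue (B i)" if "i \<in> C" for i
      proof -
        have "0 < snd i" using C(2) that by (auto simp: K_def)
        then have e: "emeasure lebesgue (ball (y i) (k * snd i)) = ennreal (k ^ DIM('a)) * emeasure lebesgue (B i)"
          unfolding B_def using assms by (intro emeasure_ball_scale) auto
        have "emeasure lebesgue (H i) = emeasure lebesgue (B i) - emeasure lebesgue (ball (y i) (k * snd i))"
          unfolding H_def using y(1)[OF that] unfolding B_def[symmetric]
          by (intro emeasure_Diff) (auto simp: B_def emeasure_eq_measure2)
        also have "\<dots> = c * emeasure lebesgue (B i)"
          unfolding e c_def using assms
          by (simp add: B_def emeasure_eq_measure2 ennreal_mult''[symmetric] ennreal_minus
              flip: ennreal_1) (simp add: algebra_simps)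
        finally show ?thesis .
      qed
      have "emeasure lebesgue T = emeasure lebesgue (\<Union>i\<in>C. H i)"
        unfolding T_def by (rule emeasure_Un_null_set[OF Hs N])
      also have "\<dots> = (\<integral>\<^sup>+i. emeasure lebesgue (H i) \<partial>count_space C)"
        using C(1) dH by (intro emeasure_UN_countable) (simp_all add: H_def[abs_def] B_def)
      also have "\<dots> = (\<integral>\<^sup>+i. c * emeasure lebesgue (B i) \<partial>count_space C)"
        by (intro nn_integral_cong) (auto simp: eH)
      also have "\<dots> = c * (\<integral>\<^sup>+i. emeasure lebesgue (B i) \<partial>count_space C)"
        by (rule nn_integral_cmult) auto
      also have "(\<integral>\<^sup>+i. emeasure lebesgue (B i) \<partial>count_space C) = emeasure lebesgue (\<Union>i\<in>C. B i)"
        using C(1) dB by (intro emeasure_UN_countable[symmetric]) (simp_all add: B_def[abs_def])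
      also have "c * \<dots> \<le> c * emeasure lebesgue V"
        using C(2) V(1) by (intro mult_left_mono emeasure_mono) (fastforce simp: K_def B_def)+
      finally have "emeasure lebesgue T \<le> c * emeasure lebesgue V" .
      moreover have "P z \<subseteq> T" using y(2) by (auto simp: T_def H_def P_def)
      moreover have "T \<in> sets lebesgue" using Hs N by (auto simp: T_def)
      ultimately show ?thesis by blast
    qed
    define m where "m = (INF V\<in>{V. open V \<and> P z \<subseteq> V \<and> emeasure lebesgue V < \<infinity>}. emeasure lebesgue V)"
    have fin: "emeasure lebesgue (ball z 1) < \<infinity>" by (simp add: emeasure_eq_measure2)
    have b: "ball z 1 \<in> {V. open V \<and> P z \<subseteq> V \<and> emeasure lebesgue V < \<infinity>}"
      using fin by (auto simp: P_def)
    have mfin: "m < \<infinity>" unfolding m_def using INF_lower[OF b, of "emeasure lebesgue"] fin by (rule le_less_trans)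
    \<comment> \<open>\<open>T\<close> is merely measurable while \<open>m\<close> is an infimum
      over open sets; an open set around \<open>T\<close> costs an arbitrarily small
      \<open>e\<close>.\<close>
    have m: "m \<le> c * emeasure lebesgue V" if V: "open V" "P z \<subseteq> V" "emeasure lebesgue V < \<infinity>" for V
    proof (rule ennreal_le_epsilon)
      fix e :: real assume e: "0 < e"
      obtain T where T: "P z \<subseteq> T" "T \<in> sets lebesgue" "emeasure lebesgue T \<le> c * emeasure lebesgue V"
        using step[OF V] by blast
      have cf: "c * emeasure lebesgue V < \<infinity>" using V(3) c1
        by (simp add: ennreal_mult_less_top less_top) (meson ennreal_one_less_top less_trans)
      obtain U where U: "open U" "T \<subseteq> U" "(U - T) \<in> lmeasurable" "emeasure lebesgue (U - T) < ennreal e"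
        using sets_lebesgue_outer_open[OF T(2) e] by metis
      have "emeasure lebesgue U \<le> emeasure lebesgue T + emeasure lebesgue (U - T)"
        using U T(2) emeasure_subadditive[of T lebesgue "U - T"] by (simp add: fmeasurableD Un_absorb1)
      also have "\<dots> \<le> c * emeasure lebesgue V + e"
        using T U by (intro add_mono) auto
      finally have *: "emeasure lebesgue U \<le> c * emeasure lebesgue V + e" .
      also have "\<dots> < \<infinity>" using cf by simp
      finally have "m \<le> emeasure lebesgue U" unfolding m_def using U T by (intro INF_lower) auto
      then show "m \<le> c * emeasure lebesgue V + e" using * by simp
    qed
    have "m \<le> c * m"
    proof (rule ennreal_le_epsilon)
      fix e :: real assume e: "0 < e"
      have "m < m + e" using mfin e by (cases m) (auto simp: ennreal_plus[symmetric] ennreal_less_iff simp del: ennreal_plus)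
      then obtain V where V: "open V" "P z \<subseteq> V" "emeasure lebesgue V < \<infinity>" "emeasure lebesgue V < m + e"
        unfolding m_def INF_less_iff by auto
      have "m \<le> c * emeasure lebesgue V" by (rule m) fact+
      also have "\<dots> \<le> c * (m + e)" using V by (intro mult_left_mono) auto
      also have "\<dots> = c * m + c * e" by (simp add: distrib_left)
      also have "\<dots> \<le> c * m + 1 * ennreal e" by (intro add_left_mono mult_right_mono less_imp_le[OF c1]) auto
      finally show "m \<le> c * m + e" by simp
    qed
    have m0: "m = 0"
    proof (rule ccontr)
      assume "m \<noteq> 0"
      then have "c * m < 1 * m" using c1 mfin 
        by (intro ennreal_mult_strict_right_mono) (auto simp: zero_less_iff_neq_zero)
      with \<open>m \<le> c * m\<close> show False by simp
    qed
    show ?thesis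
      unfolding negligible_outer
    proof (intro allI impI)
      fix e :: real assume "0 < e"
      then have "m < e" using m0 by simp
      then obtain V where V: "open V" "P z \<subseteq> V" "emeasure lebesgue V < \<infinity>" "emeasure lebesgue V < e"
        unfolding m_def INF_less_iff by auto
      then show "\<exists>T. P z \<subseteq> T \<and> T \<in> lmeasurable \<and> measure lebesgue T < e"
        using \<open>0 < e\<close> by (intro exI[of _ V]) (auto simp: fmeasurable_def emeasure_eq_ennreal_measure less_top ennreal_less_iff)
    qed
  qed
  moreover have "\<exists>T. openin (top_of_set {x\<in>S. porous_at k S x}) T \<and> z \<in> T \<and> negligible T"
    if "z \<in> {x\<in>S. porous_at k S x}" "negligible (P z)" for z
    using that by (intro exI[of _ "P z"]) (auto simp: P_def intro: openin_open_Int)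
  ultimately show ?thesis using locally_negligible_alt[of "{x\<in>S. porous_at k S x}"] by blast
qed

subsection \<open>Lipschitz functions of one variable\<close>

text \<open>Adding a multiple of the identity makes \<open>f\<close> a bi-Lipschitz homeomorphism \<open>F\<close> of the line. It maps null
  sets to null sets, so the measure \<open>X \<mapsto> |F(X)|\<close> has a Radon--Nikodym density, and \<open>F\<close> is an
  indefinite integral.\<close>

lemma lipschitz_right_derivative_AE:
  fixes f :: "real \<Rightarrow> real"
  assumes f: "L-lipschitz_on UNIV f"
  obtains N where "negligible N"
    "\<And>x. x \<notin> N \<Longrightarrow> \<exists>l. ((\<lambda>t. (f (x + t) - f x) / t) \<longlongrightarrow> l) (at_right 0)"
proof -
  define M where "M = L + 1"
  \<comment> \<open>The difference quotients of \<open>F\<close> lie between \<open>M\<close> and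
    \<open>3 * M\<close>, and \<open>M = L + 1\<close> is positive even if
    \<open>L = 0\<close>.\<close>
  define F where "F x = f x + 2 * M * x" for x
  have L0: "0 \<le> L" using f by (rule lipschitz_on_nonneg)
  have fl: "\<bar>f x - f y\<bar> \<le> M * \<bar>x - y\<bar>" for x y
    using lipschitz_onD[OF f, of x y] L0 mult_right_mono[of L M "\<bar>x-y\<bar>"]
    unfolding M_def dist_real_def by force
  have Mpos: "M > 0" using L0 by (simp add: M_def)
  have low: "M * (y - x) \<le> F y - F x" if "x \<le> y" for x y
    using fl[of x y] that by (simp add: F_def algebra_simps abs_if split: if_splits)
  have upp: "\<bar>F x - F y\<bar> \<le> 3 * M * \<bar>x - y\<bar>" for x y
    using fl[of x y] by (simp add: F_def algebra_simps abs_if split: if_splits)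
  have smono: "strict_mono F"
  proof (rule strict_monoI)
    fix x y :: real assume "x < y"
    then show "F x < F y" using low[of x y] Mpos by (smt (verit) mult_pos_pos)
  qed
  have lipF: "(3 * M)-lipschitz_on UNIV F"
    using upp Mpos by (intro lipschitz_onI) (auto simp: dist_real_def)
  then have contF: "continuous_on UNIV F" by (rule lipschitz_on_continuous_on)
  have surjF: "surj F"
  proof -
    have "\<exists>x. F x = y" for y
    proof -
      define b where "b = \<bar>y - F 0\<bar> / M"
      have b0: "b \<ge> 0" "M * b = \<bar>y - F 0\<bar>" using Mpos by (auto simp: b_def)
      have "F (-b) \<le> y" "y \<le> F b" using low[of "-b" 0] low[of 0 b] b0 by auto
      moreover have "- b \<le> b" using b0 by simp
      ultimately show ?thesis using IVT'[of F "-b" y b] contF continuous_on_subset by blast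
    qed
    then show ?thesis by (auto simp: surj_def) (metis)
  qed
  define G where "G = inv F"
  have FG: "F (G x) = x" "G (F x) = x" for x
    using surjF smono by (auto simp: G_def surj_f_inv_f strict_mono_imp_inj_on inv_f_f)
  have lipG: "(1 / M)-lipschitz_on UNIV G"
  proof (rule lipschitz_onI)
    fix x y :: real
    have "M * \<bar>G x - G y\<bar> \<le> \<bar>x - y\<bar>"
      using low[of "G x" "G y"] low[of "G y" "G x"] FG by (cases "G x \<le> G y") auto
    then show "dist (G x) (G y) \<le> 1 / M * dist x y" using Mpos by (simp add: dist_real_def field_simps)
  qed (use Mpos in auto)
  then have "continuous_on UNIV G" by (rule lipschitz_on_continuous_on)
  then have Gm [measurable]: "G \<in> borel_measurable borel" by (rule borel_measurable_continuous_onI)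
  have vim: "G -` X = F ` X" for X 
  proof -
    have "x \<in> F ` X" if "G x \<in> X" for x using FG(1)[of x] that by (metis imageI)
    then show ?thesis using FG(2) by auto
  qed
  define \<mu> where "\<mu> = distr lborel lborel G"
  have em: "emeasure \<mu> X = emeasure lborel (F ` X)" if "X \<in> sets borel" for X
    unfolding \<mu>_def using that by (subst emeasure_distr) (auto simp: vim)
  have ac: "absolutely_continuous lborel \<mu>"
  proof -
    have "X \<in> null_sets \<mu>" if "X \<in> null_sets lborel" for X
    proof -
      have X: "X \<in> sets borel" "negligible X" using that
        by (auto simp: negligible_iff_null_sets null_sets_completionI null_sets_def)
      have "negligible (F ` X)"
        using X upp by (intro negligible_locally_Lipschitz_image) (auto intro!: exI[of _ UNIV] exI[of _ "3*M"])
      moreover have "F ` X \<in> sets borel" using X(1) Gm vim measurable_sets[of G borel borel X] by simp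
      ultimately have "emeasure lborel (F ` X) = 0"
        by (simp add: negligible_iff_emeasure0)
      then show ?thesis using X em by (auto simp: \<mu>_def null_sets_def)
    qed
    then show ?thesis by (auto simp: absolutely_continuous_def)
  qed
  have sets\<mu>: "sets \<mu> = sets lborel" by (simp add: \<mu>_def)
  obtain H where H: "H \<in> borel_measurable lborel" "density lborel H = \<mu>"
    using sigma_finite_measure.Radon_Nikodym[OF sigma_finite_lborel ac sets\<mu>] by blast
  \<comment> \<open>\<open>enn2real\<close> sends infinity to 0; this is harmless because
    \<open>H\<close> has finite integrals over bounded intervals and so is finite a.e.\<close>
  define h where "h x = enn2real (H x)" for x
  have hm: "h \<in> borel_measurable lborel" unfolding h_def using H(1) by measurable
  have img: "F ` {a..b} = {F a..F b}" if "a \<le> b" for a b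
  proof
    show "{F a..F b} \<subseteq> F ` {a..b}"
    proof
      fix y assume "y \<in> {F a..F b}"
      then have "F a \<le> F (G y)" "F (G y) \<le> F b" using FG(1) by auto
      then have Gy: "G y \<in> {a..b}" using smono by (simp add: strict_mono_less_eq)
      then show "y \<in> F ` {a..b}" using FG(1)[of y] imageI[OF Gy, of F] by simp
    qed
  qed (use smono in \<open>auto simp: strict_mono_less_eq\<close>)
  have HI: "(\<integral>\<^sup>+x. H x * indicator {a..b} x \<partial>lborel) = ennreal (F b - F a)" if "a \<le> b" for a b
  proof -
    have "(\<integral>\<^sup>+x. H x * indicator {a..b} x \<partial>lborel) = emeasure (density lborel H) {a..b}"
      using H(1) by (subst emeasure_density) auto
    also have "\<dots> = emeasure lborel {F a..F b}" using H(2) em[of "{a..b}"] img[OF that] by simp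
    finally show ?thesis using that smono by (simp add: strict_mono_less_eq)
  qed
  have fin: "AE x in lborel. H x \<noteq> \<infinity>"
  proof -
    have "AE x in lborel. x \<in> {-real n..real n} \<longrightarrow> H x \<noteq> \<infinity>" for n
    proof -
      have "AE x in lborel. H x * indicator {-real n..real n} x \<noteq> \<infinity>"
        using H(1) HI[of "-real n" "real n"] by (intro nn_integral_PInf_AE) auto
      then show ?thesis by eventually_elim (auto simp: indicator_def)
    qed
    then have "AE x in lborel. \<forall>n. x \<in> {-real n..real n} \<longrightarrow> H x \<noteq> \<infinity>"
      unfolding AE_all_countable by blast
    then show ?thesis
    proof eventually_elim
      case (elim x)
      obtain n where "\<bar>x\<bar> \<le> real n" using real_arch_simple by blast
      then show ?case using elim by (auto simp: abs_le_iff)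
    qed
  qed
  have hI: "(h has_integral (F b - F a)) {a..b}" if "a \<le> b" for a b
  proof -
    have "(\<integral>\<^sup>+x. ennreal (h x * indicator {a..b} x) \<partial>lborel) = (\<integral>\<^sup>+x. H x * indicator {a..b} x \<partial>lborel)"
      using fin by (intro nn_integral_cong_AE, eventually_elim) (auto simp: h_def indicator_def less_top)
    then have "has_bochner_integral lborel (\<lambda>x. h x * indicator {a..b} x) (F b - F a)"
    proof (intro has_bochner_integral_nn_integral)
      show "(\<lambda>x. h x * indicator {a..b} x) \<in> borel_measurable lborel" using hm by measurable
    qed (use HI[OF that] that smono in \<open>auto simp: h_def strict_mono_less_eq\<close>)
    then have "((\<lambda>x. h x * indicator {a..b} x) has_integral (F b - F a)) UNIV"
      using has_integral_integral_lborel by (metis has_bochner_integral_iff)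
    moreover have "(\<lambda>x. h x * indicator {a..b} x) = (\<lambda>x. if x \<in> {a..b} then h x else 0)"
      by (auto simp: indicator_def)
    ultimately show ?thesis
      using has_integral_restrict_UNIV[of "{a..b}" h "F b - F a"] by simp
  qed
  have "h integrable_on cbox a b" for a b
    using hI[of a b] by (cases "a \<le> b") (auto simp: box_real integrable_on_def)
  \<comment> \<open>This is Lebesgue differentiation for cubes that have \<open>x\<close> as their
    lower corner; hence the derivative obtained is one-sided.\<close>
  then obtain N where N: "negligible N"
     "\<And>x e. \<lbrakk>x \<notin> N; 0 < e\<rbrakk> \<Longrightarrow> \<exists>d>0. \<forall>t. 0 < t \<and> t < d \<longrightarrow>
         norm (integral (cbox x (x + t *\<^sub>R One)) h /\<^sub>R t ^ DIM(real) - h x) < e"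
    by (rule integrable_ccontinuous_explicit) blast
  show ?thesis
  proof
    show "negligible N" by fact
    fix x assume x: "x \<notin> N"
    have "((\<lambda>t. (F (x + t) - F x) / t) \<longlongrightarrow> h x) (at_right 0)"
    proof (rule tendstoI)
      fix e :: real assume "0 < e"
      then obtain d where d: "d > 0" "\<And>t. 0 < t \<Longrightarrow> t < d \<Longrightarrow>
         norm (integral (cbox x (x + t *\<^sub>R One)) h /\<^sub>R t ^ DIM(real) - h x) < e" using N(2)[OF x, of e] by metis
      have "dist ((F (x + t) - F x) / t) (h x) < e" if "0 < t" "t < d" for t
      proof -
        have "integral (cbox x (x + t *\<^sub>R One)) h = F (x + t) - F x"
          using hI[of x "x+t"] that by (simp add: integral_unique)
        then show ?thesis using d(2)[OF that] by (simp only: dist_norm divide_inverse mult.commute real_scaleR_def DIM_real power_one_right)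
      qed
      then show "\<forall>\<^sub>F t in at_right 0. dist ((F (x + t) - F x) / t) (h x) < e"
        using d(1) eventually_at_right_real[OF d(1)] by (auto elim!: eventually_mono)
    qed
    then have "((\<lambda>t. (F (x + t) - F x) / t - 2 * M) \<longlongrightarrow> h x - 2 * M) (at_right 0)"
      by (intro tendsto_intros)
    moreover have "\<forall>\<^sub>F t in at_right 0. (F (x + t) - F x) / t - 2 * M = (f (x + t) - f x) / t"
      using eventually_at_right_less[of 0] by eventually_elim (auto simp: F_def field_simps)
    ultimately have "((\<lambda>t. (f (x + t) - f x) / t) \<longlongrightarrow> h x - 2 * M) (at_right 0)"
      by (rule Lim_transform_eventually)
    then show "\<exists>l. ((\<lambda>t. (f (x + t) - f x) / t) \<longlongrightarrow> l) (at_right 0)"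
      by blast
  qed
qed

subsection \<open>Rademacher's theorem\<close>

text \<open>The slope \<open>q\<close> will be rational and the range of \<open>t\<close> is cut at
  \<open>1 / Suc k\<close>, so countably many sets suffice. The bound with fixed \<open>e\<close>
  and \<open>k\<close> is uniform over the set, and it is this uniformity that survives a change of
  base point.\<close>

definition slope_set :: "('a::euclidean_space \<Rightarrow> real) \<Rightarrow> 'a \<Rightarrow> real \<Rightarrow> real \<Rightarrow> nat \<Rightarrow> 'a set" where
  "slope_set u b e q k =
     {x. \<forall>t. 0 < t \<and> t < 1 / Suc k \<longrightarrow> \<bar>u (x + t *\<^sub>R b) - u x - q * t\<bar> \<le> e * t}"

lemma closed_slope_set:
  assumes "continuous_on UNIV u"
  shows "closed (slope_set u b e q k)"
proof -
  have "slope_set u b e q k =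
      (\<Inter>t\<in>{0<..<1 / Suc k}. {x. \<bar>u (x + t *\<^sub>R b) - u x - q * t\<bar> \<le> e * t})"
    by (auto simp: slope_set_def)
  moreover have "continuous_on UNIV (\<lambda>x. u (x + t *\<^sub>R b))" for t
    by (rule continuous_on_compose2[OF assms]) (auto intro!: continuous_intros)
  ultimately show ?thesis
    using assms by (auto intro!: closed_INT closed_Collect_le continuous_intros)
qed

text \<open>Integrate the indicator of \<open>X\<close> at \<open>x + t *\<^sub>R b\<close> over
  \<open>t\<close> in \<open>{0..1}\<close> and over all \<open>x\<close>. Translation invariance in
  \<open>x\<close> gives the measure of \<open>X\<close>; the other order of integration gives 0. No
  coordinates adapted to \<open>b\<close> have to be chosen.\<close>

lemma negligible_if_null_on_lines:
  fixes X :: "'a::euclidean_space set"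
  assumes X: "X \<in> sets borel"
    and lines: "\<And>x. negligible {t. x + t *\<^sub>R b \<in> X}"
  shows "negligible X"
proof -
  define f :: "real \<times> 'a \<Rightarrow> ennreal" where "f = (\<lambda>(t, x). indicator {0..1} t * indicator X (x + t *\<^sub>R b))"
  have f: "f \<in> borel_measurable (lborel \<Otimes>\<^sub>M lborel)"
    using X unfolding f_def by measurable
  have "(\<integral>\<^sup>+t. \<integral>\<^sup>+x. f (t, x) \<partial>lborel \<partial>lborel) = (\<integral>\<^sup>+t. indicator {0..1::real} t * emeasure lborel X \<partial>lborel)"
  proof (rule nn_integral_cong)
    fix t :: real
    have "(\<integral>\<^sup>+x. indicator X (x + t *\<^sub>R b) \<partial>lborel) = (\<integral>\<^sup>+x. indicator X x \<partial>distr lborel borel ((+) (t *\<^sub>R b)))"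
      using X by (subst nn_integral_distr) (auto simp: add.commute)
    then show "(\<integral>\<^sup>+x. f (t, x) \<partial>lborel) = indicator {0..1} t * emeasure lborel X"
      using X by (simp add: f_def nn_integral_cmult lborel_distr_plus)
  qed
  also have "\<dots> = emeasure lborel X" by (simp add: nn_integral_multc)
  finally have "emeasure lborel X = (\<integral>\<^sup>+t. \<integral>\<^sup>+x. f (t, x) \<partial>lborel \<partial>lborel)" by simp
  also have "\<dots> = (\<integral>\<^sup>+x. \<integral>\<^sup>+t. f (t, x) \<partial>lborel \<partial>lborel)"
    using lborel_pair.Fubini'[of "\<lambda>t x. f (t, x)"] f by simp
  also have "\<dots> = (\<integral>\<^sup>+x. 0 \<partial>(lborel :: 'a measure))"
  proof (rule nn_integral_cong)
    fix x
    have "AE t in lebesgue. x + t *\<^sub>R b \<notin> X" using lines[of x]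
      by (simp add: negligible_iff_null_sets AE_iff_null_sets eventually_ae_filter) auto
    moreover have "Measurable.pred lborel (\<lambda>t. x + t *\<^sub>R b \<notin> X)" using X by measurable
    ultimately have "AE t in lborel. x + t *\<^sub>R b \<notin> X" by (simp add: AE_completion_iff)
    then show "(\<integral>\<^sup>+t. f (t, x) \<partial>lborel) = 0"
      using X by (subst nn_integral_0_iff_AE) (auto simp: f_def elim!: eventually_mono)
  qed
  finally show ?thesis using X by (simp add: negligible_iff_emeasure0)
qed

text \<open>The exceptional set is Borel, being built from closed sets by countable operations, and
  on each line parallel to \<open>b\<close> the one-variable result makes it null. A right
  derivative \<open>l\<close> puts the point into a slope set for every rational \<open>q\<close>
  close to \<open>l\<close>.\<close>

lemma lipschitz_slope_AE:
  fixes u :: "'a::euclidean_space \<Rightarrow> real"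
  assumes u: "L-lipschitz_on UNIV u"
  shows "negligible {x. \<exists>j. \<forall>q\<in>\<rat>. \<forall>k. x \<notin> slope_set u b (1 / Suc j) q k}" (is "negligible ?X")
proof (rule negligible_if_null_on_lines)
  have cont: "continuous_on UNIV u" using u by (rule lipschitz_on_continuous_on)
  have eq: "?X = (\<Union>j. - (\<Union>q\<in>\<rat>. \<Union>k. slope_set u b (1 / Suc j) q k))" by auto
  show "?X \<in> sets borel"
    unfolding eq
    by (intro sets.countable_UN'' borel_comp countable_rat borel_closed closed_slope_set[OF cont] countableI_type)
  fix x
  have "(L * norm b)-lipschitz_on UNIV (\<lambda>t. u (x + t *\<^sub>R b))"
  proof (rule lipschitz_onI)
    fix s t :: real
    have "dist (u (x + s *\<^sub>R b)) (u (x + t *\<^sub>R b)) \<le> L * dist (x + s *\<^sub>R b) (x + t *\<^sub>R b)"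
      by (rule lipschitz_onD[OF u]) auto
    also have "dist (x + s *\<^sub>R b) (x + t *\<^sub>R b) = \<bar>s - t\<bar> * norm b"
      by (simp add: dist_norm flip: scaleR_diff_left)
    finally show "dist (u (x + s *\<^sub>R b)) (u (x + t *\<^sub>R b)) \<le> L * norm b * dist s t"
      by (simp add: dist_real_def mult_ac)
  qed (use lipschitz_on_nonneg[OF u] in auto)
  then obtain N where N: "negligible N"
    "\<And>t. t \<notin> N \<Longrightarrow> \<exists>l. ((\<lambda>h. (u (x + (t + h) *\<^sub>R b) - u (x + t *\<^sub>R b)) / h) \<longlongrightarrow> l) (at_right 0)"
 
    by (rule lipschitz_right_derivative_AE) auto
  have *: "t \<in> N" if t: "x + t *\<^sub>R b \<in> ?X" for t
  proof (rule ccontr)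
    assume "t \<notin> N"
    then obtain l where l: "((\<lambda>h. (u (x + (t + h) *\<^sub>R b) - u (x + t *\<^sub>R b)) / h) \<longlongrightarrow> l) (at_right 0)"
      using N(2) by blast
    obtain j where j: "\<And>q k. q \<in> \<rat> \<Longrightarrow> x + t *\<^sub>R b \<notin> slope_set u b (1 / Suc j) q k" using t by auto
    \<comment> \<open>Half the tolerance \<open>1 / Suc j\<close>: one half for the difference
      quotient, the other for replacing \<open>l\<close> by a rational.\<close>
    define e where "e = 1 / (2 * real (Suc j))"
    have e: "e > 0" by (simp add: e_def)
    obtain q where q: "q \<in> \<rat>" "l - e < q" "q < l + e" using Rats_dense_in_real[of "l - e" "l + e"] e by auto
    have "\<forall>\<^sub>F h in at_right 0. dist ((u (x + (t + h) *\<^sub>R b) - u (x + t *\<^sub>R b)) / h) l < e"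
      using l e by (rule tendstoD)
    then obtain d where d: "d > 0" "\<And>h. 0 < h \<Longrightarrow> h < d \<Longrightarrow>
        dist ((u (x + (t + h) *\<^sub>R b) - u (x + t *\<^sub>R b)) / h) l < e"
      unfolding eventually_at_right_field by auto
    obtain k where k: "1 / Suc k < d" using d(1) nat_approx_posE by metis
    have "\<bar>u (x + t *\<^sub>R b + h *\<^sub>R b) - u (x + t *\<^sub>R b) - q * h\<bar> \<le> 1 / Suc j * h" if "0 < h" "h < 1 / Suc k" for h
    proof -
      define D where "D = (u (x + (t + h) *\<^sub>R b) - u (x + t *\<^sub>R b)) / h"
      have "\<bar>D - l\<bar> < e" using d(2)[of h] that k by (simp add: D_def dist_real_def)
      then have "\<bar>D - q\<bar> \<le> 2 * e" using q by linarith
      then have "\<bar>D - q\<bar> * h \<le> 2 * e * h" using that by (intro mult_right_mono) auto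
      moreover have "\<bar>D - q\<bar> * h = \<bar>(D - q) * h\<bar>" using that by (simp add: abs_mult)
      moreover have "(D - q) * h = u (x + t *\<^sub>R b + h *\<^sub>R b) - u (x + t *\<^sub>R b) - q * h"
      proof -
        have "D * h = u (x + t *\<^sub>R b + h *\<^sub>R b) - u (x + t *\<^sub>R b)"
          using that by (simp add: D_def scaleR_add_left add.assoc)
        then show ?thesis by (simp add: left_diff_distrib)
      qed
      moreover have "2 * e = 1 / Suc j" by (simp add: e_def field_simps)
      ultimately show ?thesis by (simp only:)
    qed
    then have "x + t *\<^sub>R b \<in> slope_set u b (1 / Suc j) q k" unfolding slope_set_def by blast
    then show False using j[OF q(1), of k] by blast
  qed
  show "negligible {t. x + t *\<^sub>R b \<in> ?X}"
  proof (rule negligible_subset[OF N(1)], rule subsetI)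
    fix t assume "t \<in> {t. x + t *\<^sub>R b \<in> ?X}"
    then show "t \<in> N" unfolding mem_Collect_eq[of t] by (rule *)
  qed
qed

text \<open>The nonporosity argument yields a separate linear map for each tolerance. Two such maps
  differ by at most the sum of their tolerances, so they form a Cauchy sequence and their limit is
  the gradient.\<close>

lemma differentiable_if_approx:
  fixes u :: "'a::euclidean_space \<Rightarrow> real"
  assumes approx: "\<And>e. 0 < e \<Longrightarrow> \<exists>Q d. d > 0 \<and> (\<forall>h. norm h < d \<longrightarrow> \<bar>u (x + h) - u x - Q \<bullet> h\<bar> \<le> e * norm h)"
  shows "u differentiable (at x)"
proof -
  have "\<forall>j. \<exists>Q d. d > 0 \<and> (\<forall>h. norm h < d \<longrightarrow> \<bar>u (x + h) - u x - Q \<bullet> h\<bar> \<le> 1 / Suc j * norm h)"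
    using approx[of "1 / Suc j" for j] by (metis of_nat_0_less_iff zero_less_Suc zero_less_divide_1_iff)
  then obtain Q d where Q: "\<And>j. d j > 0"
     "\<And>j h. norm h < d j \<Longrightarrow> \<bar>u (x + h) - u x - Q j \<bullet> h\<bar> \<le> 1 / Suc j * norm h" by metis
  have QQ: "norm (Q i - Q j) \<le> 1 / Suc i + 1 / Suc j" for i j
  proof (cases "Q i = Q j")
    case False
    \<comment> \<open>Makes \<open>h\<close> parallel to \<open>Q i - Q j\<close>, which turns
      Cauchy--Schwarz into an equality, and gives it half the smaller of the two radii as
      length.\<close>
    define s where "s = min (d i) (d j) / (2 * norm (Q i - Q j))"
    define h where "h = s *\<^sub>R (Q i - Q j)"
    have s: "s > 0" using False Q(1) by (simp add: s_def)
    have nh: "norm h = s * norm (Q i - Q j)" using s by (simp add: h_def)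
    have "norm h < d i" "norm h < d j" using Q(1)[of i] Q(1)[of j] False by (auto simp: nh s_def min_def)
    then have "\<bar>Q i \<bullet> h - Q j \<bullet> h\<bar> \<le> 1 / Suc i * norm h + 1 / Suc j * norm h"
      using Q(2)[of h i] Q(2)[of h j] by linarith
    moreover have "\<bar>Q i \<bullet> h - Q j \<bullet> h\<bar> = norm (Q i - Q j) * norm h"
    proof -
      have "Q i \<bullet> h - Q j \<bullet> h = s * (norm (Q i - Q j))\<^sup>2"
        unfolding power2_norm_eq_inner by (simp add: h_def algebra_simps)
      then show ?thesis unfolding nh using s by (simp add: power2_eq_square)
    qed
    ultimately have "norm (Q i - Q j) * norm h \<le> (1 / Suc i + 1 / Suc j) * norm h" by (simp add: distrib_right)
    then show ?thesis using nh s False by (simp add: mult_le_cancel_right)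
  qed simp
  have "Cauchy Q"
  proof (rule metric_CauchyI)
    fix e :: real assume "0 < e"
    then obtain M where M: "1 / Suc M < e / 2" using nat_approx_posE[of "e/2"] by auto
    have "dist (Q m) (Q n) < e" if "M \<le> m" "M \<le> n" for m n
    proof -
      have "1 / Suc m \<le> 1 / Suc M" "1 / Suc n \<le> 1 / Suc M" using that by (auto simp: field_simps)
      then show ?thesis using QQ[of m n] M unfolding dist_norm by linarith
    qed
    then show "\<exists>M. \<forall>m\<ge>M. \<forall>n\<ge>M. dist (Q m) (Q n) < e" by blast
  qed
  then obtain D where D: "Q \<longlonglongrightarrow> D" using Cauchy_convergent_iff convergent_def by blast
  have QD: "norm (Q i - D) \<le> 1 / Suc i" for i
  proof (rule tendsto_le[OF trivial_limit_sequentially])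
    show "(\<lambda>j. norm (Q i - Q j)) \<longlonglongrightarrow> norm (Q i - D)" by (intro tendsto_intros D)
    show "(\<lambda>j. 1 / Suc i + 1 / Suc j) \<longlonglongrightarrow> 1 / Suc i"
      using tendsto_add[OF tendsto_const LIMSEQ_inverse_real_of_nat, of "1 / Suc i"] by (simp add: divide_inverse)
  qed (use QQ in auto)
  have "(u has_derivative (\<bullet>) D) (at x)"
    unfolding has_derivative_at_alt
  proof (intro conjI allI impI)
    show "bounded_linear ((\<bullet>) D)" by (rule bounded_linear_inner_right)
    fix e :: real assume "0 < e"
    then obtain j where j: "1 / Suc j < e / 2" using nat_approx_posE[of "e/2"] by auto
    have "norm (u y - u x - D \<bullet> (y - x)) \<le> e * norm (y - x)" if "norm (y - x) < d j" for y
    proof -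
      have "\<bar>u y - u x - Q j \<bullet> (y - x)\<bar> \<le> 1 / Suc j * norm (y - x)" using Q(2)[OF that] by simp
      moreover have "\<bar>(Q j - D) \<bullet> (y - x)\<bar> \<le> 1 / Suc j * norm (y - x)"
        using Cauchy_Schwarz_ineq2[of "Q j - D" "y - x"] mult_right_mono[OF QD[of j], of "norm (y - x)"] by simp
      moreover have "2 * (1 / Suc j) * norm (y - x) \<le> e * norm (y - x)" using j by (intro mult_right_mono) auto
      ultimately show ?thesis by (simp add: inner_diff_left)
    qed
    then show "\<exists>d>0. \<forall>y. norm (y - x) < d \<longrightarrow> norm (u y - u x - D \<bullet> (y - x)) \<le> e * norm (y - x)"
      using Q(1) by blast
  qed
  then show ?thesis by (auto simp: differentiable_def)
qed

text \<open>The path from \<open>x\<close> to \<open>x + h\<close> along the coordinate directions need not meet \<open>E\<close>, but at a nonporous point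
  each of its vertices is close to a point of \<open>E\<close>, where the slope is under control. Only right
  derivatives are needed: a step in a negative direction is read backwards.\<close>

lemma nonporous_chain:
  fixes u :: "'a::euclidean_space \<Rightarrow> real" and q :: "'a \<Rightarrow> real"
  assumes u: "L-lipschitz_on UNIV u"
    and E: "E \<subseteq> (\<Inter>b\<in>Basis. slope_set u b e (q b) k)" and "0 \<le> e"
    and near: "\<And>p. norm (p - x) \<le> norm h \<Longrightarrow> \<exists>y\<in>E. norm (y - p) \<le> s * norm h"
    and h: "norm h < 1 / Suc k"
    and B: "finite B" "B \<subseteq> Basis"
  shows "\<bar>u (x + (\<Sum>b\<in>B. (h \<bullet> b) *\<^sub>R b)) - u x - (\<Sum>b\<in>B. q b * (h \<bullet> b))\<bar>
           \<le> card B * ((e + 2 * L * s) * norm h)"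
  using B
proof (induction B rule: finite_induct)
  case (insert b B)
  define P where "P S = x + (\<Sum>b\<in>S. (h \<bullet> b) *\<^sub>R b)" for S
  have Pn: "norm (P S - x) \<le> norm h" if "S \<subseteq> Basis" for S
  proof -
    have "finite S" using that finite_Basis finite_subset by blast
    then have "\<bar>(\<Sum>b\<in>S. (h \<bullet> b) *\<^sub>R b) \<bullet> c\<bar> \<le> \<bar>h \<bullet> c\<bar>" if "c \<in> Basis" for c
    proof -
      have "(\<Sum>b\<in>S. (h \<bullet> b) *\<^sub>R b) \<bullet> c = (\<Sum>b\<in>S. if b = c then h \<bullet> c else 0)"
        unfolding inner_sum_left using \<open>S \<subseteq> Basis\<close> that
        by (intro sum.cong) (auto simp: inner_Basis)
      then show ?thesis using \<open>finite S\<close> by (simp add: sum.delta)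
    qed
    then show ?thesis unfolding P_def by (simp add: norm_le_componentwise)
  qed
  have LL: "\<bar>u y - u z\<bar> \<le> L * norm (y - z)" for y z using lipschitz_onD[OF u, of y z] by (simp add: dist_norm)
  have L0: "0 \<le> L" using u by (rule lipschitz_on_nonneg)
  have step: "\<bar>u (p + t *\<^sub>R b) - u p - q b * t\<bar> \<le> (e + 2 * L * s) * norm h"
    if t: "0 \<le> t" "t \<le> norm h" and p: "norm (p - x) \<le> norm h" for p t
  proof -
    obtain y where y: "y \<in> E" "norm (y - p) \<le> s * norm h" using near[OF p] by blast
    have "\<bar>u (y + t *\<^sub>R b) - u y - q b * t\<bar> \<le> e * t"
    proof (cases "t = 0")
      case False
      have "y \<in> slope_set u b e (q b) k" using y(1) E insert.prems by auto
      then show ?thesis using t h False by (auto simp: slope_set_def)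
    qed simp
    moreover have "e * t \<le> e * norm h" using t \<open>0 \<le> e\<close> by (intro mult_left_mono) auto
    moreover have "\<bar>u y - u p\<bar> \<le> L * (s * norm h)"
      using LL[of y p] mult_left_mono[OF y(2) L0] by linarith
    moreover have "\<bar>u (y + t *\<^sub>R b) - u (p + t *\<^sub>R b)\<bar> \<le> L * (s * norm h)"
      using LL[of "y + t *\<^sub>R b" "p + t *\<^sub>R b"] mult_left_mono[OF y(2) L0] by simp
    ultimately have "\<bar>u (p + t *\<^sub>R b) - u p - q b * t\<bar> \<le> e * norm h + 2 * (L * (s * norm h))" by linarith
    then show ?thesis by (simp add: algebra_simps)
  qed
  have PI: "P (insert b B) = P B + (h \<bullet> b) *\<^sub>R b" using insert.hyps by (simp add: P_def algebra_simps)
  have hb: "\<bar>h \<bullet> b\<bar> \<le> norm h" using insert.prems by (simp add: Basis_le_norm)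
  have "\<bar>u (P (insert b B)) - u (P B) - q b * (h \<bullet> b)\<bar> \<le> (e + 2 * L * s) * norm h"
  proof (cases "0 \<le> h \<bullet> b")
    case True
    then show ?thesis using step[of "h \<bullet> b" "P B"] hb Pn[of B] insert.prems by (simp add: PI)
  next
    case False
    then have "\<bar>u (P (insert b B) + (- (h \<bullet> b)) *\<^sub>R b) - u (P (insert b B)) - q b * (- (h \<bullet> b))\<bar> \<le> (e + 2 * L * s) * norm h"
      using step[of "- (h \<bullet> b)" "P (insert b B)"] hb Pn[of "insert b B"] insert.prems by simp
    then show ?thesis by (simp add: PI)
  qed
  moreover have "\<bar>u (P B) - u x - (\<Sum>b\<in>B. q b * (h \<bullet> b))\<bar> \<le> card B * ((e + 2 * L * s) * norm h)"
    using insert by (simp add: P_def)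
  ultimately have "\<bar>u (P (insert b B)) - u x - (q b * (h \<bullet> b) + (\<Sum>b\<in>B. q b * (h \<bullet> b)))\<bar>
      \<le> (e + 2 * L * s) * norm h + card B * ((e + 2 * L * s) * norm h)" by linarith
  then show ?case using insert.hyps by (simp add: P_def algebra_simps)
qed simp

text \<open>Outside \<open>N0\<close> every point lies, for each \<open>j\<close>, in some
  \<open>E j q k\<close> with rational \<open>q\<close>. Since \<open>j\<close>, \<open>q\<close>,
  \<open>k\<close> and the porosity constant range over countable sets, the porous points of all
  these sets can be discarded together. Elsewhere \<open>nonporous_chain\<close> gives a linear
  approximation for every tolerance.\<close>

theorem Rademacher:
  fixes u :: "'a::euclidean_space \<Rightarrow> real"
  assumes u: "L-lipschitz_on UNIV u"
  shows "negligible {x. \<not> u differentiable (at x)}"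
proof -
  define E where "E j q k = (\<Inter>b\<in>Basis. slope_set u b (1 / Suc j) (q b) k)" for j q k
  define Q where "Q = (Basis :: 'a set) \<rightarrow>\<^sub>E (\<rat> :: real set)"
  have cQ: "countable Q" unfolding Q_def by (intro countable_PiE) (auto intro: countable_rat)
  define N0 where "N0 = (\<Union>b\<in>Basis. {x. \<exists>j. \<forall>q\<in>\<rat>. \<forall>k. x \<notin> slope_set u b (1 / Suc j) q k})"
  define N1 where "N1 = (\<Union>j. \<Union>q\<in>Q. \<Union>k. \<Union>i. {x\<in>E j q k. porous_at (1 / Suc i) (E j q k) x})"
  have "negligible N0" unfolding N0_def
    by (intro negligible_Union finite_imageI finite_Basis) (auto intro: lipschitz_slope_AE[OF u, simplified])
  moreover have "negligible N1" unfolding N1_def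
    by (intro negligible_countable_Union countable_image cQ ballI)
       (auto intro!: negligible_countable_Union countable_image cQ negligible_porous)
  moreover have "{x. \<not> u differentiable (at x)} \<subseteq> N0 \<union> N1"
  proof (rule subsetI, rule ccontr)
    fix x assume "x \<in> {x. \<not> u differentiable (at x)}" and x: "x \<notin> N0 \<union> N1"
    have "u differentiable (at x)"
    proof (rule differentiable_if_approx)
      fix \<epsilon> :: real assume "0 < \<epsilon>"
      define n where "n = real (DIM('a))"
      have n: "n > 0" by (simp add: n_def)
      obtain j where j: "1 / Suc j < \<epsilon> / (2 * n)" using nat_approx_posE[of "\<epsilon> / (2 * n)"] \<open>0 < \<epsilon>\<close> n by auto
      have "\<forall>b\<in>Basis. \<exists>q\<in>\<rat>. \<exists>k. x \<in> slope_set u b (1 / Suc j) q k" using x by (auto simp: N0_def)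
      then obtain q0 k0 where q0: "\<And>b. b \<in> Basis \<Longrightarrow> q0 b \<in> \<rat>"
        "\<And>b. b \<in> Basis \<Longrightarrow> x \<in> slope_set u b (1 / Suc j) (q0 b) (k0 b)" by metis
      define q where "q = restrict q0 Basis"
      define k where "k = Max (k0 ` Basis)"
      have qQ: "q \<in> Q" using q0(1) by (auto simp: Q_def q_def)
      have xE: "x \<in> E j q k"
      proof -
        have "x \<in> slope_set u b (1 / Suc j) (q b) k" if b: "b \<in> Basis" for b
        proof -
          have "k0 b \<le> k" using b by (simp add: k_def)
          then have "1 / Suc k \<le> 1 / Suc (k0 b)" by (simp add: field_simps)
          then show ?thesis using q0(2)[OF b] b by (auto simp: slope_set_def q_def)
        qed
        then show ?thesis by (auto simp: E_def)
      qed
      have L0: "0 \<le> L" using u by (rule lipschitz_on_nonneg)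
      \<comment> \<open>Moving a slope from a point of \<open>E\<close> to a vertex of the path
        costs \<open>2 * L * s\<close>; this is kept below the slope tolerance
        \<open>1 / Suc j\<close>, and each of the \<open>n\<close> steps then contributes less than
        \<open>\<epsilon> / n\<close>.\<close>
      define s where "s = min 1 (1 / (2 * (L + 1) * Suc j))"
      have s: "s > 0" "s \<le> 1" "2 * L * s \<le> 1 / Suc j"
      proof -
        show "s > 0" "s \<le> 1" using L0 by (auto simp: s_def)
        have "2 * L * s \<le> 2 * L * (1 / (2 * (L + 1) * Suc j))" using L0 by (intro mult_left_mono) (auto simp: s_def)
        also have "\<dots> = (L / (L + 1)) * (1 / Suc j)"
          by (simp only: times_divide_eq_right times_divide_eq_left mult_1_right divide_divide_eq_left
              mult.assoc mult_divide_mult_cancel_left[of 2, OF numeral_neq_zero])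
        also have "\<dots> \<le> 1 * (1 / Suc j)" using L0 by (intro mult_right_mono) auto
        finally show "2 * L * s \<le> 1 / Suc j" by simp
      qed
      \<comment> \<open>The factor 2 comes from applying nonporosity in the ball of radius
        \<open>2 * norm h\<close> about \<open>x\<close>, which has room for a small ball about each
        vertex of the path.\<close>
      obtain i where i: "1 / Suc i < s / 2" using nat_approx_posE[of "s / 2"] s by auto
      have "\<not> porous_at (1 / Suc i) (E j q k) x" using x qQ xE by (auto simp: N1_def)
      then obtain d where d: "d > 0" "\<And>r y. 0 < r \<Longrightarrow> r < d \<Longrightarrow> ball y (1 / Suc i * r) \<subseteq> ball x r \<Longrightarrow>
           ball y (1 / Suc i * r) \<inter> E j q k \<noteq> {}" unfolding porous_at_def by blast
      define d' where "d' = min (d / 2) (1 / Suc k)"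
      have "\<bar>u (x + h) - u x - (\<Sum>b\<in>Basis. q b *\<^sub>R b) \<bullet> h\<bar> \<le> \<epsilon> * norm h" if h: "norm h < d'" for h
      proof (cases "h = 0")
        case False
        have near: "\<exists>y\<in>E j q k. norm (y - p) \<le> s * norm h" if p: "norm (p - x) \<le> norm h" for p
        proof -
          have b: "1 / Suc i * (2 * norm h) \<le> s * norm h"
          proof -
            have "1 / Suc i * (2 * norm h) \<le> s / 2 * (2 * norm h)" using i by (intro mult_right_mono) auto
            then show ?thesis by simp
          qed
          also have "\<dots> \<le> norm h" using s by (simp add: mult_left_le_one_le)
          finally have "ball p (1 / Suc i * (2 * norm h)) \<subseteq> ball x (2 * norm h)"
            using p by (intro ball_subset_ball_iff[THEN iffD2]) (auto simp: dist_norm)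
          then have "ball p (1 / Suc i * (2 * norm h)) \<inter> E j q k \<noteq> {}"
            using d(2)[of "2 * norm h" p] h False by (auto simp: d'_def)
          then obtain y where y: "y \<in> E j q k" "dist p y < 1 / Suc i * (2 * norm h)" by auto
          then have "norm (y - p) \<le> s * norm h" using b by (simp add: dist_norm norm_minus_commute)
          then show ?thesis using y by blast
        qed
        have "\<bar>u (x + (\<Sum>b\<in>Basis. (h \<bullet> b) *\<^sub>R b)) - u x - (\<Sum>b\<in>Basis. q b * (h \<bullet> b))\<bar>
           \<le> card (Basis :: 'a set) * ((1 / Suc j + 2 * L * s) * norm h)"
        proof (rule nonporous_chain[OF u])
          show "E j q k \<subseteq> (\<Inter>b\<in>Basis. slope_set u b (1 / Suc j) (q b) k)" by (simp add: E_def)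
          show "norm h < 1 / Suc k" using h by (simp add: d'_def)
        qed (use near in auto)
        moreover have "(\<Sum>b\<in>Basis. q b *\<^sub>R b) \<bullet> h = (\<Sum>b\<in>Basis. q b * (h \<bullet> b))"
          unfolding inner_sum_left by (intro sum.cong) (auto simp: inner_commute)
        moreover have "n * ((1 / Suc j + 2 * L * s) * norm h) \<le> \<epsilon> * norm h"
        proof -
          have "1 / Suc j + 2 * L * s \<le> \<epsilon> / n" 
          proof -
            have "\<epsilon> / (2 * n) = (\<epsilon> / n) / 2" by simp
            then show ?thesis using j s(3) by linarith
          qed
          then have "n * (1 / Suc j + 2 * L * s) \<le> \<epsilon>" using n by (simp add: field_simps)
          then have "n * (1 / Suc j + 2 * L * s) * norm h \<le> \<epsilon> * norm h" by (rule mult_right_mono) simp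
          then show ?thesis by (simp only: mult.assoc)
        qed
        ultimately show ?thesis by (simp add: euclidean_representation n_def)
      qed simp
      moreover have "d' > 0" using d(1) by (simp add: d'_def)
      ultimately show "\<exists>Q d. d > 0 \<and> (\<forall>h. norm h < d \<longrightarrow> \<bar>u (x + h) - u x - Q \<bullet> h\<bar> \<le> \<epsilon> * norm h)" by blast
    qed
    then show False using \<open>x \<in> _\<close> by simp
  qed
  ultimately show ?thesis by (meson negligible_Un negligible_subset)
qed

subsection \<open>Weakly spacelike functions are Lipschitz along segments\<close>

text \<open>Only pairs joined inside \<open>U\<close> are compared: across a slit of the domain the
  bound may fail. In contrast to a condition on gradients, this one passes to pointwise limits and
  to maxima and minima without any measure theory.\<close>

definition seg_lipschitz :: "'a::euclidean_space set \<Rightarrow> ('a \<Rightarrow> real) \<Rightarrow> bool" where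
  "seg_lipschitz U u \<longleftrightarrow> (\<forall>x y. closed_segment x y \<subseteq> U \<longrightarrow> \<bar>u x - u y\<bar> \<le> norm (x - y))"

lemma seg_lipschitzD:
  "seg_lipschitz U u \<Longrightarrow> closed_segment x y \<subseteq> U \<Longrightarrow> \<bar>u x - u y\<bar> \<le> norm (x - y)"
  by (auto simp: seg_lipschitz_def)

lemma seg_lipschitz_subset: "seg_lipschitz U u \<Longrightarrow> V \<subseteq> U \<Longrightarrow> seg_lipschitz V u"
  unfolding seg_lipschitz_def by blast

lemma seg_lipschitz_convex:
  assumes "seg_lipschitz U u" "convex B" "B \<subseteq> U"
  shows "1-lipschitz_on B u"
proof (rule lipschitz_onI)
  fix x y assume "x \<in> B" "y \<in> B"
  then have "closed_segment x y \<subseteq> U" using assms(2,3) closed_segment_subset by blast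
  then show "dist (u x) (u y) \<le> 1 * dist x y" using seg_lipschitzD[OF assms(1)] by (simp add: dist_norm)
qed simp

lemma continuous_on_if_locally_1_lipschitz:
  assumes "\<And>x. x \<in> U \<Longrightarrow> \<exists>r>0. 1-lipschitz_on (ball x r) u"
  shows "continuous_on U u"
proof (rule continuous_at_imp_continuous_on, rule ballI)
  fix x assume "x \<in> U"
  then obtain r where r: "r > 0" "1-lipschitz_on (ball x r) u" using assms by blast
  then show "isCont u x"
    using lipschitz_on_continuous_on[OF r(2)] continuous_on_eq_continuous_at[of "ball x r" u] by auto
qed

lemma seg_lipschitz_continuous_on:
  assumes "open U" "seg_lipschitz U u"
  shows "continuous_on U u"
proof (rule continuous_on_if_locally_1_lipschitz)
  fix x assume "x \<in> U"
  then obtain r where r: "r > 0" "ball x r \<subseteq> U" using assms(1) openE by blast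
  then show "\<exists>r>0. 1-lipschitz_on (ball x r) u"
    using seg_lipschitz_convex[OF assms(2) _ r(2)] by auto
qed

text \<open>Along a segment the claim is one-dimensional, and there continuity together with
  arbitrarily short forward steps that satisfy the bound is enough. This is how glued competitors
  are checked, one neighbourhood at a time.\<close>

lemma seg_lipschitz_localI:
  assumes "\<And>x. x \<in> U \<Longrightarrow> \<exists>r>0. 1-lipschitz_on (ball x r) u"
  shows "seg_lipschitz U u"
  unfolding seg_lipschitz_def
proof (intro allI impI)
  fix x y assume xy: "closed_segment x y \<subseteq> U"
  define p where "p t = x + t *\<^sub>R (y - x)" for t
  have pU: "p t \<in> U" if "t \<in> {0..1}" for t
  proof -
    have "p t = (1 - t) *\<^sub>R x + t *\<^sub>R y" by (simp add: p_def algebra_simps)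
    then show ?thesis using xy that by (auto simp: closed_segment_def)
  qed
  have pn: "norm (p s - p t) = \<bar>s - t\<bar> * norm (y - x)" for s t
    by (simp add: p_def flip: scaleR_diff_left)
  show "\<bar>u x - u y\<bar> \<le> norm (x - y)"
  proof (cases "x = y")
    case False
    have ex: "\<exists>d>0. \<forall>s. \<bar>s - t\<bar> < d \<longrightarrow> \<bar>u (p s) - u (p t)\<bar> \<le> norm (y - x) * \<bar>s - t\<bar>" if t: "t \<in> {0..1}" for t
    proof -
      obtain r where r: "r > 0" "1-lipschitz_on (ball (p t) r) u" using assms[OF pU[OF t]] by blast
      have "p s \<in> ball (p t) r" if "\<bar>s - t\<bar> < r / norm (y - x)" for s
      proof -
        have "norm (p t - p s) < r" using that False by (simp add: pn field_simps abs_minus_commute)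
        then show ?thesis by (simp add: dist_norm)
      qed
      then have "\<bar>u (p s) - u (p t)\<bar> \<le> norm (y - x) * \<bar>s - t\<bar>" if "\<bar>s - t\<bar> < r / norm (y - x)" for s
        using lipschitz_onD[OF r(2), of "p s" "p t"] that pn[of s t] r(1) by (simp add: mult.commute dist_norm)
      then show ?thesis using r(1) False by (intro exI[of _ "r / norm (y - x)"]) auto
    qed
    have "(norm (y - x))-lipschitz_on {0..1} (\<lambda>t. u (p t))"
    proof (rule locally_lipschitz_imp_lipschitz)
      show "continuous_on {0..1} (\<lambda>t. u (p t))"
        using pU by (intro continuous_on_compose2[OF continuous_on_if_locally_1_lipschitz[OF assms]])
          (auto simp: p_def intro!: continuous_intros)
      fix s t :: real assume s: "s \<in> {0..<1}" and t: "t > s"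
      then obtain d where d: "d > 0" "\<And>t. \<bar>t - s\<bar> < d \<Longrightarrow> \<bar>u (p t) - u (p s)\<bar> \<le> norm (y - x) * \<bar>t - s\<bar>"
        using ex[of s] by auto
      define z where "z = min t (s + d / 2)"
      have "z \<in> {s<..t}" "\<bar>z - s\<bar> < d" using d t by (auto simp: z_def)
      then show "\<exists>z\<in>{s<..t}. dist (u (p z)) (u (p s)) \<le> norm (y - x) * (z - s)"
        using d(2)[of z] by (intro bexI[of _ z]) (auto simp: dist_real_def)
    qed simp
    from lipschitz_onD[OF this, of 0 1] show ?thesis
      by (simp add: p_def dist_real_def norm_minus_commute)
  qed simp
qed

section \<open>Gradients, and differentiability of functions that are 1-Lipschitz along
  segments\<close>

lemma GDERIV_grad:
  assumes "u differentiable (at x)"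
  shows "GDERIV u x :> grad u x" "GDERIV u x :> D \<longleftrightarrow> D = grad u x"
proof -
  obtain u' where u': "(u has_derivative u') (at x)" using assms by (auto simp: differentiable_def)
  define D where "D = (\<Sum>b\<in>Basis. u' b *\<^sub>R b)"
  have "u' h = h \<bullet> D" for h
  proof -
    have lin: "linear u'" using u' has_derivative_linear by blast
    have "u' h = u' (\<Sum>b\<in>Basis. (h \<bullet> b) *\<^sub>R b)" by (simp add: euclidean_representation)
    also have "\<dots> = (\<Sum>b\<in>Basis. (h \<bullet> b) * u' b)"
      using lin by (simp add: linear_sum linear_scale)
    also have "\<dots> = h \<bullet> D" by (simp add: D_def inner_sum_right mult.commute)
    finally show ?thesis .
  qed
  then have "u' = (\<lambda>h. h \<bullet> D)" by auto
  with u' have D: "GDERIV u x :> D" by (simp add: gderiv_def)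
  have uni: "D1 = D2" if "GDERIV u x :> D1" "GDERIV u x :> D2" for D1 D2
  proof -
    have "(\<lambda>h. h \<bullet> D1) = (\<lambda>h. h \<bullet> D2)" using that has_derivative_unique unfolding gderiv_def by blast
    then have "h \<bullet> (D1 - D2) = 0" for h by (metis inner_diff_right eq_iff_diff_eq_0)
    then show ?thesis by (metis eq_iff_diff_eq_0 inner_eq_zero_iff)
  qed
  have "grad u x = D" unfolding grad_def using D uni by (intro the_equality) auto
  with D uni show "GDERIV u x :> grad u x" "GDERIV u x :> D' \<longleftrightarrow> D' = grad u x" for D' by auto
qed

text \<open>The constant \<open>c\<close> is there for truncated competitors, which on open pieces
  coincide with a given function shifted by a level.\<close>

lemma grad_cong:
  assumes "open T" "x \<in> T" "\<And>y. y \<in> T \<Longrightarrow> u y = v y + c"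
  shows "u differentiable (at x) \<longleftrightarrow> v differentiable (at x)" "grad u x = grad v x"
proof -
  have "(u has_derivative D) (at x) \<longleftrightarrow> (v has_derivative D) (at x)" for D
  proof -
    have "(u has_derivative D) (at x) \<longleftrightarrow> ((\<lambda>y. v y + c) has_derivative D) (at x)"
      using has_derivative_transform_within_open[OF _ assms(1,2), of u D UNIV "\<lambda>y. v y + c"]
         has_derivative_transform_within_open[OF _ assms(1,2), of "\<lambda>y. v y + c" D UNIV u] assms(3) by auto
    also have "\<dots> \<longleftrightarrow> (v has_derivative D) (at x)"
      using has_derivative_add_const[of v D "at x" c] has_derivative_add_const[of "\<lambda>y. v y + c" D "at x" "- c"] by auto
    finally show ?thesis .
  qed
  then show "u differentiable (at x) \<longleftrightarrow> v differentiable (at x)" "grad u x = grad v x"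
    by (simp_all add: differentiable_def grad_def gderiv_def)
qed

text \<open>A short step in the direction of the gradient \<open>D\<close> changes \<open>u\<close>
  at a rate close to \<open>norm D\<close>, which the segment bound limits to one.\<close>

lemma seg_lipschitz_norm_grad_le:
  assumes U: "open U" "seg_lipschitz U u" and x: "x \<in> U" "u differentiable (at x)"
  shows "norm (grad u x) \<le> 1"
proof (rule ccontr)
  assume "\<not> norm (grad u x) \<le> 1"
  define D where "D = grad u x"
  have nD: "norm D > 1" using \<open>\<not> _\<close> by (simp add: D_def)
  define e where "e = (norm D - 1) / 2"
  have e: "e > 0" using nD by (simp add: e_def)
  have "(u has_derivative (\<lambda>h. h \<bullet> D)) (at x)" using GDERIV_grad(1)[OF x(2)] by (simp add: gderiv_def D_def)
  then obtain d where d: "d > 0" "\<And>y. norm (y - x) < d \<Longrightarrow> norm (u y - u x - (y - x) \<bullet> D) \<le> e * norm (y - x)"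
    unfolding has_derivative_at_alt using e by blast
  obtain r where r: "r > 0" "ball x r \<subseteq> U" using U(1) x(1) openE by blast
  define s where "s = min d r / (2 * norm D)"
  define y where "y = x + s *\<^sub>R D"
  have s: "s > 0" unfolding s_def using d(1) r(1) nD by (intro divide_pos_pos) auto
  have ny: "norm (y - x) = s * norm D" using s by (simp add: y_def)
  have sm: "s * norm D < d" "s * norm D < r" using nD d r by (auto simp: s_def min_def)
  have "x \<in> ball x r" "y \<in> ball x r" using r sm ny by (auto simp: dist_norm norm_minus_commute)
  then have "closed_segment y x \<subseteq> U" using r(2) closed_segment_subset[of y "ball x r" x] by auto
  then have "\<bar>u y - u x\<bar> \<le> s * norm D" using seg_lipschitzD[OF U(2)] ny by metis
  moreover have "(y - x) \<bullet> D = s * norm D * norm D" by (simp add: y_def power2_norm_eq_inner[symmetric] power2_eq_square)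
  moreover have "\<bar>u y - u x - (y - x) \<bullet> D\<bar> \<le> e * (s * norm D)" using d(2)[of y] ny sm by simp
  ultimately have "norm D * (s * norm D) \<le> (1 + e) * (s * norm D)" by (simp add: algebra_simps)
  moreover have "s * norm D > 0" using s nD by (intro mult_pos_pos) auto
  ultimately have "norm D \<le> 1 + e" by (rule mult_right_le_imp_le)
  then have "norm D \<le> 1" by (simp add: e_def field_simps)
  then show False using nD by simp
qed

text \<open>Composition with the nearest-point projection, which is 1-Lipschitz, keeps the constant.
  It carries local questions over to results for functions on the whole space.\<close>

lemma lipschitz_extension_cball:
  fixes u :: "'a::euclidean_space \<Rightarrow> real"
  assumes "L-lipschitz_on (cball x r) u" "0 < r"
  obtains v where "L-lipschitz_on UNIV v" "\<And>y. y \<in> cball x r \<Longrightarrow> v y = u y"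
proof
  define p where "p = closest_point (cball x r)"
  have "1-lipschitz_on UNIV p" unfolding p_def using assms(2)
    by (intro lipschitz_onI) (auto intro!: closest_point_lipschitz)
  moreover have "p ` UNIV \<subseteq> cball x r"
    unfolding p_def using assms(2) closest_point_in_set[of "cball x r"] by fastforce
  ultimately have "(L * 1)-lipschitz_on UNIV (\<lambda>y. u (p y))"
    using assms(1) by (intro lipschitz_on_compose2[of 1 UNIV p L u]) (auto intro: lipschitz_on_subset)
  then show "L-lipschitz_on UNIV (\<lambda>y. u (p y))" by simp
  show "u (p y) = u y" if "y \<in> cball x r" for y using that by (simp add: p_def closest_point_self)
qed

lemma seg_lipschitz_AE_differentiable:
  assumes U: "open U" "seg_lipschitz U u"
  shows "negligible {x\<in>U. \<not> u differentiable (at x)}"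
proof -
  define X where "X = {x\<in>U. \<not> u differentiable (at x)}"
  have "\<exists>T. openin (top_of_set X) T \<and> x \<in> T \<and> negligible T" if x: "x \<in> X" for x
  proof -
    obtain r where r: "r > 0" "cball x r \<subseteq> U" using x U(1) open_contains_cball unfolding X_def by blast
    have "1-lipschitz_on (cball x r) u" using seg_lipschitz_convex[OF U(2) _ r(2)] by auto
    then obtain v where v: "1-lipschitz_on UNIV v" "\<And>y. y \<in> cball x r \<Longrightarrow> v y = u y"
      using r(1) by (rule lipschitz_extension_cball) blast
    have "u differentiable (at y) \<longleftrightarrow> v differentiable (at y)" if "y \<in> ball x r" for y
      by (rule grad_cong(1)[of "ball x r" _ _ _ 0]) (use that v(2) in auto)
    then have "X \<inter> ball x r \<subseteq> {y. \<not> v differentiable (at y)}" by (auto simp: X_def)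
    then have "negligible (X \<inter> ball x r)" using Rademacher[OF v(1)] negligible_subset by blast
    then show ?thesis using x r(1) by (intro exI[of _ "X \<inter> ball x r"]) (auto simp: openin_open_Int)
  qed
  then have "negligible X" using locally_negligible_alt[of X] by blast
  then show ?thesis by (simp add: X_def)
qed

lemma seg_lipschitz_C01:
  assumes U: "open U" "seg_lipschitz U u"
  shows "C01 U u"
  unfolding C01_def
proof (intro allI impI, elim conjE)
  fix K assume K: "compact K" "K \<subseteq> U"
  \<comment> \<open>\<open>local_lipschitz\<close> is made for time-dependent fields; here time is a
    dummy that ranges over \<open>{0}\<close>.\<close>
  have "local_lipschitz {0::real} K (\<lambda>_. u)"
  proof (rule local_lipschitzI)
    fix x assume "x \<in> K"
    then obtain r where r: "r > 0" "cball x r \<subseteq> U" using U(1) K(2) open_contains_cball by blast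
    have "1-lipschitz_on (cball x r \<inter> K) u"
      using seg_lipschitz_convex[OF U(2) _ r(2)] lipschitz_on_subset[of 1 "cball x r" u] by auto
    then show "\<exists>r>0. \<exists>L. \<forall>t\<in>cball t r \<inter> {0}. L-lipschitz_on (cball x r \<inter> K) u" for t :: real
      using r(1) by blast
  qed
  then obtain L where "\<And>t. t \<in> {0::real} \<Longrightarrow> L-lipschitz_on K u"
    by (rule local_lipschitz_compact_implies_lipschitz[OF _ K(1)]) auto
  then show "\<exists>L. L-lipschitz_on K u" by blast
qed

lemma seg_lipschitz_imp_weakly_spacelike:
  assumes U: "open U" "seg_lipschitz U u"
  shows "weakly_spacelike U u"
  unfolding weakly_spacelike_def
proof
  have "AE x in lebesgue. x \<notin> {x\<in>U. \<not> u differentiable (at x)}"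
    using seg_lipschitz_AE_differentiable[OF U] unfolding negligible_iff_null_sets by (rule AE_not_in)
  then show "AE x in lebesgue. x \<in> U \<longrightarrow> u differentiable (at x) \<and> norm (grad u x) \<le> 1"
    by eventually_elim (use seg_lipschitz_norm_grad_le[OF U] in auto)
qed (rule seg_lipschitz_C01[OF U])

section \<open>From an a.e. gradient bound to a Lipschitz bound\<close>

lemma AE_LIMSEQ_measurable:
  fixes f :: "nat \<Rightarrow> 'a::euclidean_space \<Rightarrow> real"
  assumes "\<And>n. f n \<in> borel_measurable lebesgue" "AE x in lebesgue. (\<lambda>n. f n x) \<longlonglongrightarrow> g x"
  shows "g \<in> borel_measurable lebesgue"
proof -
  have 1: "(\<lambda>x. lim (\<lambda>n. f n x)) \<in> borel_measurable lebesgue"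
    using assms(1) by (rule borel_measurable_lim_metric)
  have 2: "AE x in lebesgue. lim (\<lambda>n. f n x) = g x"
    using assms(2) by eventually_elim (rule limI)
  show ?thesis using 1 2 by (rule borel_measurable_AE)
qed

lemma AE_bounded_integrable:
  fixes f :: "'a::euclidean_space \<Rightarrow> real"
  assumes "f \<in> borel_measurable lebesgue" "S \<in> lmeasurable"
    "AE x in lebesgue. x \<in> S \<longrightarrow> \<bar>f x\<bar> \<le> M" "\<And>x. x \<notin> S \<Longrightarrow> f x = 0"
  shows "integrable lebesgue f"
  using assms by (intro integrableI_bounded_set[of S _ _ M]) (auto simp: fmeasurable_def)

lemma diffquot_tendsto:
  assumes "u differentiable (at x)"
  shows "(\<lambda>n. (u (x + (1 / Suc n) *\<^sub>R e) - u x) / (1 / Suc n)) \<longlonglongrightarrow> grad u x \<bullet> e"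
proof (cases "e = 0")
  case False
  show ?thesis
  proof (rule LIMSEQ_I)
    fix r :: real assume r: "0 < r"
    define D where "D = grad u x"
    define c where "c = r / (2 * norm e)"
    have c: "c > 0" using r False by (simp add: c_def)
    have "(u has_derivative (\<lambda>h. h \<bullet> D)) (at x)" using GDERIV_grad(1)[OF assms] by (simp add: gderiv_def D_def)
    then obtain d where d: "d > 0" "\<And>y. norm (y - x) < d \<Longrightarrow> norm (u y - u x - (y - x) \<bullet> D) \<le> c * norm (y - x)"
      unfolding has_derivative_at_alt using c by blast
    have "d / norm e > 0" using d False by simp
    then obtain N where N: "1 / Suc N < d / norm e" using nat_approx_posE by metis
    have "norm ((u (x + (1 / Suc n) *\<^sub>R e) - u x) / (1 / Suc n) - D \<bullet> e) < r" if "n \<ge> N" for n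
    proof -
      define t where "t = 1 / real (Suc n)"
      have t: "t > 0" "t \<le> 1 / Suc N" using that by (auto simp: t_def field_simps)
      then have "t < d / norm e" using N by linarith
      then have "t * norm e < d" using False by (simp add: field_simps)
      then have "\<bar>u (x + t *\<^sub>R e) - u x - t * (D \<bullet> e)\<bar> \<le> c * (t * norm e)"
        using d(2)[of "x + t *\<^sub>R e"] t by (simp add: inner_commute)
      also have "\<dots> = t * (r / 2)" using False by (simp add: c_def)
      also have "\<dots> < t * r" using t r by simp
      finally have "\<bar>(u (x + t *\<^sub>R e) - u x - t * (D \<bullet> e)) / t\<bar> < r"
        using t by (simp add: field_simps)
      then show ?thesis using t unfolding t_def[symmetric] by (simp add: diff_divide_distrib)
    qed
    then show "\<exists>N. \<forall>n\<ge>N. norm ((u (x + (1 / Suc n) *\<^sub>R e) - u x) / (1 / Suc n) - grad u x \<bullet> e) < r"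
      unfolding D_def by blast
  qed
qed simp

text \<open>If the gradients differ by \<open>D\<close> at a point of \<open>S\<close>, then
  \<open>u - v\<close> is nearly linear there and cannot vanish near a small displacement along
  \<open>D\<close>. That leaves a hole in \<open>S\<close> of fixed relative size, so
  \<open>S\<close> is porous at the point. No regularity of \<open>S\<close> enters.\<close>

lemma negligible_grad_neq:
  fixes u v :: "'a::euclidean_space \<Rightarrow> real"
  assumes "\<And>x. x \<in> S \<Longrightarrow> u x = v x"
  shows "negligible {x\<in>S. u differentiable (at x) \<and> v differentiable (at x) \<and> grad u x \<noteq> grad v x}"
proof -
  have "x \<in> {x\<in>S. porous_at (1/8) S x}"
    if x: "x \<in> S" "u differentiable (at x)" "v differentiable (at x)" "grad u x \<noteq> grad v x" for x
  proof (rule ccontr)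
    assume "x \<notin> {x\<in>S. porous_at (1/8) S x}"
    then obtain d where d: "d > 0" "\<And>r y. 0 < r \<Longrightarrow> r < d \<Longrightarrow> ball y (1/8 * r) \<subseteq> ball x r \<Longrightarrow>
       ball y (1/8 * r) \<inter> S \<noteq> {}" using x(1) unfolding porous_at_def by blast
    define D where "D = grad u x - grad v x"
    have D: "norm D > 0" using x(4) by (simp add: D_def)
    have "(u has_derivative (\<lambda>h. h \<bullet> grad u x)) (at x)" "(v has_derivative (\<lambda>h. h \<bullet> grad v x)) (at x)"
      using GDERIV_grad(1) x by (auto simp: gderiv_def)
    then have der: "((\<lambda>y. u y - v y) has_derivative (\<lambda>h. h \<bullet> grad u x - h \<bullet> grad v x)) (at x)"
      by (rule has_derivative_diff)
    have D4: "norm D / 4 > 0" using D by simp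
    from der obtain d' where d': "d' > 0"
      "\<And>y. norm (y - x) < d' \<Longrightarrow> norm (u y - v y - (u x - v x) - ((y - x) \<bullet> grad u x - (y - x) \<bullet> grad v x)) \<le> norm D / 4 * norm (y - x)"
      unfolding has_derivative_at_alt using D4 by blast
    \<comment> \<open>In the ball of radius \<open>2 * s\<close> a hole of relative radius 1/8 has
      radius \<open>s / 4\<close>, so a point \<open>z\<close> of \<open>S\<close> in it is within
      \<open>5/4 * s\<close> of \<open>x\<close>. First-order expansion bounds
      \<open>\<bar>(z - x) \<bullet> D\<bar>\<close> by \<open>5/16 * (s * norm D)\<close>, whereas
      closeness to \<open>y\<close> makes it at least \<open>3/4 * (s * norm D)\<close>.\<close>
    define s where "s = min d d' / 4"
    have s: "s > 0" "2 * s < d" "2 * s < d'" using d(1) d'(1) by (auto simp: s_def)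
    define y where "y = x + (s / norm D) *\<^sub>R D"
    have ny: "norm (y - x) = s" using s D by (simp add: y_def)
    have "ball y (1/8 * (2 * s)) \<subseteq> ball x (2 * s)"
      using s ny by (intro ball_subset_ball_iff[THEN iffD2]) (auto simp: dist_norm)
    then obtain z where z: "z \<in> S" "norm (z - y) < s / 4"
      using d(2)[of "2 * s" y] s by (auto simp: dist_norm norm_minus_commute)
    have nz: "norm (z - x) \<le> 5/4 * s" using norm_triangle_ineq[of "z - y" "y - x"] z ny by simp
    have "norm (u z - v z - (u x - v x) - ((z - x) \<bullet> grad u x - (z - x) \<bullet> grad v x)) \<le> norm D / 4 * norm (z - x)"
      using d'(2)[of z] nz s by simp
    then have "\<bar>(z - x) \<bullet> D\<bar> \<le> norm D / 4 * norm (z - x)"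
      using assms[OF z(1)] assms[OF x(1)] by (simp add: D_def inner_diff_right abs_minus_commute)
    also have "\<dots> \<le> norm D / 4 * (5/4 * s)" using nz by (intro mult_left_mono) auto
    finally have 1: "\<bar>(z - x) \<bullet> D\<bar> \<le> 5/16 * (s * norm D)" by (simp add: mult_ac)
    have "(y - x) \<bullet> D = s * norm D" using D by (simp add: y_def power2_norm_eq_inner[symmetric] power2_eq_square)
    moreover have "\<bar>(z - y) \<bullet> D\<bar> \<le> norm (z - y) * norm D" by (rule Cauchy_Schwarz_ineq2)
    moreover have "norm (z - y) * norm D \<le> s / 4 * norm D" using z by (intro mult_right_mono) auto
    moreover have "(z - x) \<bullet> D = (z - y) \<bullet> D + (y - x) \<bullet> D" by (simp flip: inner_add_left)
    ultimately have "3/4 * (s * norm D) \<le> \<bar>(z - x) \<bullet> D\<bar>" by (simp add: abs_le_iff)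
    moreover have "s * norm D > 0" using s D by simp
    ultimately show False using 1 by linarith
  qed
  then have "{x\<in>S. u differentiable (at x) \<and> v differentiable (at x) \<and> grad u x \<noteq> grad v x}
      \<subseteq> {x\<in>S. porous_at (1/8) S x}" by blast
  then show ?thesis using negligible_porous[of "1/8" S] negligible_subset by auto
qed

text \<open>The mean of \<open>u\<close> over a small ball moving from \<open>y\<close> to \<open>z\<close> is differentiable with derivative at most
  \<open>|z - y|\<close>, whatever \<open>u\<close> does on individual segments.\<close>

lemma lipschitz_grad_le_imp_1_lipschitz:
  fixes u :: "'a::euclidean_space \<Rightarrow> real"
  assumes u: "L-lipschitz_on UNIV u"
    and N: "negligible {w \<in> ball x R. \<not> (u differentiable (at w) \<and> norm (grad u w) \<le> 1)}" (is "negligible ?N")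
    and y: "y \<in> ball x R" and z: "z \<in> ball x R"
  shows "\<bar>u z - u y\<bar> \<le> norm (z - y)"
proof -
  define e where "e = z - y"
  have LL: "\<bar>u p - u q\<bar> \<le> L * norm (p - q)" for p q using lipschitz_onD[OF u, of p q] by (simp add: dist_norm)
  have L0: "0 \<le> L" using u by (rule lipschitz_on_nonneg)
  have um: "(\<lambda>w. u (w + c)) \<in> borel_measurable lebesgue" for c
  proof -
    have "continuous_on UNIV (\<lambda>w. u (w + c))"
      by (rule continuous_on_compose2[OF lipschitz_on_continuous_on[OF u]]) (auto intro!: continuous_intros)
    then have "(\<lambda>w. u (w + c)) \<in> borel_measurable lborel" by (simp add: borel_measurable_continuous_onI)
    then show ?thesis by (rule measurable_completion)
  qed
  \<comment> \<open>\<open>q0\<close> is the radius of the averaging ball: replacing a mean by the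
    value at the centre costs \<open>L * q0\<close> at either end. The slack \<open>c\<close> makes
    the derivative bound strict.\<close>
  have main: "\<bar>u z - u y\<bar> \<le> norm e + c + 2 * (L * q0)"
    if q0: "0 < q0" "ball y q0 \<subseteq> ball x R" "ball z q0 \<subseteq> ball x R" and c: "0 < c" for q0 c
  proof -
    define B where "B = ball y q0"
    define m where "m = measure lebesgue B"
    have m: "m > 0" using q0(1) by (simp add: m_def B_def content_ball_pos)
    have Bm: "B \<in> lmeasurable" by (simp add: B_def)
    have inB: "w + t *\<^sub>R e \<in> ball x R" if "w \<in> B" "t \<in> {0..1}" for w t
    proof -
      have "w \<in> ball x R" using that q0(2) by (auto simp: B_def)
      moreover have "w + e \<in> ball z q0" using that(1) by (simp add: B_def e_def dist_norm algebra_simps)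
      then have "w + e \<in> ball x R" using q0(3) by auto
      ultimately have "(1 - t) *\<^sub>R w + t *\<^sub>R (w + e) \<in> ball x R" using that(2)
        by (intro convexD[OF convex_ball]) auto
      then show ?thesis by (simp add: algebra_simps)
    qed
    define g where "g t = (LINT w:B|lebesgue. u (w + t *\<^sub>R e))" for t
    have int: "set_integrable lebesgue B (\<lambda>w. u (w + p))" for p
    proof -
      have "norm (u (w + p)) \<le> \<bar>u (y + p)\<bar> + L * q0" if "w \<in> B" for w
        using LL[of "w + p" "y + p"] that mult_left_mono[of "norm (w - y)" q0 L] L0
        by (auto simp: B_def dist_norm norm_minus_commute)
      then show ?thesis unfolding set_integrable_def using um Bm
        by (intro integrableI_bounded_set[of B _ _ "\<bar>u (y + p)\<bar> + L * q0"])
           (auto simp: indicator_def fmeasurable_def intro!: AE_I2)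
    qed
    have gdiff: "g s - g t = (LINT w:B|lebesgue. u (w + s *\<^sub>R e) - u (w + t *\<^sub>R e))" for s t
      unfolding g_def using int by simp
    have bound: "\<bar>LINT w:B|lebesgue. f w\<bar> \<le> K * m"
      if "\<And>w. w \<in> B \<Longrightarrow> \<bar>f w\<bar> \<le> K" "set_integrable lebesgue B f" for f K
    proof -
      have "norm (LINT w:B|lebesgue. f w) \<le> (LINT w:B|lebesgue. \<bar>f w\<bar>)"
        using set_integral_norm_bound[OF that(2)] by simp
      also have "\<dots> \<le> (LINT w:B|lebesgue. K)"
        using that(1) Bm set_integrable_abs[OF that(2)]
        by (intro set_integral_mono) (auto simp: fmeasurable_def set_integrable_def)
      also have "\<dots> = K * m" using Bm by (simp add: m_def set_lebesgue_integral_def fmeasurable_def mult.commute)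
      finally show ?thesis by simp
    qed
    have "((norm e + c) * m)-lipschitz_on {0..1} g"
    proof (rule locally_lipschitz_imp_lipschitz)
      have "(L * norm e * m)-lipschitz_on {0..1} g"
      proof (rule lipschitz_onI)
        fix s t
        have "\<bar>u (w + s *\<^sub>R e) - u (w + t *\<^sub>R e)\<bar> \<le> L * (\<bar>s - t\<bar> * norm e)" for w
          using LL[of "w + s *\<^sub>R e" "w + t *\<^sub>R e"] by (simp flip: scaleR_diff_left)
        then have "\<bar>g s - g t\<bar> \<le> (L * (\<bar>s - t\<bar> * norm e)) * m"
          unfolding gdiff using int by (intro bound) auto
        then show "dist (g s) (g t) \<le> L * norm e * m * dist s t" by (simp add: dist_real_def mult_ac)
      qed (use L0 m in auto)
      then show "continuous_on {0..1} g" by (rule lipschitz_on_continuous_on)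
      fix t t' :: real assume t: "t \<in> {0..<1}" "t < t'"
      define r' where "r' n = 1 / real (Suc n)" for n
      have r': "r' n > 0" for n by (simp add: r'_def)
      define q where "q n w = (u (w + t *\<^sub>R e + r' n *\<^sub>R e) - u (w + t *\<^sub>R e)) / r' n" for n w
      define D where "D w = grad u (w + t *\<^sub>R e) \<bullet> e" for w
      define Z where "Z = (+) (- (t *\<^sub>R e)) ` ?N"
      have "negligible Z" unfolding Z_def using N by (rule negligible_translation)
      then have "AE w in lebesgue. w \<notin> Z" unfolding negligible_iff_null_sets by (rule AE_not_in)
      then have AED: "AE w in lebesgue. w \<in> B \<longrightarrow> u differentiable (at (w + t *\<^sub>R e)) \<and> norm (grad u (w + t *\<^sub>R e)) \<le> 1"
      proof eventually_elim
        case (elim w)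
        have "w + t *\<^sub>R e \<notin> ?N"
        proof
          assume "w + t *\<^sub>R e \<in> ?N"
          then have "- (t *\<^sub>R e) + (w + t *\<^sub>R e) \<in> Z" unfolding Z_def by (rule imageI)
          with elim show False by simp
        qed
        then show ?case using inB[of w t] t by auto
      qed
      have qm: "(\<lambda>w. indicator B w * q n w) \<in> borel_measurable lebesgue" for n
        unfolding q_def add.assoc using um Bm by (auto simp: fmeasurable_def)
      have lim: "AE w in lebesgue. (\<lambda>n. indicator B w * q n w) \<longlonglongrightarrow> indicator B w * D w"
        using AED
      proof eventually_elim
        case (elim w)
        show ?case
        proof (cases "w \<in> B")
          case True
          then show ?thesis using elim diffquot_tendsto[of u "w + t *\<^sub>R e" e] by (simp add: q_def D_def r'_def)
        qed simp
      qed
      have Dm: "(\<lambda>w. indicator B w * D w) \<in> borel_measurable lebesgue"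
        by (rule AE_LIMSEQ_measurable[OF qm lim])
      have qb: "\<bar>q n w\<bar> \<le> L * norm e" for n w
      proof -
        have "\<bar>u (w + t *\<^sub>R e + r' n *\<^sub>R e) - u (w + t *\<^sub>R e)\<bar> \<le> L * norm e * r' n"
          using LL[of "w + t *\<^sub>R e + r' n *\<^sub>R e" "w + t *\<^sub>R e"] r'[of n] by (simp add: mult_ac)
        then show ?thesis using r'[of n] unfolding q_def by (simp add: pos_divide_le_eq)
      qed
      have "(\<lambda>n. LINT w|lebesgue. indicator B w * q n w) \<longlonglongrightarrow> (LINT w|lebesgue. indicator B w * D w)"
      proof (rule integral_dominated_convergence[OF Dm qm _ lim])
        show "integrable lebesgue (\<lambda>w. indicator B w * (L * norm e))" using Bm by (auto simp: fmeasurable_def)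
        show "AE w in lebesgue. norm (indicator B w * q n w) \<le> indicator B w * (L * norm e)" for n
          using qb by (auto simp: indicator_def)
      qed
      moreover have "(LINT w|lebesgue. indicator B w * q n w) = (g (t + r' n) - g t) / r' n" for n
        unfolding gdiff by (simp add: q_def set_lebesgue_integral_def scaleR_add_left add.assoc)
      ultimately have gl: "(\<lambda>n. (g (t + r' n) - g t) / r' n) \<longlonglongrightarrow> (LINT w|lebesgue. indicator B w * D w)" by simp
      have "norm (LINT w|lebesgue. indicator B w * D w) \<le> (LINT w|lebesgue. indicator B w * norm e)"
      proof -
        have De: "AE w in lebesgue. w \<in> B \<longrightarrow> \<bar>D w\<bar> \<le> norm e" using AED
        proof eventually_elim
          case (elim w)
          have "\<bar>D w\<bar> \<le> norm (grad u (w + t *\<^sub>R e)) * norm e" unfolding D_def by (rule Cauchy_Schwarz_ineq2)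
          then show ?case using elim mult_right_mono[of "norm (grad u (w + t *\<^sub>R e))" 1 "norm e"] by auto
        qed
        then have Di: "integrable lebesgue (\<lambda>w. indicator B w * D w)"
          by (intro AE_bounded_integrable[OF Dm Bm]) (auto elim: eventually_mono)
        have "norm (LINT w|lebesgue. indicator B w * D w) \<le> (LINT w|lebesgue. norm (indicator B w * D w))"
          by (rule integral_norm_bound)
        also have "\<dots> \<le> (LINT w|lebesgue. indicator B w * norm e)"
          using Di Bm De by (intro integral_mono_AE) (auto simp: fmeasurable_def split: split_indicator elim!: eventually_mono)
        finally show ?thesis .
      qed
      then have Db: "\<bar>LINT w|lebesgue. indicator B w * D w\<bar> \<le> norm e * m"
        using Bm by (simp add: m_def fmeasurable_def mult.commute)
      \<comment> \<open>Strictness turns the bound on the limit into a bound for one actual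
        difference quotient, and a single forward step is all that the local Lipschitz criterion
        asks for.\<close>
      have "0 < c * m" using c m by simp
      then have "\<bar>LINT w|lebesgue. indicator B w * D w\<bar> < (norm e + c) * m"
        using Db by (simp only: distrib_right)
      then have ev1: "\<forall>\<^sub>F n in sequentially. \<bar>(g (t + r' n) - g t) / r' n\<bar> < (norm e + c) * m"
        using order_tendstoD(2)[OF tendsto_rabs[OF gl]] by blast
      have ev2: "\<forall>\<^sub>F n in sequentially. r' n < t' - t"
        using order_tendstoD(2)[OF LIMSEQ_inverse_real_of_nat, of "t' - t"] t by (simp add: divide_inverse r'_def)
      obtain n where n: "\<bar>(g (t + r' n) - g t) / r' n\<bar> < (norm e + c) * m" "r' n < t' - t"
        using eventually_happens[OF eventually_conj[OF ev1 ev2]] by auto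
      have "\<bar>g (t + r' n) - g t\<bar> / r' n < (norm e + c) * m" using n(1) r'[of n] by simp
      then have "\<bar>g (t + r' n) - g t\<bar> \<le> (norm e + c) * m * r' n"
        using r'[of n] by (simp only: pos_divide_less_eq less_imp_le)
      then show "\<exists>z\<in>{t<..t'}. dist (g z) (g t) \<le> (norm e + c) * m * (z - t)"
        using r'[of n] n(2) by (intro bexI[of _ "t + r' n"]) (auto simp: dist_real_def)
    qed (use c m in auto)
    from lipschitz_onD[OF this, of 1 0] have g10: "\<bar>g 1 - g 0\<bar> \<le> (norm e + c) * m" by (simp add: dist_real_def)
    have near: "\<bar>g t - m * u (y + t *\<^sub>R e)\<bar> \<le> (L * q0) * m" for t
    proof -
      have eq: "g t - m * u (y + t *\<^sub>R e) = (LINT w:B|lebesgue. u (w + t *\<^sub>R e) - u (y + t *\<^sub>R e))"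
        using int[of "t *\<^sub>R e"] Bm unfolding g_def
        by (subst set_integral_diff(2)) (auto simp: m_def set_lebesgue_integral_def fmeasurable_def set_integrable_def mult.commute)
      have "\<bar>u (w + t *\<^sub>R e) - u (y + t *\<^sub>R e)\<bar> \<le> L * q0" if "w \<in> B" for w
        using LL[of "w + t *\<^sub>R e" "y + t *\<^sub>R e"] that mult_left_mono[of "norm (w - y)" q0 L] L0
        by (auto simp: B_def dist_norm norm_minus_commute)
      moreover have "set_integrable lebesgue B (\<lambda>w. u (w + t *\<^sub>R e) - u (y + t *\<^sub>R e))"
        using int[of "t *\<^sub>R e"] Bm by (intro set_integral_diff(1)) (auto simp: fmeasurable_def set_integrable_def)
      ultimately show ?thesis unfolding eq by (intro bound)
    qed
    have "\<bar>m * u z - m * u y\<bar> \<le> (norm e + c) * m + 2 * ((L * q0) * m)"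
      using near[of 0] near[of 1] g10 by (simp add: e_def)
    then have "m * \<bar>u z - u y\<bar> \<le> m * (norm e + c + 2 * (L * q0))"
      using m by (simp only: right_diff_distrib[symmetric] abs_mult abs_of_pos) (simp add: algebra_simps)
    then show ?thesis using m by simp
  qed
  obtain r1 where r1: "r1 > 0" "ball y r1 \<subseteq> ball x R" using y openE[OF open_ball] by metis
  obtain r2 where r2: "r2 > 0" "ball z r2 \<subseteq> ball x R" using z openE[OF open_ball] by metis
  show ?thesis
  proof (rule field_le_epsilon)
    fix \<eta> :: real assume \<eta>: "0 < \<eta>"
    define q0 where "q0 = min (min r1 r2) (\<eta> / (4 * (L + 1)))"
    have q0: "q0 > 0" "q0 \<le> r1" "q0 \<le> r2" using r1 r2 \<eta> L0 by (auto simp: q0_def)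
    have "L * q0 \<le> (L + 1) * (\<eta> / (4 * (L + 1)))" using L0 q0 by (intro mult_mono) (auto simp: q0_def)
    also have "\<dots> = \<eta> / 4" using L0 by (simp add: field_simps)
    finally have "2 * (L * q0) \<le> \<eta> / 2" by simp
    moreover have "\<bar>u z - u y\<bar> \<le> norm e + \<eta> / 2 + 2 * (L * q0)"
      using q0 r1 r2 \<eta> by (intro main) auto
    ultimately show "\<bar>u z - u y\<bar> \<le> norm (z - y) + \<eta>" by (simp add: e_def)
  qed
qed

text \<open>In the forward direction \<open>C01\<close> supplies some constant on a small ball, and
  averaging improves it to one. From here on the gradient condition is replaced by the segment
  condition.\<close>

lemma weakly_spacelike_iff:
  assumes U: "open U"
  shows "weakly_spacelike U u \<longleftrightarrow> seg_lipschitz U u"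
proof
  assume ws: "weakly_spacelike U u"
  show "seg_lipschitz U u"
  proof (rule seg_lipschitz_localI)
    fix x assume x: "x \<in> U"
    then obtain r where r: "r > 0" "cball x r \<subseteq> U" using U open_contains_cball by blast
    obtain L where "L-lipschitz_on (cball x r) u" using ws r(2) unfolding weakly_spacelike_def C01_def by (meson compact_cball)
    then obtain v where v: "L-lipschitz_on UNIV v" "\<And>y. y \<in> cball x r \<Longrightarrow> v y = u y"
      using r(1) by (rule lipschitz_extension_cball) blast
    have neg: "negligible {w \<in> U. \<not> (u differentiable (at w) \<and> norm (grad u w) \<le> 1)}"
    proof -
      have "AE w in lebesgue. w \<notin> {w \<in> U. \<not> (u differentiable (at w) \<and> norm (grad u w) \<le> 1)}"
        using ws unfolding weakly_spacelike_def by (auto elim!: eventually_mono)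
      then show ?thesis by (simp add: negligible_iff_null_sets AE_iff_null_sets[symmetric] completion.AE_iff_null_sets)
    qed
    have "(v differentiable (at w) \<longleftrightarrow> u differentiable (at w)) \<and> grad v w = grad u w" if "w \<in> ball x r" for w
      using grad_cong[of "ball x r" w v u 0] that v(2) by auto
    then have "{w \<in> ball x r. \<not> (v differentiable (at w) \<and> norm (grad v w) \<le> 1)}
      \<subseteq> {w \<in> U. \<not> (u differentiable (at w) \<and> norm (grad u w) \<le> 1)}" using r(2) by auto
    then have "negligible {w \<in> ball x r. \<not> (v differentiable (at w) \<and> norm (grad v w) \<le> 1)}"
      using neg negligible_subset by blast
    then have "\<bar>v z - v y\<bar> \<le> norm (z - y)" if "y \<in> ball x r" "z \<in> ball x r" for y z
      using lipschitz_grad_le_imp_1_lipschitz[OF v(1) _ that] by blast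
    then have "1-lipschitz_on (ball x r) u" using v(2) by (intro lipschitz_onI) (auto simp: dist_norm)
    then show "\<exists>r>0. 1-lipschitz_on (ball x r) u" using r(1) by blast
  qed
qed (rule seg_lipschitz_imp_weakly_spacelike[OF U])

subsection \<open>Weak convergence of gradients\<close>

lemma lebesgue_translate:
  fixes p :: "'a::euclidean_space"
  shows "(\<lambda>x. x + p) \<in> lebesgue \<rightarrow>\<^sub>M lebesgue" "distr lebesgue lebesgue (\<lambda>x. x + p) = lebesgue"
proof -
  have T: "(\<lambda>x. p + (\<Sum>j\<in>Basis. (1 * (x \<bullet> j)) *\<^sub>R j)) = (\<lambda>x. x + p)"
    by (auto simp: euclidean_representation add.commute)
  show 1: "(\<lambda>x. x + p) \<in> lebesgue \<rightarrow>\<^sub>M lebesgue"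
    using lebesgue_affine_measurable[of "\<lambda>_. 1" p] unfolding T by simp
  have "lebesgue = density (distr lebesgue lebesgue (\<lambda>x. x + p)) (\<lambda>_. 1)"
    using lebesgue_affine_euclidean[of "\<lambda>_. 1" p] unfolding T by simp
  then show "distr lebesgue lebesgue (\<lambda>x. x + p) = lebesgue" by (simp add: density_1)
qed

lemma lebesgue_integral_translate:
  fixes f :: "'a::euclidean_space \<Rightarrow> real"
  assumes f: "f \<in> borel_measurable lebesgue"
  shows "(\<lambda>x. f (x + p)) \<in> borel_measurable lebesgue"
    "integrable lebesgue (\<lambda>x. f (x + p)) \<longleftrightarrow> integrable lebesgue f"
    "(LINT x|lebesgue. f (x + p)) = (LINT x|lebesgue. f x)"
proof -
  note T = lebesgue_translate(1)[of p]
  show "(\<lambda>x. f (x + p)) \<in> borel_measurable lebesgue"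
    using measurable_compose[OF T f] by simp
  show "integrable lebesgue (\<lambda>x. f (x + p)) \<longleftrightarrow> integrable lebesgue f"
    using integrable_distr_eq[OF T f] by (simp add: lebesgue_translate)
  show "(LINT x|lebesgue. f (x + p)) = (LINT x|lebesgue. f x)"
    using integral_distr[OF T f] by (simp add: lebesgue_translate)
qed

lemma continuous_imp_lebesgue_measurable:
  fixes g :: "'a::euclidean_space \<Rightarrow> real"
  assumes "continuous_on UNIV g"
  shows "g \<in> borel_measurable lebesgue"
proof -
  have "g \<in> borel_measurable lborel" using assms by (simp add: borel_measurable_continuous_onI)
  then show ?thesis by (rule measurable_completion)
qed

lemma continuous_approx_L1:
  fixes h :: "'a::euclidean_space \<Rightarrow> real"
  assumes h: "h \<in> borel_measurable lebesgue" and M: "\<And>x. \<bar>h x\<bar> \<le> M"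
    and R: "\<And>x. norm x > R \<Longrightarrow> h x = 0" and "0 < \<eta>"
  obtains g where "continuous_on UNIV g" "\<And>x. \<bar>g x\<bar> \<le> M" "\<And>x. norm x > R + 1 \<Longrightarrow> g x = 0"
    "(LINT x|lebesgue. \<bar>h x - g x\<bar>) < \<eta>"
proof -
  have M0: "0 \<le> M" using M[of 0] by linarith
  have "h measurable_on UNIV" using h by (intro lebesgue_measurable_imp_measurable_on) auto
  then obtain N g where N: "negligible N" and gc: "\<And>n. continuous_on UNIV (g n)"
    and gh: "\<And>x. x \<notin> N \<Longrightarrow> (\<lambda>n. g n x) \<longlonglongrightarrow> h x"
    unfolding measurable_on_def by auto
  \<comment> \<open>The cutoff and the clamp to \<open>[-M, M]\<close> leave \<open>h\<close>
    unchanged and give all approximants a common bound and a common bounded support, hence a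
    dominating function.\<close>
  define ct where "ct x = max 0 (min 1 (R + 1 - norm x))" for x :: 'a
  define G where "G n x = ct x * max (- M) (min M (g n x))" for n x
  have Gc: "continuous_on UNIV (G n)" for n unfolding G_def ct_def
    by (intro continuous_intros gc)
  have ct01: "0 \<le> ct x" "ct x \<le> 1" for x by (auto simp: ct_def)
  have GM: "\<bar>G n x\<bar> \<le> M" for n x
  proof -
    have "\<bar>max (- M) (min M (g n x))\<bar> \<le> M" using M0 by auto
    then show ?thesis using mult_mono[of "\<bar>ct x\<bar>" 1 "\<bar>max (- M) (min M (g n x))\<bar>" M] ct01[of x] M0
      by (simp add: G_def abs_mult)
  qed
  have G0: "G n x = 0" if "norm x > R + 1" for n x using that by (simp add: G_def ct_def)
  have hx: "h x = ct x * max (- M) (min M (h x))" for x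
    using R[of x] M[of x] by (cases "norm x > R") (auto simp: ct_def abs_le_iff max_def min_def)
  have Glim: "(\<lambda>n. G n x) \<longlonglongrightarrow> h x" if "x \<notin> N" for x
  proof -
    have "(\<lambda>n. G n x) \<longlonglongrightarrow> ct x * max (- M) (min M (h x))"
      unfolding G_def by (intro tendsto_intros gh that)
    then show ?thesis by (simp flip: hx)
  qed
  define C where "C = cball (0::'a) (\<bar>R\<bar> + 1)"
  have "(\<lambda>n. LINT x|lebesgue. \<bar>h x - G n x\<bar>) \<longlonglongrightarrow> (LINT x|(lebesgue :: 'a measure). (0::real))"
  proof (rule integral_dominated_convergence)
    show "integrable lebesgue (\<lambda>x. 2 * M * indicator C x)"
      by (intro integrable_mult_right) (auto simp: C_def emeasure_eq_measure2)
    have "G n \<in> borel_measurable lebesgue" for n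
      using Gc[of n] by (rule continuous_imp_lebesgue_measurable)
    then show "(\<lambda>x. \<bar>h x - G n x\<bar>) \<in> borel_measurable lebesgue" for n using h by auto
    have "AE x in lebesgue. x \<notin> N" using N unfolding negligible_iff_null_sets by (rule AE_not_in)
    then show "AE x in lebesgue. (\<lambda>n. \<bar>h x - G n x\<bar>) \<longlonglongrightarrow> 0"
    proof eventually_elim
      case (elim x)
      show ?case using tendsto_rabs[OF tendsto_diff[OF tendsto_const Glim[OF elim], of "h x"]] by simp
    qed
    have "\<bar>h x - G n x\<bar> \<le> 2 * M * indicator C x" for n x
    proof (cases "x \<in> C")
      case True
      then show ?thesis using M[of x] GM[of n x] by simp
    next
      case False
      then show ?thesis using R[of x] G0[of x n] by (simp add: C_def)
    qed
    then show "AE x in lebesgue. norm \<bar>h x - G n x\<bar> \<le> 2 * M * indicator C x" for n by simp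
  qed simp
  then have "\<forall>\<^sub>F n in sequentially. (LINT x|lebesgue. \<bar>h x - G n x\<bar>) < \<eta>"
    using \<open>0 < \<eta>\<close> by (intro order_tendstoD(2)) auto
  then obtain n where "(LINT x|lebesgue. \<bar>h x - G n x\<bar>) < \<eta>" using eventually_happens by force
  then show ?thesis using that[of "G n"] Gc GM G0 by auto
qed

lemma integrable_bounded_support:
  fixes h :: "'a::euclidean_space \<Rightarrow> real"
  assumes h: "h \<in> borel_measurable lebesgue" and M: "\<And>x. \<bar>h x\<bar> \<le> M"
    and R: "\<And>x. norm x > R \<Longrightarrow> h x = 0"
  shows "integrable lebesgue h"
  using h R M by (intro integrableI_bounded_set[of "cball 0 R" _ _ M]) (auto simp: emeasure_eq_measure2 intro!: AE_I2)

lemma L1_translation_continuous: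
  fixes h :: "'a::euclidean_space \<Rightarrow> real"
  assumes h: "h \<in> borel_measurable lebesgue" and M: "\<And>x. \<bar>h x\<bar> \<le> M"
    and R: "\<And>x. norm x > R \<Longrightarrow> h x = 0" and \<eta>: "0 < \<eta>"
  obtains d where "d > 0" "\<And>p. norm p < d \<Longrightarrow> (LINT x|lebesgue. \<bar>h (x + p) - h x\<bar>) < \<eta>"
proof -
  obtain g where gc: "continuous_on UNIV g" and gM: "\<And>x. \<bar>g x\<bar> \<le> M"
    and g0: "\<And>x. norm x > R + 1 \<Longrightarrow> g x = 0" and hg: "(LINT x|lebesgue. \<bar>h x - g x\<bar>) < \<eta> / 4"
    by (rule continuous_approx_L1[OF h M R, where \<eta> = "\<eta> / 4"]) (use \<eta> in auto)
  have gm: "g \<in> borel_measurable lebesgue"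
    using gc by (rule continuous_imp_lebesgue_measurable)
  define C where "C = cball (0::'a) (\<bar>R\<bar> + 2)"
  define m where "m = measure lebesgue C"
  have m0: "m \<ge> 0" by (simp add: m_def)
  \<comment> \<open>The continuous part contributes at most \<open>c * m\<close>, a quarter of
    \<open>\<eta>\<close>; adding 1 to \<open>m\<close> secures a positive denominator.\<close>
  define c where "c = \<eta> / (4 * (m + 1))"
  have c: "c > 0" using \<eta> m0 by (simp add: c_def)
  have "uniformly_continuous_on (cball 0 (\<bar>R\<bar> + 3)) g"
    by (intro compact_uniformly_continuous continuous_on_subset[OF gc]) auto
  then obtain d where d: "d > 0" "\<And>x y. x \<in> cball 0 (\<bar>R\<bar> + 3) \<Longrightarrow> y \<in> cball 0 (\<bar>R\<bar> + 3) \<Longrightarrow> dist y x < d \<Longrightarrow> dist (g y) (g x) < c"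
    unfolding uniformly_continuous_on_def using c by metis
  have "(LINT x|lebesgue. \<bar>h (x + p) - h x\<bar>) < \<eta>" if p: "norm p < min d 1" for p
  proof -
    have gb: "\<bar>g (x + p) - g x\<bar> \<le> c * indicator C x" for x
    proof (cases "x \<in> C")
      case True
      have "norm (x + p) \<le> \<bar>R\<bar> + 3" using True p norm_triangle_ineq[of x p] by (simp add: C_def)
      then have "x \<in> cball 0 (\<bar>R\<bar> + 3)" "x + p \<in> cball 0 (\<bar>R\<bar> + 3)" using True by (auto simp: C_def)
      moreover have "dist (x + p) x < d" using p by (simp add: dist_norm)
      ultimately have "dist (g (x + p)) (g x) < c" by (rule d(2))
      then show ?thesis using True by (simp add: dist_norm)
    next
      case False
      then have "norm x > \<bar>R\<bar> + 2" by (simp add: C_def)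
      moreover then have "norm (x + p) > R + 1" using p norm_diff_ineq[of x p] by linarith
      ultimately show ?thesis using g0[of x] g0[of "x + p"] c by (simp add: False)
    qed
    have ig: "integrable lebesgue g" by (rule integrable_bounded_support[OF gm gM g0])
    have ih: "integrable lebesgue h" by (rule integrable_bounded_support[OF h M R])
    have igp: "integrable lebesgue (\<lambda>x. g (x + p))" "integrable lebesgue (\<lambda>x. h (x + p))"
      using ig ih lebesgue_integral_translate(2)[OF gm] lebesgue_integral_translate(2)[OF h] by auto
    have iC: "integrable lebesgue (\<lambda>x. c * indicator C x)"
      by (intro integrable_mult_right) (auto simp: C_def emeasure_eq_measure2)
    have "(LINT x|lebesgue. \<bar>h (x + p) - h x\<bar>) \<le>
       (LINT x|lebesgue. \<bar>h (x + p) - g (x + p)\<bar> + (c * indicator C x + \<bar>h x - g x\<bar>))"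
    proof (rule integral_mono)
      show "integrable lebesgue (\<lambda>x. \<bar>h (x + p) - h x\<bar>)" using ih igp by auto
      show "integrable lebesgue (\<lambda>x. \<bar>h (x + p) - g (x + p)\<bar> + (c * indicator C x + \<bar>h x - g x\<bar>))"
        using ih igp ig iC by (intro Bochner_Integration.integrable_add integrable_abs Bochner_Integration.integrable_diff)
      show "\<bar>h (x + p) - h x\<bar> \<le> \<bar>h (x + p) - g (x + p)\<bar> + (c * indicator C x + \<bar>h x - g x\<bar>)" for x
        using gb[of x] by linarith
    qed
    also have "\<dots> = (LINT x|lebesgue. \<bar>h (x + p) - g (x + p)\<bar>) + ((LINT x|lebesgue. c * indicator C x) + (LINT x|lebesgue. \<bar>h x - g x\<bar>))"
      using ih igp ig iC by (subst Bochner_Integration.integral_add | intro integrable_abs Bochner_Integration.integrable_add Bochner_Integration.integrable_diff | assumption)+ auto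
    also have "(LINT x|lebesgue. \<bar>h (x + p) - g (x + p)\<bar>) = (LINT x|lebesgue. \<bar>h x - g x\<bar>)"
      using h gm by (intro lebesgue_integral_translate(3)) auto
    also have "(LINT x|lebesgue. c * indicator C x) = c * m" by (simp add: m_def C_def)
    also have "c * m \<le> \<eta> / 4"
    proof -
      have "c * m \<le> c * (m + 1)" using c by simp
      also have "\<dots> = \<eta> / 4" using m0 by (simp add: c_def field_simps)
      finally show ?thesis .
    qed
    finally show ?thesis using hg \<eta> by linarith
  qed
  then show ?thesis using that[of "min d 1"] d(1) by auto
qed

text \<open>Write \<open>I k t\<close> for the integral of \<open>h x * w k (x + t e)\<close>. Up to the modulus of continuity of
  translations of \<open>h\<close> in \<open>L\<^sup>1\<close>, the increments of \<open>I k\<close> are additive; so the derivative of \<open>I k\<close> at \<open>0\<close>, which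
  is the integral of \<open>h * D k\<close>, is uniformly close to a difference quotient with fixed step, and the latter
  tends to \<open>0\<close> with \<open>w k\<close>.\<close>

lemma weak_gradient_convergence:
  fixes h :: "'a::euclidean_space \<Rightarrow> real" and w :: "nat \<Rightarrow> 'a \<Rightarrow> real" and D :: "nat \<Rightarrow> 'a \<Rightarrow> real"
  assumes h: "h \<in> borel_measurable lebesgue" and M: "\<And>x. \<bar>h x\<bar> \<le> M"
    and C: "bounded C" "\<And>x. x \<notin> C \<Longrightarrow> h x = 0"
    and w: "\<And>k. w k \<in> borel_measurable lebesgue" "\<And>k x. \<bar>w k x\<bar> \<le> \<eta> k" "\<eta> \<longlonglongrightarrow> 0"
    and lip: "\<And>k x p q. x \<in> C \<Longrightarrow> norm q \<le> d' \<Longrightarrow> norm p \<le> d' \<Longrightarrow> \<bar>w k (x + q + p) - w k (x + q)\<bar> \<le> K * norm p"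
    and d': "0 < d'" and e: "norm e \<le> 1"
    and D: "\<And>k. AE x in lebesgue. x \<in> C \<longrightarrow> (\<lambda>n. (w k (x + (1 / Suc n) *\<^sub>R e) - w k x) / (1 / Suc n)) \<longlonglongrightarrow> D k x"
  shows "(\<lambda>k. LINT x|lebesgue. h x * D k x) \<longlonglongrightarrow> 0"
proof -
  obtain R where R: "\<And>x. x \<in> C \<Longrightarrow> norm x \<le> R" using C(1) unfolding bounded_iff by blast
  have hR: "\<And>x. norm x > R \<Longrightarrow> h x = 0" using R C(2) by (meson not_le)
  have ih: "integrable lebesgue h" by (rule integrable_bounded_support[OF h M hR])
  define H where "H = (LINT x|lebesgue. \<bar>h x\<bar>)"
  have H0: "H \<ge> 0" by (simp add: H_def)
  have \<eta>0: "\<eta> k \<ge> 0" for k using w(2)[of k 0] by linarith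
  define K' where "K' = \<bar>K\<bar> + 1"
  have K': "K' > 0" "K \<le> K'" by (auto simp: K'_def)
  have wm: "(\<lambda>x. w k (x + p)) \<in> borel_measurable lebesgue" for k p
    using lebesgue_integral_translate(1)[OF w(1)] .
  have iprod: "integrable lebesgue (\<lambda>x. f x * b x)"
    if f: "integrable lebesgue f" and b: "b \<in> borel_measurable lebesgue" "\<And>x. \<bar>b x\<bar> \<le> B" for f b :: "'a \<Rightarrow> real" and B
  proof (rule Bochner_Integration.integrable_bound)
    show "integrable lebesgue (\<lambda>x. B * f x)" using f by simp
    show "(\<lambda>x. f x * b x) \<in> borel_measurable lebesgue" using f b(1) by auto
    have "B \<ge> 0" using b(2)[of 0] by linarith
    then show "AE x in lebesgue. norm (f x * b x) \<le> norm (B * f x)"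
      using b(2) by (intro AE_I2) (auto simp: abs_mult mult.commute intro!: mult_right_mono)
  qed
  define I where "I k t = (LINT x|lebesgue. h x * w k (x + t *\<^sub>R e))" for k t
  define om where "om t = (LINT x|lebesgue. \<bar>h (x + t *\<^sub>R e) - h x\<bar>)" for t
  have ihw: "integrable lebesgue (\<lambda>x. h x * w k (x + p))" for k p
    using iprod[OF ih wm w(2)] .
  have te: "norm (t *\<^sub>R e) \<le> \<bar>t\<bar>" for t using e mult_left_mono[of "norm e" 1 "\<bar>t\<bar>"] by simp
  \<comment> \<open>A change of variables moves the shift by \<open>t\<close> from \<open>w\<close>
    to \<open>h\<close>. The second difference thus involves only \<open>h (x + p) - h x\<close>,
    whose \<open>L\<^sup>1\<close> norm is \<open>om (- t)\<close>, times an increment of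
    \<open>w\<close> over a step of size \<open>s\<close>.\<close>
  have step: "\<bar>(I k (t + s) - I k t) - (I k s - I k 0)\<bar> \<le> K' * s * om (- t)"
    if t: "0 \<le> t" "t \<le> d'" and s: "0 \<le> s" "s \<le> d'" for k s t
  proof -
    define F where "F x = w k (x + s *\<^sub>R e) - w k x" for x
    have Fm: "F \<in> borel_measurable lebesgue" unfolding F_def using wm w(1) by auto
    have Fb: "\<bar>F x\<bar> \<le> 2 * \<eta> k" for x unfolding F_def using w(2)[of k x] w(2)[of k "x + s *\<^sub>R e"] by linarith
    have i1: "integrable lebesgue (\<lambda>x. h x * F (x + p))" for p
      unfolding F_def right_diff_distrib add.assoc using ihw by auto
    have ihp: "integrable lebesgue (\<lambda>x. h (x + p))" for p using ih lebesgue_integral_translate(2)[OF h] by simp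
    have i2: "integrable lebesgue (\<lambda>x. h (x + p) * F x)" for p
      using iprod[OF ihp Fm Fb] .
    define p where "p = (- t) *\<^sub>R e"
    have eq: "h x * F (x + t *\<^sub>R e) = h x * w k (x + (t + s) *\<^sub>R e) - h x * w k (x + t *\<^sub>R e)" for x
      by (simp add: F_def right_diff_distrib scaleR_add_left add.assoc)
    have "I k (t + s) - I k t = (LINT x|lebesgue. h x * F (x + t *\<^sub>R e))"
      unfolding I_def eq by (rule Bochner_Integration.integral_diff[symmetric, OF ihw ihw])
    also have "\<dots> = (LINT x|lebesgue. h ((x + t *\<^sub>R e) + p) * F (x + t *\<^sub>R e))" by (simp add: p_def)
    also have "\<dots> = (LINT x|lebesgue. h (x + p) * F x)"
      by (rule lebesgue_integral_translate(3)) (use i2[of p] in auto)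
    finally have 1: "I k (t + s) - I k t = (LINT x|lebesgue. h (x + p) * F x)" .
    have eq': "h x * F x = h x * w k (x + s *\<^sub>R e) - h x * w k (x + 0 *\<^sub>R e)" for x
      by (simp add: F_def right_diff_distrib)
    have 2: "I k s - I k 0 = (LINT x|lebesgue. h x * F x)"
      unfolding I_def eq' by (rule Bochner_Integration.integral_diff[symmetric, OF ihw ihw])
    have i0: "integrable lebesgue (\<lambda>x. h x * F x)" using i2[of 0] by simp
    have "(I k (t + s) - I k t) - (I k s - I k 0) = (LINT x|lebesgue. (h (x + p) - h x) * F x)"
      unfolding 1 2 left_diff_distrib by (rule Bochner_Integration.integral_diff[symmetric, OF i2 i0])
    then have "\<bar>(I k (t + s) - I k t) - (I k s - I k 0)\<bar> = norm (LINT x|lebesgue. (h (x + p) - h x) * F x)" by simp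
    also have "\<dots> \<le> (LINT x|lebesgue. norm ((h (x + p) - h x) * F x))" by (rule integral_norm_bound)
    also have "\<dots> \<le> (LINT x|lebesgue. (K' * s) * \<bar>h (x + p) - h x\<bar>)"
    proof (rule integral_mono)
      show "integrable lebesgue (\<lambda>x. norm ((h (x + p) - h x) * F x))"
        unfolding left_diff_distrib by (intro integrable_norm Bochner_Integration.integrable_diff i2 i0)
      show "integrable lebesgue (\<lambda>x. (K' * s) * \<bar>h (x + p) - h x\<bar>)"
        using ih ihp by (intro integrable_mult_right integrable_abs Bochner_Integration.integrable_diff)
      fix x
      \<comment> \<open>The Lipschitz bound on \<open>w\<close> is available only near
        \<open>C\<close>; elsewhere both values of \<open>h\<close> vanish. The case
        \<open>x + p \<in> C\<close> is the reason for the displacement \<open>q\<close> in the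
        assumption \<open>lip\<close>.\<close>
      have Fx: "\<bar>F x\<bar> \<le> K' * s" if "x \<in> C \<or> x + p \<in> C"
      proof -
        have ns: "norm (s *\<^sub>R e) \<le> d'" using te[of s] s by linarith
        have nt: "norm (t *\<^sub>R e) \<le> d'" using te[of t] t by linarith
        have "\<bar>F x\<bar> \<le> K * norm (s *\<^sub>R e)"
          using that
        proof
          assume "x \<in> C"
          then show ?thesis using lip[of x 0 "s *\<^sub>R e" k] ns d' by (simp add: F_def)
        next
          assume "x + p \<in> C"
          then show ?thesis using lip[of "x + p" "t *\<^sub>R e" "s *\<^sub>R e" k] ns nt by (simp add: F_def p_def)
        qed
        also have "\<dots> \<le> K' * norm (s *\<^sub>R e)" using K' by (intro mult_right_mono) auto
        also have "\<dots> \<le> K' * s" using te[of s] s K' by (intro mult_left_mono) auto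
        finally show ?thesis .
      qed
      show "norm ((h (x + p) - h x) * F x) \<le> (K' * s) * \<bar>h (x + p) - h x\<bar>"
      proof (cases "x \<in> C \<or> x + p \<in> C")
        case True
        show ?thesis using mult_left_mono[OF Fx[OF True], of "\<bar>h (x + p) - h x\<bar>"]
          by (simp add: abs_mult mult.commute)
      next
        case False
        then have "h x = 0" "h (x + p) = 0" using C(2) by auto
        then show ?thesis by (simp only:) simp
      qed
    qed
    finally show ?thesis by (simp add: om_def p_def)
  qed
  have iter: "\<bar>(I k (real n * s) - I k 0) - real n * (I k s - I k 0)\<bar> \<le> real n * (K' * s * W)"
    if s: "0 \<le> s" "s \<le> d'" "real n * s \<le> d'" and W: "\<And>t. 0 \<le> t \<Longrightarrow> t \<le> real n * s \<Longrightarrow> om (- t) \<le> W" for k s W n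
    using s W
  proof (induction n)
    case (Suc n)
    have ns: "real n * s \<le> real (Suc n) * s" using Suc.prems(1) by (intro mult_right_mono) auto
    have "\<bar>(I k (real n * s) - I k 0) - real n * (I k s - I k 0)\<bar> \<le> real n * (K' * s * W)"
      using Suc.prems ns by (intro Suc.IH) auto
    moreover have "\<bar>(I k (real n * s + s) - I k (real n * s)) - (I k s - I k 0)\<bar> \<le> K' * s * om (- (real n * s))"
      using Suc.prems ns by (intro step) auto
    moreover have "K' * s * om (- (real n * s)) \<le> K' * s * W"
      using Suc.prems ns K' by (intro mult_left_mono) auto
    moreover have "real (Suc n) * s = real n * s + s" by (simp add: algebra_simps)
    moreover have "real (Suc n) * y = real n * y + y" for y by (simp add: algebra_simps)
    ultimately show ?case by (simp only:)
  qed simp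
  have lim: "(\<lambda>n. (I k (1 / Suc n) - I k 0) / (1 / Suc n)) \<longlonglongrightarrow> (LINT x|lebesgue. h x * D k x)" for k
  proof -
    define q where "q n x = h x * ((w k (x + (1 / Suc n) *\<^sub>R e) - w k x) / (1 / Suc n))" for n x
    obtain n0 where n0: "1 / Suc n0 < d'" using nat_approx_posE[OF d'] by auto
    have qm: "q n \<in> borel_measurable lebesgue" for n
      unfolding q_def using wm w(1) h by auto
    have ql: "AE x in lebesgue. (\<lambda>n. q n x) \<longlonglongrightarrow> h x * D k x"
      using D[of k]
    proof eventually_elim
      case (elim x)
      show ?case unfolding q_def using C(2)[of x] elim by (cases "x \<in> C") (auto intro: tendsto_mult_left)
    qed
    have qb: "\<bar>q (n + n0) x\<bar> \<le> K' * \<bar>h x\<bar>" for n x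
    proof (cases "x \<in> C")
      case True
      define r' where "r' = 1 / real (Suc (n + n0))"
      have "r' \<le> 1 / Suc n0" by (simp add: r'_def field_simps)
      then have r': "r' > 0" "r' \<le> d'" using n0 by (auto simp: r'_def)
      have "\<bar>w k (x + r' *\<^sub>R e) - w k x\<bar> \<le> K * norm (r' *\<^sub>R e)" 
      proof -
        have "norm (r' *\<^sub>R e) \<le> d'" using te[of r'] r' by linarith
        then show ?thesis using lip[OF True, of 0 "r' *\<^sub>R e" k] d' by simp
      qed
      also have "\<dots> \<le> K' * r'" using te[of r'] r' K' by (intro mult_mono) auto
      finally have "\<bar>w k (x + r' *\<^sub>R e) - w k x\<bar> / r' \<le> K'" using r' by (simp only: pos_divide_le_eq)
      then have "\<bar>h x\<bar> * (\<bar>w k (x + r' *\<^sub>R e) - w k x\<bar> / r') \<le> \<bar>h x\<bar> * K'" by (intro mult_left_mono) auto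
      then show ?thesis unfolding q_def r'_def[symmetric] using r' by (simp add: abs_mult mult.commute)
    qed (simp add: q_def C(2))
    have "(\<lambda>n. LINT x|lebesgue. q (n + n0) x) \<longlonglongrightarrow> (LINT x|lebesgue. h x * D k x)"
    proof (rule integral_dominated_convergence[OF _ qm, where w = "\<lambda>x. K' * \<bar>h x\<bar>"])
      show "(\<lambda>x. h x * D k x) \<in> borel_measurable lebesgue" by (rule AE_LIMSEQ_measurable[OF qm ql])
      show "integrable lebesgue (\<lambda>x. K' * \<bar>h x\<bar>)" using ih by auto
      show "AE x in lebesgue. (\<lambda>n. q (n + n0) x) \<longlonglongrightarrow> h x * D k x"
        using ql by eventually_elim (rule LIMSEQ_ignore_initial_segment)
      show "AE x in lebesgue. norm (q (n + n0) x) \<le> K' * \<bar>h x\<bar>" for n using qb by simp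
    qed
    then have "(\<lambda>n. LINT x|lebesgue. q n x) \<longlonglongrightarrow> (LINT x|lebesgue. h x * D k x)"
      by (rule LIMSEQ_offset)
    moreover have "(LINT x|lebesgue. q n x) = (I k (1 / Suc n) - I k 0) / (1 / Suc n)" for n
    proof -
      have "I k (1 / Suc n) - I k 0 = (LINT x|lebesgue. h x * (w k (x + (1 / Suc n) *\<^sub>R e) - w k x))"
        unfolding I_def right_diff_distrib using ihw ihw[of k 0] by (subst Bochner_Integration.integral_diff) auto
      then show ?thesis unfolding q_def times_divide_eq_right by (simp only: integral_divide_zero)
    qed
    ultimately show ?thesis by simp
  qed
  show ?thesis
  proof (rule LIMSEQ_I)
    fix r :: real assume r: "0 < r"
    define W where "W = r / (4 * K')"
    have W: "W > 0" using r K' by (simp add: W_def)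
    obtain d where d: "d > 0" "\<And>p. norm p < d \<Longrightarrow> (LINT x|lebesgue. \<bar>h (x + p) - h x\<bar>) < W"
      using L1_translation_continuous[OF h M hR W] by blast
    obtain m where m: "1 / Suc m < min d d'" using nat_approx_posE[of "min d d'"] d(1) d' by auto
    define r' where "r' = 1 / real (Suc m)"
    have r': "r' > 0" "r' < d" "r' < d'" using m by (auto simp: r'_def)
    have omW: "om (- t) \<le> W" if "0 \<le> t" "t \<le> r'" for t
    proof -
      have "norm ((- t) *\<^sub>R e) < d" using te[of "- t"] that r' by linarith
      then show ?thesis using d(2)[of "(- t) *\<^sub>R e"] by (simp add: om_def)
    qed
    have close: "\<bar>(I k r' - I k 0) / r' - (LINT x|lebesgue. h x * D k x)\<bar> \<le> K' * W" for k
    proof -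
      \<comment> \<open>Only denominators \<open>Suc m * Suc N\<close> are used, so that
        \<open>r'\<close> is exactly \<open>Suc N\<close> steps of size \<open>s\<close> and
        \<open>iter\<close> applies without remainder.\<close>
      define N' where "N' N = Suc m * Suc N - 1" for N
      have "strict_mono N'" unfolding N'_def strict_mono_Suc_iff by auto
      then have "(\<lambda>N. (I k (1 / Suc (N' N)) - I k 0) / (1 / Suc (N' N))) \<longlonglongrightarrow> (LINT x|lebesgue. h x * D k x)"
        using LIMSEQ_subseq_LIMSEQ[OF lim, of N' k] by (simp add: o_def)
      then have l: "(\<lambda>N. \<bar>(I k r' - I k 0) / r' - (I k (1 / Suc (N' N)) - I k 0) / (1 / Suc (N' N))\<bar>)
          \<longlonglongrightarrow> \<bar>(I k r' - I k 0) / r' - (LINT x|lebesgue. h x * D k x)\<bar>"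
        by (intro tendsto_intros)
      have b: "\<bar>(I k r' - I k 0) / r' - (I k (1 / Suc (N' N)) - I k 0) / (1 / Suc (N' N))\<bar> \<le> K' * W" for N
      proof -
        define s where "s = 1 / real (Suc (N' N))"
        have "Suc (N' N) = Suc m * Suc N" by (simp add: N'_def)
        then have rs: "real (Suc (N' N)) = real (Suc m) * real (Suc N)" by (simp only: of_nat_mult)
        have s: "s > 0" "real (Suc N) * s = r'"
        proof -
          show "s > 0" by (simp add: s_def)
          have "real (Suc N) * s = real (Suc N) * 1 / (real (Suc m) * real (Suc N))" unfolding s_def rs by simp
          then show "real (Suc N) * s = r'" unfolding r'_def by simp
        qed
        have "s \<le> real (Suc N) * s" using s(1) by simp
        then have sd0: "s \<le> d'" using s r' by linarith
        have "\<bar>(I k r' - I k 0) - Suc N * (I k s - I k 0)\<bar> \<le> Suc N * (K' * s * W)"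
          using iter[of s "Suc N" W k] s sd0 r' omW by simp
        also have "\<dots> = K' * W * r'" using s(2) by (simp add: algebra_simps flip: s(2))
        finally have "\<bar>(I k r' - I k 0) - Suc N * (I k s - I k 0)\<bar> / r' \<le> K' * W" using r' by (simp only: pos_divide_le_eq)
        moreover have "(I k r' - I k 0) / r' - (I k s - I k 0) / s = ((I k r' - I k 0) - Suc N * (I k s - I k 0)) / r'"
          using s r' by (simp add: diff_divide_distrib flip: s(2))
        ultimately show ?thesis using r' unfolding s_def[symmetric] by simp
      qed
      show ?thesis by (rule LIMSEQ_le_const2[OF l]) (use b in auto)
    qed
    have Ib: "\<bar>I k t\<bar> \<le> \<eta> k * H" for k t
    proof -
      have "norm (I k t) \<le> (LINT x|lebesgue. norm (h x * w k (x + t *\<^sub>R e)))" unfolding I_def by (rule integral_norm_bound)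
      also have "\<dots> \<le> (LINT x|lebesgue. \<eta> k * \<bar>h x\<bar>)"
      proof (rule integral_mono)
        show "norm (h x * w k (x + t *\<^sub>R e)) \<le> \<eta> k * \<bar>h x\<bar>" for x
          using mult_right_mono[OF w(2), of "\<bar>h x\<bar>" k "x + t *\<^sub>R e"] by (simp add: abs_mult mult.commute)
      qed (use ih ihw in auto)
      finally show ?thesis by (simp add: H_def)
    qed
    have "(\<lambda>k. 2 * (\<eta> k * H) / r') \<longlonglongrightarrow> 2 * (0 * H) / r'"
      using r' by (intro tendsto_intros w(3)) auto
    then have "\<forall>\<^sub>F k in sequentially. 2 * (\<eta> k * H) / r' < r / 2" using r by (intro order_tendstoD(2)) auto
    then obtain k0 where k0: "\<And>k. k \<ge> k0 \<Longrightarrow> 2 * (\<eta> k * H) / r' < r / 2" unfolding eventually_sequentially by blast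
    have "norm ((LINT x|lebesgue. h x * D k x) - 0) < r" if "k \<ge> k0" for k
    proof -
      have "\<bar>I k r' - I k 0\<bar> \<le> 2 * (\<eta> k * H)" using Ib[of k r'] Ib[of k 0] by linarith
      then have "\<bar>(I k r' - I k 0) / r'\<bar> \<le> 2 * (\<eta> k * H) / r'" using r' by (simp add: divide_right_mono)
      moreover have "K' * W = r / 4" using K' by (simp add: W_def)
      ultimately show ?thesis using close[of k] k0[OF that] r unfolding real_norm_def by linarith
    qed
    then show "\<exists>k0. \<forall>k\<ge>k0. norm ((LINT x|lebesgue. h x * D k x) - 0) < r" by blast
  qed
qed

subsection \<open>Upper semicontinuity of the area\<close>

lemma seg_lipschitz_AE:
  assumes "open U" "seg_lipschitz U u"
  shows "AE x in lebesgue. x \<in> U \<longrightarrow> u differentiable (at x) \<and> norm (grad u x) \<le> 1"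
  using seg_lipschitz_imp_weakly_spacelike[OF assms] by (simp add: weakly_spacelike_def)

lemma grad_diff:
  assumes "u differentiable (at x)" "v differentiable (at x)"
  shows "(\<lambda>y. u y - v y) differentiable (at x)" "grad (\<lambda>y. u y - v y) x = grad u x - grad v x"
proof -
  have "GDERIV (\<lambda>y. u y - v y) x :> grad u x - grad v x"
    using GDERIV_grad(1)[OF assms(1)] GDERIV_grad(1)[OF assms(2)] by (rule GDERIV_diff)
  then show "(\<lambda>y. u y - v y) differentiable (at x)"
    by (auto simp: gderiv_def differentiable_def)
  then show "grad (\<lambda>y. u y - v y) x = grad u x - grad v x"
    using GDERIV_grad(2) \<open>GDERIV _ x :> _\<close> by metis
qed

lemma grad_measurable:
  fixes v :: "'a::euclidean_space \<Rightarrow> real"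
  assumes U: "open U" "seg_lipschitz U v" and S: "S \<in> sets lebesgue" "S \<subseteq> U"
  shows "(\<lambda>x. indicator S x *\<^sub>R grad v x) \<in> borel_measurable lebesgue"
proof (subst borel_measurable_euclidean_space, rule ballI)
  fix b :: 'a assume b: "b \<in> Basis"
  \<comment> \<open>\<open>V\<close> is Borel on the whole space, even where difference quotients
    step out of \<open>U\<close>, and it has the gradient of \<open>v\<close> on the open set
    \<open>U\<close>.\<close>
  define V where "V x = indicator U x *\<^sub>R v x" for x
  have "V \<in> borel_measurable borel" unfolding V_def[abs_def]
    using U by (intro borel_measurable_continuous_on_indicator seg_lipschitz_continuous_on) auto
  then have "V \<in> borel_measurable lborel" by simp
  then have Vm: "V \<in> borel_measurable lebesgue" by (rule measurable_completion)
  define q where "q n x = indicator S x * ((V (x + (1 / Suc n) *\<^sub>R b) - V x) / (1 / Suc n))" for n x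
  have qm: "q n \<in> borel_measurable lebesgue" for n
    unfolding q_def using Vm lebesgue_integral_translate(1)[OF Vm] S(1) by auto
  have "AE x in lebesgue. (\<lambda>n. q n x) \<longlonglongrightarrow> indicator S x * (grad v x \<bullet> b)"
    using seg_lipschitz_AE[OF U]
  proof eventually_elim
    case (elim x)
    show ?case
    proof (cases "x \<in> S")
      case True
      then have x: "x \<in> U" using S by auto
      have "V differentiable (at x)" "grad V x = grad v x"
        using grad_cong[of U x V v 0] U x elim by (auto simp: V_def)
      then show ?thesis using diffquot_tendsto[of V x b] True by (simp add: q_def)
    qed (simp add: q_def)
  qed
  then have "(\<lambda>x. indicator S x * (grad v x \<bullet> b)) \<in> borel_measurable lebesgue"
    by (rule AE_LIMSEQ_measurable[OF qm])
  then show "(\<lambda>x. (indicator S x *\<^sub>R grad v x) \<bullet> b) \<in> borel_measurable lebesgue" by simp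
qed

abbreviation area_density :: "('a::euclidean_space \<Rightarrow> real) \<Rightarrow> 'a \<Rightarrow> real" where
  "area_density v x \<equiv> sqrt (1 - (norm (grad v x))\<^sup>2)"

lemma area_density_AE:
  assumes "open U" "seg_lipschitz U v"
  shows "AE x in lebesgue. x \<in> U \<longrightarrow> 0 \<le> area_density v x \<and> area_density v x \<le> 1"
  using seg_lipschitz_AE[OF assms]
  by eventually_elim (auto simp: abs_square_le_1)

lemma area_density_integrable:
  fixes v :: "'a::euclidean_space \<Rightarrow> real"
  assumes U: "open U" "seg_lipschitz U v" and S: "S \<in> lmeasurable" "S \<subseteq> U"
  shows "set_integrable lebesgue S (area_density v)"
  unfolding set_integrable_def
proof (rule AE_bounded_integrable[OF _ S(1)])
  have S': "S \<in> sets lebesgue" using S by auto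
  define g where "g x = indicator S x *\<^sub>R grad v x" for x
  have "g \<in> borel_measurable lebesgue" unfolding g_def[abs_def] by (rule grad_measurable[OF U S' S(2)])
  then have "(\<lambda>x. indicator S x * sqrt (1 - (norm (g x))\<^sup>2)) \<in> borel_measurable lebesgue"
    using S' by measurable
  moreover have "(\<lambda>x. indicator S x * sqrt (1 - (norm (g x))\<^sup>2)) = (\<lambda>x. indicator S x *\<^sub>R area_density v x)"
    by (auto simp: indicator_def g_def)
  ultimately show "(\<lambda>x. indicator S x *\<^sub>R area_density v x) \<in> borel_measurable lebesgue" by simp
  show "AE x in lebesgue. x \<in> S \<longrightarrow> \<bar>indicator S x *\<^sub>R area_density v x\<bar> \<le> 1"
    using area_density_AE[OF U]
  proof eventually_elim
    case (elim x)
    have "x \<in> S \<Longrightarrow> x \<in> U" using S(2) by blast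
    then show ?case using elim by auto
  qed
qed auto

lemma uniform_limit_bound_seq:
  fixes u :: "nat \<Rightarrow> 'a::euclidean_space \<Rightarrow> real"
  assumes K: "compact K" and c: "\<And>k. continuous_on K (u k)" "continuous_on K v"
    and ul: "uniform_limit K u v sequentially"
  obtains \<eta> where "\<eta> \<longlonglongrightarrow> 0" "\<And>k x. x \<in> K \<Longrightarrow> \<bar>u k x - v x\<bar> \<le> \<eta> k" "\<And>k. 0 \<le> \<eta> k"
proof
  \<comment> \<open>Inserting 0 keeps the supremum meaningful for empty \<open>K\<close> and makes
    its nonnegativity immediate.\<close>
  define \<eta> where "\<eta> k = Sup (insert 0 ((\<lambda>x. \<bar>u k x - v x\<bar>) ` K))" for k
  have bdd: "bdd_above (insert 0 ((\<lambda>x. \<bar>u k x - v x\<bar>) ` K))" for k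
  proof -
    have "compact ((\<lambda>x. \<bar>u k x - v x\<bar>) ` K)"
      by (intro compact_continuous_image K continuous_intros c)
    then have "bdd_above ((\<lambda>x. \<bar>u k x - v x\<bar>) ` K)" by (intro bounded_imp_bdd_above compact_imp_bounded)
    then show ?thesis by simp
  qed
  show 1: "\<bar>u k x - v x\<bar> \<le> \<eta> k" if "x \<in> K" for k x
    unfolding \<eta>_def using that by (intro cSup_upper bdd) auto
  show 2: "0 \<le> \<eta> k" for k unfolding \<eta>_def by (intro cSup_upper bdd) auto
  show "\<eta> \<longlonglongrightarrow> 0"
  proof (rule tendstoI)
    fix r :: real assume r: "0 < r"
    have "\<forall>\<^sub>F k in sequentially. \<forall>x\<in>K. dist (u k x) (v x) < r / 2" using uniform_limitD[OF ul, of "r/2"] r by simp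
    then show "\<forall>\<^sub>F k in sequentially. dist (\<eta> k) 0 < r"
    proof eventually_elim
      case (elim k)
      have "\<eta> k \<le> r / 2" unfolding \<eta>_def using elim r
        by (intro cSup_least) (auto simp: dist_real_def intro: less_imp_le)
      then show ?case using 2[of k] r by simp
    qed
  qed
qed

text \<open>The two vectors \<open>(p, sqrt (a - |p|\<^sup>2))\<close> and \<open>(q, sqrt (a - |q|\<^sup>2))\<close> have length \<open>sqrt a\<close>; the
  tangent inequality is the Cauchy--Schwarz inequality for them.\<close>

lemma sqrt_tangent:
  fixes p q :: "'a::real_inner"
  assumes "(norm p)\<^sup>2 \<le> a" "(norm q)\<^sup>2 < a"
  shows "sqrt (a - (norm p)\<^sup>2) \<le> sqrt (a - (norm q)\<^sup>2) - q \<bullet> (p - q) / sqrt (a - (norm q)\<^sup>2)"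
proof -
  define P Q where "P = sqrt (a - (norm p)\<^sup>2)" and "Q = sqrt (a - (norm q)\<^sup>2)"
  have PQ: "P \<ge> 0" "Q > 0" "P\<^sup>2 = a - (norm p)\<^sup>2" "Q\<^sup>2 = a - (norm q)\<^sup>2" using assms by (auto simp: P_def Q_def)
  have "0 \<le> (P - Q)\<^sup>2 + (norm (p - q))\<^sup>2" by simp
  also have "\<dots> = 2 * a - 2 * (P * Q) - 2 * (p \<bullet> q)"
    using PQ(3,4) by (simp add: power2_diff power2_norm_eq_inner algebra_simps inner_commute)
  finally have "P * Q \<le> a - p \<bullet> q" by simp
  also have "\<dots> = Q * Q - q \<bullet> (p - q)"
    using PQ(4) by (simp add: power2_eq_square[symmetric] inner_diff_right inner_commute power2_norm_eq_inner)
  finally have "P \<le> (Q * Q - q \<bullet> (p - q)) / Q" using PQ(2) by (simp add: pos_le_divide_eq)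
  then show ?thesis using PQ(2) unfolding P_def[symmetric] Q_def[symmetric] by (simp add: diff_divide_distrib)
qed

text \<open>The difference \<open>u k - v\<close> is cut off to the compact
  \<open>d / 2\<close>-neighbourhood \<open>C2\<close> of \<open>C\<close>. The jump at the edge of
  \<open>C2\<close> is never seen, since the increments involved start within \<open>d / 4\<close>
  of \<open>C\<close> and have length at most \<open>d / 4\<close>.\<close>

lemma weak_convergence_grad:
  fixes u :: "nat \<Rightarrow> 'a::euclidean_space \<Rightarrow> real"
  assumes U: "open U" "\<And>k. seg_lipschitz U (u k)" "seg_lipschitz U v"
    and ul: "\<And>K. compact K \<Longrightarrow> K \<subseteq> U \<Longrightarrow> uniform_limit K u v sequentially"
    and C: "compact C" "C \<subseteq> U"
    and h: "h \<in> borel_measurable lebesgue" "\<And>x. \<bar>h x\<bar> \<le> M" "\<And>x. x \<notin> C \<Longrightarrow> h x = 0"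
    and b: "norm b \<le> 1"
  shows "(\<lambda>k. LINT x|lebesgue. h x * ((grad (u k) x - grad v x) \<bullet> b)) \<longlonglongrightarrow> 0"
proof -
  obtain d where d0: "d > 0" "(\<Union>x\<in>C. ball x d) \<subseteq> U"
    by (rule compact_subset_open_imp_ball_epsilon_subset[OF C(1) U(1) C(2)])
  then have d: "ball x d \<subseteq> U" if "x \<in> C" for x using that by auto
  define C2 where "C2 = {x + y | x y. x \<in> C \<and> y \<in> cball 0 (d / 2)}"
  have cC2: "compact C2" unfolding C2_def by (intro compact_sums C) auto
  have inC2: "x + p \<in> C2" if "x \<in> C" "norm p \<le> d / 2" for x p using that by (auto simp: C2_def)
  have C2U: "C2 \<subseteq> U"
  proof
    fix z assume "z \<in> C2"
    then obtain x y where z: "z = x + y" "x \<in> C" "norm y \<le> d / 2" by (auto simp: C2_def)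
    then have "z \<in> ball x d" using d0(1) by (simp add: dist_norm)
    then show "z \<in> U" using d z by blast
  qed
  have cont: "continuous_on C2 (u k)" "continuous_on C2 v" for k
    using continuous_on_subset[OF seg_lipschitz_continuous_on[OF U(1)] C2U] U by auto
  obtain \<eta> where \<eta>: "\<eta> \<longlonglongrightarrow> 0" "\<And>k x. x \<in> C2 \<Longrightarrow> \<bar>u k x - v x\<bar> \<le> \<eta> k" "\<And>k. 0 \<le> \<eta> k"
    using uniform_limit_bound_seq[OF cC2 cont ul[OF cC2 C2U]] by blast
  define w where "w k x = indicator C2 x *\<^sub>R (u k x - v x)" for k x
  show ?thesis
  proof (rule weak_gradient_convergence[where C = C and w = w and \<eta> = \<eta> and d' = "d / 4" and K = 2 and e = b])
    show "bounded C" using C(1) by (rule compact_imp_bounded)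
    have "w k \<in> borel_measurable borel" for k unfolding w_def[abs_def]
      by (intro borel_measurable_continuous_on_indicator continuous_intros cont borel_closed compact_imp_closed cC2)
    then have "w k \<in> borel_measurable lborel" for k by simp
    then show "w k \<in> borel_measurable lebesgue" for k by (rule measurable_completion)
    show "\<bar>w k x\<bar> \<le> \<eta> k" for k x using \<eta>(2)[of x k] \<eta>(3)[of k] by (cases "x \<in> C2") (auto simp: w_def)
    show "\<bar>w k (x + q + p) - w k (x + q)\<bar> \<le> 2 * norm p"
      if "x \<in> C" "norm q \<le> d / 4" "norm p \<le> d / 4" for k x p q
    proof -
      have n: "norm (q + p) \<le> d / 2" using norm_triangle_ineq[of q p] that by linarith
      have 1: "x + q \<in> C2" using that d0 by (intro inC2) auto
      have 2: "x + q + p \<in> C2" using inC2[OF that(1) n] by (simp add: add.assoc)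
      have "x + q \<in> ball x d" using that(2) d0(1) by (simp add: dist_norm)
      moreover have "x + q + p \<in> ball x d" using n d0(1) by (simp add: dist_norm add.assoc del: minus_add_distrib)
      ultimately have "x + q \<in> ball x d" "x + q + p \<in> ball x d" .
      then have "closed_segment (x + q + p) (x + q) \<subseteq> U"
        using closed_segment_subset[of "x + q + p" "ball x d" "x + q"] d[OF that(1)] by auto
      then have "\<bar>u k (x + q + p) - u k (x + q)\<bar> \<le> norm p" "\<bar>v (x + q + p) - v (x + q)\<bar> \<le> norm p"
        using seg_lipschitzD[OF U(2)] seg_lipschitzD[OF U(3)] by fastforce+
      then show ?thesis using 1 2 by (simp add: w_def)
    qed
    show "AE x in lebesgue. x \<in> C \<longrightarrow> (\<lambda>n. (w k (x + (1 / Suc n) *\<^sub>R b) - w k x) / (1 / Suc n))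
        \<longlonglongrightarrow> (grad (u k) x - grad v x) \<bullet> b" for k
      using seg_lipschitz_AE[OF U(1) U(2)[of k]] seg_lipschitz_AE[OF U(1) U(3)]
    proof eventually_elim
      case (elim x)
      show ?case
      proof
        assume x: "x \<in> C"
        then have D: "u k differentiable (at x)" "v differentiable (at x)" using elim C(2) by auto
        have "w k y = (u k y - v y) + 0" if "y \<in> ball x (d / 2)" for y
          using inC2[OF x, of "y - x"] that by (simp add: w_def dist_norm norm_minus_commute)
        then have "w k differentiable (at x)" "grad (w k) x = grad (u k) x - grad v x"
          using grad_cong[of "ball x (d / 2)" x "w k" "\<lambda>y. u k y - v y" 0] grad_diff[OF D] d0(1) by auto
        then show "(\<lambda>n. (w k (x + (1 / Suc n) *\<^sub>R b) - w k x) / (1 / Suc n)) \<longlonglongrightarrow> (grad (u k) x - grad v x) \<bullet> b"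
          using diffquot_tendsto[of "w k" x b] by simp
      qed
    qed
  qed (use h \<eta> d0 b in auto)
qed

text \<open>The tangent inequality bounds the density of \<open>u k\<close> by that of
  \<open>v\<close> plus a term linear in \<open>grad (u k) - grad v\<close>, whose integral tends to
  0 by weak convergence. With \<open>a = 1 + r\<^sup>2\<close> under the root, the coefficients of
  that term are bounded by \<open>1 / r\<close> and the density of \<open>v\<close> grows by at most
  \<open>r\<close>.\<close>

lemma area_upper_semicontinuous:
  fixes u :: "nat \<Rightarrow> 'a::euclidean_space \<Rightarrow> real"
  assumes U: "open U" "\<And>k. seg_lipschitz U (u k)" "seg_lipschitz U v"
    and ul: "\<And>K. compact K \<Longrightarrow> K \<subseteq> U \<Longrightarrow> uniform_limit K u v sequentially"
    and C: "compact C" "C \<subseteq> U" and S: "S \<in> sets lebesgue" "S \<subseteq> C" and \<epsilon>: "0 < \<epsilon>"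
  shows "\<forall>\<^sub>F k in sequentially. (LINT x:S|lebesgue. area_density (u k) x) \<le> (LINT x:S|lebesgue. area_density v x) + \<epsilon>"
proof -
  have SU: "S \<subseteq> U" using S C by auto
  have Sm: "S \<in> lmeasurable" using S C(1) bounded_subset compact_imp_bounded bounded_set_imp_lmeasurable by metis
  define m where "m = measure lebesgue S"
  have m0: "m \<ge> 0" by (simp add: m_def)
  define r where "r = \<epsilon> / (2 * (m + 1))"
  have r: "r > 0" "r * m \<le> \<epsilon> / 2"
  proof -
    show "r > 0" using \<epsilon> m0 by (simp add: r_def)
    then have "r * m \<le> r * (m + 1)" by simp
    also have "\<dots> = \<epsilon> / 2" using m0 by (simp add: r_def field_simps)
    finally show "r * m \<le> \<epsilon> / 2" .
  qed
  define a where "a = 1 + r\<^sup>2"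
  define g where "g x = indicator S x *\<^sub>R grad v x" for x
  have gm: "g \<in> borel_measurable lebesgue" unfolding g_def[abs_def] by (rule grad_measurable[OF U(1,3) S(1) SU])
  \<comment> \<open>Altering the gradient of \<open>v\<close> on a null set makes the bounds hold at
    every point, as the bounded multipliers \<open>h b\<close> require.\<close>
  define G where "G x = (if norm (g x) \<le> 1 then g x else 0)" for x
  have Gm: "G \<in> borel_measurable lebesgue" unfolding G_def[abs_def] using gm by measurable
  have G1: "norm (G x) \<le> 1" for x by (simp add: G_def)
  have G2: "(norm (G x))\<^sup>2 \<le> 1" for x using G1[of x] by (simp add: abs_square_le_1)
  have G0: "G x = 0" if "x \<notin> S" for x using that by (simp add: G_def g_def)
  define Q where "Q x = sqrt (a - (norm (G x))\<^sup>2)" for x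
  have Qr: "Q x \<ge> r" for x unfolding Q_def using G2[of x] r(1) by (intro real_le_rsqrt) (auto simp: a_def)
  have Qm: "Q \<in> borel_measurable lebesgue" unfolding Q_def[abs_def] using Gm by measurable
  \<comment> \<open>The component along \<open>b\<close> of the slope of
    \<open>\<lambda>q. sqrt (a - (norm q)\<^sup>2)\<close> at \<open>G x\<close>.\<close>
  define h where "h b x = - (G x \<bullet> b) / Q x" for b x
  have hm: "h b \<in> borel_measurable lebesgue" for b unfolding h_def[abs_def] using Gm Qm by measurable
  have hM: "\<bar>h b x\<bar> \<le> 1 / r" if "b \<in> Basis" for b x
  proof -
    have "\<bar>G x \<bullet> b\<bar> \<le> 1" using Basis_le_norm[OF that, of "G x"] G1[of x] by linarith
    then show ?thesis unfolding h_def using Qr[of x] r(1) by (auto simp: abs_divide intro!: frac_le)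
  qed
  have h0: "h b x = 0" if "x \<notin> C" for b x
  proof -
    have "x \<notin> S" using that S(2) by blast
    then show ?thesis by (simp add: h_def G0)
  qed
  define E where "E k = (\<Sum>b\<in>Basis. LINT x|lebesgue. h b x * ((grad (u k) x - grad v x) \<bullet> b))" for k
  have "E \<longlonglongrightarrow> (\<Sum>b\<in>(Basis::'a set). 0)"
    unfolding E_def by (intro tendsto_sum weak_convergence_grad[OF U ul C hm hM h0]) auto
  then have ev: "\<forall>\<^sub>F k in sequentially. E k < \<epsilon> / 2" using \<epsilon> by (intro order_tendstoD(2)) auto
  have bound: "(LINT x:S|lebesgue. area_density (u k) x) \<le> (LINT x:S|lebesgue. area_density v x) + r * m + E k" for k
  proof -
    note AEs = seg_lipschitz_AE[OF U(1) U(2)[of k]] seg_lipschitz_AE[OF U(1) U(3)]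
    have hi: "integrable lebesgue (\<lambda>x. h b x * ((grad (u k) x - grad v x) \<bullet> b))" if b: "b \<in> Basis" for b
    proof (rule AE_bounded_integrable[OF _ Sm])
      have "(\<lambda>x. h b x * ((indicator S x *\<^sub>R grad (u k) x - g x) \<bullet> b)) \<in> borel_measurable lebesgue"
        using hm gm grad_measurable[OF U(1) U(2)[of k] S(1) SU] by measurable
      moreover have "(\<lambda>x. h b x * ((indicator S x *\<^sub>R grad (u k) x - g x) \<bullet> b)) = (\<lambda>x. h b x * ((grad (u k) x - grad v x) \<bullet> b))"
        using G0 by (auto simp: h_def g_def indicator_def)
      ultimately show "(\<lambda>x. h b x * ((grad (u k) x - grad v x) \<bullet> b)) \<in> borel_measurable lebesgue" by simp
      show "AE x in lebesgue. x \<in> S \<longrightarrow> \<bar>h b x * ((grad (u k) x - grad v x) \<bullet> b)\<bar> \<le> 1 / r * 2"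
        using AEs
      proof eventually_elim
        case (elim x)
        show ?case
        proof
          assume "x \<in> S"
          then have "norm (grad (u k) x) \<le> 1" "norm (grad v x) \<le> 1" using elim SU by auto
          then have "norm (grad (u k) x - grad v x) \<le> 2" using norm_triangle_ineq4[of "grad (u k) x" "grad v x"] by linarith
          then have "\<bar>(grad (u k) x - grad v x) \<bullet> b\<bar> \<le> 2" using Basis_le_norm[OF b, of "grad (u k) x - grad v x"] by linarith
          then show "\<bar>h b x * ((grad (u k) x - grad v x) \<bullet> b)\<bar> \<le> 1 / r * 2"
            unfolding abs_mult using hM[OF b, of x] r(1) by (intro mult_mono) auto
        qed
      qed
    qed (simp add: h_def G0)
    have iv: "integrable lebesgue (\<lambda>x. indicator S x *\<^sub>R area_density v x)"
      using area_density_integrable[OF U(1,3) Sm SU] by (simp add: set_integrable_def)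
    have iu: "integrable lebesgue (\<lambda>x. indicator S x *\<^sub>R area_density (u k) x)"
      using area_density_integrable[OF U(1) U(2)[of k] Sm SU] by (simp add: set_integrable_def)
    have ir: "integrable lebesgue (\<lambda>x. r * indicator S x)" using Sm by (auto simp: fmeasurable_def)
    define J where "J x = (indicator S x *\<^sub>R area_density v x + r * indicator S x) + (\<Sum>b\<in>Basis. h b x * ((grad (u k) x - grad v x) \<bullet> b))" for x
    have "(LINT x:S|lebesgue. area_density (u k) x) \<le>
      (LINT x|lebesgue. J x)"
      unfolding set_lebesgue_integral_def
    proof (rule integral_mono_AE[OF iu])
      show "integrable lebesgue J"
        unfolding J_def using iv ir hi by auto
      show "AE x in lebesgue. indicator S x *\<^sub>R area_density (u k) x \<le>
         J x"
        using AEs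
      proof eventually_elim
        case (elim x)
        show ?case
        proof (cases "x \<in> S")
          case True
          define p where "p = grad (u k) x"
          have n: "norm p \<le> 1" "norm (grad v x) \<le> 1" using elim True SU by (auto simp: p_def)
          have Gx: "G x = grad v x" using n True by (simp add: G_def g_def)
          have p2: "(norm p)\<^sup>2 \<le> 1" using n by (simp add: abs_square_le_1)
          have r2: "r\<^sup>2 > 0" using r(1) by simp
          have "sqrt (1 - (norm p)\<^sup>2) \<le> sqrt (a - (norm p)\<^sup>2)" by (simp add: a_def)
          moreover have "sqrt (a - (norm p)\<^sup>2) \<le> Q x - G x \<bullet> (p - G x) / Q x"
          proof -
            have "(norm p)\<^sup>2 \<le> a" "(norm (G x))\<^sup>2 < a" using p2 G2[of x] r2 unfolding a_def by linarith+
            then show ?thesis unfolding Q_def by (rule sqrt_tangent)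
          qed
          moreover have "Q x \<le> sqrt (1 - (norm (G x))\<^sup>2) + r"
            using sqrt_add_le_add_sqrt[of "1 - (norm (G x))\<^sup>2" "r\<^sup>2"] G2[of x] r(1) by (simp add: Q_def a_def algebra_simps)
          moreover have "(\<Sum>b\<in>Basis. h b x * ((p - G x) \<bullet> b)) = - (G x \<bullet> (p - G x) / Q x)"
            unfolding h_def euclidean_inner[of "G x" "p - G x"] by (simp add: sum_divide_distrib sum_negf[symmetric])
          ultimately have "sqrt (1 - (norm p)\<^sup>2) \<le> (sqrt (1 - (norm (G x))\<^sup>2) + r) + (\<Sum>b\<in>Basis. h b x * ((p - G x) \<bullet> b))"
            by linarith
          then show ?thesis using True unfolding Gx p_def J_def by simp
        qed (simp add: h_def G0 J_def)
      qed
    qed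
    also have "\<dots> = (LINT x:S|lebesgue. area_density v x) + r * m + E k"
      using iv ir hi Sm unfolding J_def set_lebesgue_integral_def E_def m_def
      by (simp add: fmeasurable_def)
    finally show ?thesis .
  qed
  show ?thesis using ev
  proof eventually_elim
    case (elim k)
    then show ?case using bound[of k] r(2) by linarith
  qed
qed

subsection \<open>Limits of almost maximizing functions\<close>

lemma area_Un:
  assumes "open U" "seg_lipschitz U v" "S \<in> lmeasurable" "T \<in> lmeasurable" "S \<union> T \<subseteq> U" "S \<inter> T = {}"
  shows "area (S \<union> T) v = area S v + area T v"
  unfolding area_def using assms by (intro set_integral_Un area_density_integrable) auto

lemma area_nonneg:
  assumes "open U" "seg_lipschitz U v" "S \<subseteq> U"
  shows "0 \<le> area S v"
  unfolding area_def set_lebesgue_integral_def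
proof (rule integral_nonneg_AE)
  show "AE x in lebesgue. 0 \<le> indicator S x *\<^sub>R area_density v x"
    using area_density_AE[OF assms(1,2)]
  proof eventually_elim
    case (elim x)
    have "x \<in> S \<Longrightarrow> x \<in> U" using assms(3) by blast
    then show ?case using elim by (auto simp: indicator_def)
  qed
qed

lemma area_le_measure:
  assumes "open U" "seg_lipschitz U v" "S \<in> lmeasurable" "S \<subseteq> U"
  shows "area S v \<le> measure lebesgue S"
proof -
  have "area S v \<le> (LINT x|lebesgue. indicator S x)"
    unfolding area_def set_lebesgue_integral_def
  proof (rule integral_mono_AE)
    show "integrable lebesgue (\<lambda>x. indicator S x *\<^sub>R area_density v x)"
      using area_density_integrable[OF assms] by (simp add: set_integrable_def)
    show "integrable lebesgue (indicator S :: 'a \<Rightarrow> real)" using assms(3) by (auto simp: fmeasurable_def)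
    show "AE x in lebesgue. indicator S x *\<^sub>R area_density v x \<le> indicator S x"
      using area_density_AE[OF assms(1,2)]
    proof eventually_elim
      case (elim x)
      have "x \<in> S \<Longrightarrow> x \<in> U" using assms(4) by blast
      then show ?case using elim by (auto simp: indicator_def)
    qed
  qed
  then show ?thesis using assms(3) by (auto simp: fmeasurable_def)
qed

lemma area_mono:
  assumes "open U" "seg_lipschitz U v" "S \<in> lmeasurable" "T \<in> lmeasurable" "S \<subseteq> T" "T \<subseteq> U"
  shows "area S v \<le> area T v"
proof -
  have "area T v = area (S \<union> (T - S)) v" using assms(5) by (simp add: Un_absorb1)
  also have "\<dots> = area S v + area (T - S) v" using assms by (intro area_Un) auto
  finally show ?thesis using area_nonneg[OF assms(1,2), of "T - S"] assms by auto
qed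

lemma area_le_add_measure:
  assumes "open U" "seg_lipschitz U v" "S \<in> lmeasurable" "T \<in> lmeasurable" "L \<in> lmeasurable"
    "S \<union> T \<union> L \<subseteq> U" "T \<subseteq> S \<union> L"
  shows "area T v \<le> area S v + measure lebesgue L"
proof -
  have "area T v \<le> area (S \<union> (L - S)) v" using assms by (intro area_mono[of U]) auto
  also have "\<dots> = area S v + area (L - S) v" using assms by (intro area_Un) auto
  also have "area (L - S) v \<le> area L v" using assms by (intro area_mono[of U]) auto
  also have "area L v \<le> measure lebesgue L" using assms by (intro area_le_measure) auto
  finally show ?thesis by simp
qed

lemma area_cong_AE:
  assumes "open U" "seg_lipschitz U u" "open V" "seg_lipschitz V v" "S \<in> lmeasurable" "S \<subseteq> U" "S \<subseteq> V"
    and "AE x in lebesgue. x \<in> S \<longrightarrow> grad u x = grad v x"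
  shows "area S u = area S v"
  unfolding area_def set_lebesgue_integral_def
proof (rule integral_cong_AE)
  show "(\<lambda>x. indicator S x *\<^sub>R area_density u x) \<in> borel_measurable lebesgue"
    "(\<lambda>x. indicator S x *\<^sub>R area_density v x) \<in> borel_measurable lebesgue"
    using area_density_integrable[of U u S] area_density_integrable[of V v S] assms
    by (auto simp: set_integrable_def)
  show "AE x in lebesgue. indicator S x *\<^sub>R area_density u x = indicator S x *\<^sub>R area_density v x"
    using assms(8) by eventually_elim (auto simp: indicator_def)
qed

text \<open>\<open>S\<close> need not be open, so equal values do not give equal gradients
  pointwise; they do almost everywhere, by \<open>negligible_grad_neq\<close>.\<close>

lemma area_cong_eq:
  assumes "open U" "seg_lipschitz U u" "open V" "seg_lipschitz V v" "S \<in> lmeasurable" "S \<subseteq> U" "S \<subseteq> V"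
    and eq: "\<And>x. x \<in> S \<Longrightarrow> u x = v x"
  shows "area S u = area S v"
proof (rule area_cong_AE[OF assms(1-7)])
  have "AE x in lebesgue. x \<notin> {x\<in>S. u differentiable (at x) \<and> v differentiable (at x) \<and> grad u x \<noteq> grad v x}"
    using negligible_grad_neq[OF eq] unfolding negligible_iff_null_sets by (rule AE_not_in)
  then show "AE x in lebesgue. x \<in> S \<longrightarrow> grad u x = grad v x"
    using seg_lipschitz_AE[OF assms(1,2)] seg_lipschitz_AE[OF assms(3,4)]
  proof eventually_elim
    case (elim x)
    have "x \<in> S \<Longrightarrow> x \<in> U \<and> x \<in> V" using assms(6,7) by blast
    then show ?case using elim by blast
  qed
qed

lemma segment_limit_bound:
  fixes f :: "'a::euclidean_space \<Rightarrow> real"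
  assumes yz: "y \<noteq> z" and lim: "(f \<longlongrightarrow> l) (at y within open_segment y z)"
    and b: "\<And>p. p \<in> open_segment y z \<Longrightarrow> \<bar>f x - f p\<bar> \<le> c * norm (x - p)"
  shows "\<bar>f x - l\<bar> \<le> c * norm (x - y)"
proof (rule tendsto_le)
  have "y \<in> closure (open_segment y z - {y})" using yz by (simp add: open_segment_def)
      (metis closure_open_segment ends_in_segment(1) insert_commute open_segment_def Diff_insert2 Diff_idemp)
  then show "at y within open_segment y z \<noteq> bot"
    using not_in_closure_trivial_limitI trivial_limit_within islimpt_in_closure by blast
  show "((\<lambda>p. \<bar>f x - f p\<bar>) \<longlongrightarrow> \<bar>f x - l\<bar>) (at y within open_segment y z)"
    by (intro tendsto_intros lim)
  show "((\<lambda>p. c * norm (x - p)) \<longlongrightarrow> c * norm (x - y)) (at y within open_segment y z)"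
    by (intro tendsto_intros)
  show "\<forall>\<^sub>F p in at y within open_segment y z. \<bar>f x - f p\<bar> \<le> c * norm (x - p)"
    using b by (auto simp: eventually_at_filter)
qed

text \<open>Since the difference vanishes along segments at the boundary, it is small near the nearest boundary
  point; so the set where two functions with the same boundary values differ by at least \<open>\<epsilon>\<close> is
  compactly contained.\<close>

lemma same_bdry_values_diff_le:
  fixes u v :: "'a::euclidean_space \<Rightarrow> real"
  assumes W: "open W" "bounded W" and uv: "seg_lipschitz W u" "seg_lipschitz W v"
    and bd: "bdry_values W (\<lambda>x. v x - u x) (\<lambda>_. 0)" and x: "x \<in> W"
  shows "\<bar>v x - u x\<bar> \<le> 2 * infdist x (- W)"
proof -
  have "- W \<noteq> {}" using W(2) not_bounded_UNIV by (metis Compl_UNIV_eq double_compl)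
  then obtain y where y: "y \<in> - W" "infdist x (- W) = dist x y"
    using infdist_attains_inf[of "- W" x] W(1) by auto
  have yx: "y \<noteq> x" using x y by auto
  have ball: "ball x (dist x y) \<subseteq> W"
  proof
    fix p assume p: "p \<in> ball x (dist x y)"
    show "p \<in> W"
    proof (rule ccontr)
      assume "p \<notin> W"
      then have "infdist x (- W) \<le> dist x p" by (intro infdist_le) auto
      then show False using p y by simp
    qed
  qed
  have seg: "p \<in> ball x (dist x y)" if "p \<in> open_segment y x" for p
    using dist_in_open_segment[OF that] by (simp add: dist_commute)
  then have segW: "open_segment y x \<subseteq> W" using ball by blast
  have "y \<in> closure W" using closure_mono[OF segW] yx by auto
  then have "y \<in> frontier W" using y W(1) by (simp add: frontier_def interior_open)
  then have "((\<lambda>x. v x - u x) \<longlongrightarrow> 0) (at y within open_segment y x)"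
    using bd yx segW unfolding bdry_values_def by auto
  moreover have "\<bar>(v x - u x) - (v p - u p)\<bar> \<le> 2 * norm (x - p)" if "p \<in> open_segment y x" for p
  proof -
    have "closed_segment x p \<subseteq> ball x (dist x y)" using seg[OF that] yx by (intro closed_segment_subset) auto
    then have "closed_segment x p \<subseteq> W" using ball by blast
    then have "\<bar>u x - u p\<bar> \<le> norm (x - p)" "\<bar>v x - v p\<bar> \<le> norm (x - p)" using seg_lipschitzD uv by blast+
    then show ?thesis by linarith
  qed
  ultimately have "\<bar>(v x - u x) - 0\<bar> \<le> 2 * norm (x - y)" by (rule segment_limit_bound[OF yx])
  then show ?thesis using y by (simp add: dist_norm)
qed

text \<open>The competitor \<open>w\<close> for \<open>u k\<close> in the proof is \<open>u k\<close> truncated to the strip between \<open>v - c\<close> and \<open>v + c\<close>. It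
  differs from \<open>u k\<close> only in a compact subset of \<open>W\<close>, so it does not matter how \<open>u k\<close> and \<open>u0\<close>
  compare near the boundary of \<open>W\<close>.\<close>

lemma area_comparison_level:
  fixes u :: "nat \<Rightarrow> 'a::euclidean_space \<Rightarrow> real"
  assumes U: "open U" "\<And>k. seg_lipschitz U (u k)" "seg_lipschitz U u0"
    and ul: "\<And>K. compact K \<Longrightarrow> K \<subseteq> U \<Longrightarrow> uniform_limit K u u0 sequentially"
    and e: "e \<longlonglongrightarrow> 0" and \<rho>: "filterlim \<rho> at_top sequentially"
    and almost: "\<And>k K w. compact K \<Longrightarrow> K \<subseteq> U \<inter> ball 0 (\<rho> k) \<Longrightarrow> seg_lipschitz U w \<Longrightarrow>
        (\<And>x. x \<in> U - K \<Longrightarrow> w x = u k x) \<Longrightarrow> area K w \<le> area K (u k) + e k"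
    and W: "open W" "bounded W" "W \<subseteq> U" and v: "seg_lipschitz W v"
    and bd: "bdry_values W (\<lambda>x. v x - u0 x) (\<lambda>_. 0)" and c: "0 < c"
  shows "area {x\<in>W. c < \<bar>u0 x - v x\<bar>} v \<le> area {x\<in>W. c < \<bar>u0 x - v x\<bar>} u0
           + measure lebesgue {x\<in>W. 0 < \<bar>u0 x - v x\<bar> \<and> \<bar>u0 x - v x\<bar> \<le> c}"
proof (cases "W = {}")
  case False
  define S where "S = {x\<in>W. c < \<bar>u0 x - v x\<bar>}"
  define L where "L = {x\<in>W. 0 < \<bar>u0 x - v x\<bar> \<and> \<bar>u0 x - v x\<bar> \<le> c}"
  define D where "D x = infdist x (- W)" for x
  have Wne: "- W \<noteq> {}" using W(2) not_bounded_UNIV by (metis Compl_UNIV_eq double_compl)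
  have clW: "closed (- W)" using W(1) by auto
  have Dpos: "D x > 0 \<longleftrightarrow> x \<in> W" for x
    using in_closed_iff_infdist_zero[OF clW Wne, of x] infdist_nonneg[of x "- W"] unfolding D_def by force
  have Dtri: "D x \<le> D y + dist x y" for x y unfolding D_def by (rule infdist_triangle)
  have u0W: "seg_lipschitz W u0" using U(3) W(3) by (rule seg_lipschitz_subset)
  have ukW: "seg_lipschitz W (u k)" for k using U(2) W(3) by (rule seg_lipschitz_subset)
  have diff: "\<bar>u0 x - v x\<bar> \<le> 2 * D x" if "x \<in> W" for x
    using same_bdry_values_diff_le[OF W(1,2) u0W v bd that] by (simp add: D_def abs_minus_commute)
  have Wl: "W \<in> lmeasurable" using W(1,2) bounded_set_imp_lmeasurable[of W] by auto
  have cont: "continuous_on W (u k)" "continuous_on W u0" "continuous_on W v" "continuous_on UNIV D" for k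
    using seg_lipschitz_continuous_on[OF W(1)] u0W ukW v by (auto simp: D_def[abs_def] intro!: continuous_intros)
  have S_open: "open S"
  proof -
    have "open (W \<inter> (\<lambda>x. \<bar>u0 x - v x\<bar>) -` {c<..})"
      by (intro continuous_open_preimage W continuous_intros cont open_greaterThan)
    moreover have "W \<inter> (\<lambda>x. \<bar>u0 x - v x\<bar>) -` {c<..} = S" by (auto simp: S_def)
    ultimately show ?thesis by simp
  qed
  have lmeas: "X \<in> lmeasurable" if "X \<in> sets lebesgue" "X \<subseteq> W" for X
    using that W(2) bounded_subset bounded_set_imp_lmeasurable by blast
  have Sl: "S \<in> lmeasurable" using S_open by (intro lmeas) (auto simp: S_def)
  have Ll: "L \<in> lmeasurable"
  proof -
    have "open (W \<inter> (\<lambda>x. \<bar>u0 x - v x\<bar>) -` {0<..})"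
      by (intro continuous_open_preimage W continuous_intros cont open_greaterThan)
    moreover have "L = (W \<inter> (\<lambda>x. \<bar>u0 x - v x\<bar>) -` {0<..}) - S" by (auto simp: L_def S_def)
    ultimately show ?thesis using S_open by (intro lmeas) (auto simp: L_def)
  qed
  \<comment> \<open>On \<open>S\<close> the bound \<open>diff\<close> gives
    \<open>D > c / 2\<close>, so this compact set contains \<open>S\<close> with room to
    spare.\<close>
  define K where "K = {x. c / 4 \<le> D x}"
  have KW: "K \<subseteq> W" 
  proof
    fix x assume "x \<in> K"
    then have "D x > 0" using c by (simp add: K_def)
    then show "x \<in> W" using Dpos by blast
  qed
  have cK: "compact K"
  proof -
    have "closed K" unfolding K_def by (intro closed_Collect_le cont continuous_intros)
    then show ?thesis using KW W(2) bounded_subset compact_eq_bounded_closed by blast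
  qed
  have Kl: "K \<in> lmeasurable" using cK by (rule lmeasurable_compact)
  have SK: "S \<subseteq> K" using diff c by (force simp: S_def K_def)
  \<comment> \<open>The part of \<open>K\<close> where the truncation of \<open>u k\<close> takes
    effect. A further region \<open>c < \<bar>u k x - v x\<bar>\<close> close to the boundary of
    \<open>W\<close> may exist; there \<open>u k\<close> is left alone.\<close>
  define T where "T k = {x\<in>W. c / 4 < D x \<and> c < \<bar>u k x - v x\<bar>}" for k
  have Topen: "open {x\<in>W. c / 4 < D x \<and> c < s * (u k x - v x)}" for k s
  proof -
    have "open (W \<inter> (\<lambda>x. s * (u k x - v x)) -` {c<..})"
      by (intro continuous_open_preimage W continuous_intros cont open_greaterThan)
    moreover have "open (D -` {c / 4<..})" using cont(4) by (intro open_vimage) auto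
    moreover have "{x\<in>W. c / 4 < D x \<and> c < s * (u k x - v x)} = (W \<inter> (\<lambda>x. s * (u k x - v x)) -` {c<..}) \<inter> D -` {c / 4<..}" by auto
    ultimately show ?thesis by (metis open_Int)
  qed
  have Tdec: "T k = {x\<in>W. c / 4 < D x \<and> c < 1 * (u k x - v x)} \<union> {x\<in>W. c / 4 < D x \<and> c < (- 1) * (u k x - v x)}" for k
    using c by (auto simp: T_def)
  have T_open: "open (T k)" for k unfolding Tdec using Topen by (intro open_Un)
  have Tl: "T k \<in> lmeasurable" for k using T_open by (intro lmeas) (auto simp: T_def)
  have TK: "T k \<subseteq> K" for k by (auto simp: T_def K_def)
  define w where "w k x = (if x \<in> T k then v x + c * sgn (u k x - v x) else u k x)" for k x
  have key: "area (T k) v \<le> area (T k) (u k) + e k"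
    and Tsub: "T k \<subseteq> S \<union> L"
    if near: "\<And>x. x \<in> K \<Longrightarrow> \<bar>u k x - u0 x\<bar> \<le> c / 4" and ball: "W \<subseteq> ball 0 (\<rho> k)" for k
  proof -
    \<comment> \<open>Uniform convergence on \<open>K\<close> gives \<open>3/4 * c\<close>, and
      \<open>diff\<close> turns it into \<open>D x > 3/8 * c\<close>. Between the thresholds
      \<open>1/4 * c\<close> and \<open>3/8 * c\<close> no truncation happens, so the two
      definitions of \<open>w k\<close> fit together.\<close>
    have T34: "3 / 4 * c < \<bar>u0 x - v x\<bar>" if "x \<in> T k" for x
    proof -
      have "x \<in> K" using that TK[of k] by blast
      then have "\<bar>u k x - u0 x\<bar> \<le> c / 4" by (rule near)
      moreover have "c < \<bar>u k x - v x\<bar>" using that by (simp add: T_def)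
      ultimately show ?thesis by linarith
    qed
    have TD: "3 / 8 * c < D x" if "x \<in> T k" for x
      using T34[OF that] diff[of x] that by (force simp: T_def)
    show "T k \<subseteq> S \<union> L" using T34 c by (force simp: S_def L_def T_def)
    \<comment> \<open>Where \<open>D > c / 4\<close>, the function \<open>w k\<close> is
      \<open>u k\<close> clamped between \<open>v - c\<close> and \<open>v + c\<close>. Elsewhere a
      ball of radius \<open>c / 8\<close> still misses \<open>T k\<close>, as
      \<open>1/4 + 1/8 = 3/8\<close>, and \<open>w k\<close> is \<open>u k\<close> there.\<close>
    have wseg: "seg_lipschitz U (w k)"
    proof (rule seg_lipschitz_localI)
      fix x assume x: "x \<in> U"
      show "\<exists>r>0. 1-lipschitz_on (ball x r) (w k)"
      proof (cases "c / 4 < D x")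
        case True
        have "open (D -` {c / 4<..})" using cont(4) by (intro open_vimage) auto
        then obtain r where r: "r > 0" "ball x r \<subseteq> D -` {c / 4<..}" using True openE[of _ x] by blast
        have rK: "y \<in> W" "c / 4 < D y" if "y \<in> ball x r" for y
          using r(2) that KW by (auto simp: K_def subset_iff)
        have rW: "ball x r \<subseteq> W" using rK by blast
        have weq: "w k y = max (min (u k y) (v y + c)) (v y - c)" if "y \<in> ball x r" for y
          using rK[OF that] c by (auto simp: w_def T_def sgn_if)
        have "1-lipschitz_on (ball x r) (u k)" "1-lipschitz_on (ball x r) v"
          using seg_lipschitz_convex[OF ukW _ rW] seg_lipschitz_convex[OF v _ rW] by auto
        then have "\<bar>u k y - u k z\<bar> \<le> dist y z" "\<bar>v y - v z\<bar> \<le> dist y z" if "y \<in> ball x r" "z \<in> ball x r" for y z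
          using lipschitz_onD that by (fastforce simp: dist_real_def)+
        then have "\<bar>w k y - w k z\<bar> \<le> dist y z" if "y \<in> ball x r" "z \<in> ball x r" for y z
          unfolding weq[OF that(1)] weq[OF that(2)] using that by (smt (verit))
        then have "1-lipschitz_on (ball x r) (w k)" by (intro lipschitz_onI) (auto simp: dist_real_def)
        then show ?thesis using r(1) by blast
      next
        case False
        obtain r where r: "r > 0" "ball x r \<subseteq> U" using U(1) x openE by blast
        define r' where "r' = min r (c / 8)"
        have r': "r' > 0" "ball x r' \<subseteq> U" using r c by (auto simp: r'_def)
        have "w k y = u k y" if "y \<in> ball x r'" for y
        proof -
          have "D y < 3 / 8 * c" using Dtri[of y x] False that by (auto simp: r'_def dist_commute)
          then have "y \<notin> T k" using TD[of y] by auto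
          then show ?thesis by (simp add: w_def)
        qed
        moreover have "1-lipschitz_on (ball x r') (u k)" using seg_lipschitz_convex[OF U(2) _ r'(2)] by auto
        ultimately have "1-lipschitz_on (ball x r') (w k)" by (metis (no_types, lifting) lipschitz_on_transform)
        then show ?thesis using r'(1) by blast
      qed
    qed
    have "area K (w k) \<le> area K (u k) + e k"
      using KW W(3) ball TK[of k] by (intro almost cK wseg) (auto simp: w_def)
    moreover have split: "area K f = area (T k) f + area (K - T k) f" if "seg_lipschitz U f" for f
    proof -
      have "area (T k \<union> (K - T k)) f = area (T k) f + area (K - T k) f"
        using that Tl Kl KW W(3) TK[of k] by (intro area_Un[OF U(1)]) auto
      then show ?thesis using TK[of k] by (simp add: Un_absorb1)
    qed
    moreover have "area (K - T k) (w k) = area (K - T k) (u k)"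
      using Kl Tl KW W(3) by (intro area_cong_eq[OF U(1) wseg U(1) U(2)]) (auto simp: w_def)
    moreover have "area (T k) (w k) = area (T k) v"
    proof (rule area_cong_AE[OF U(1) wseg W(1) v Tl])
      have "grad (w k) x = grad v x" if xT: "x \<in> T k" for x
      proof -
        consider "x \<in> {x\<in>W. c / 4 < D x \<and> c < 1 * (u k x - v x)}" | "x \<in> {x\<in>W. c / 4 < D x \<and> c < (- 1) * (u k x - v x)}"
          using xT[unfolded Tdec] by blast
        then show ?thesis
        proof cases
          case 1
          show ?thesis by (rule grad_cong(2)[OF Topen 1, of _ _ c]) (use c in \<open>auto simp: w_def T_def\<close>)
        next
          case 2
          show ?thesis by (rule grad_cong(2)[OF Topen 2, of _ _ "- c"]) (use c in \<open>auto simp: w_def T_def\<close>)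
        qed
      qed
      then show "AE x in lebesgue. x \<in> T k \<longrightarrow> grad (w k) x = grad v x" by simp
    qed (use TK[of k] KW W(3) in auto)
    ultimately show "area (T k) v \<le> area (T k) (u k) + e k" using split[OF wseg] split[OF U(2)[of k]] by linarith
  qed
  have u0lim: "(\<lambda>k. u k x) \<longlonglongrightarrow> u0 x" if "x \<in> W" for x
    using tendsto_uniform_limitI[OF ul[of "{x}"], of x] that W(3) by auto
  \<comment> \<open>Each point of \<open>S\<close> eventually lies in \<open>T k\<close>, but not
    uniformly near the level \<open>c\<close>; dominated convergence suffices.\<close>
  have STlim: "(\<lambda>k. area (S \<inter> T k) v) \<longlonglongrightarrow> area S v"
    unfolding area_def set_lebesgue_integral_def
  proof (rule integral_dominated_convergence)
    have SW: "S \<subseteq> W" by (auto simp: S_def)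
    have i: "integrable lebesgue (\<lambda>x. indicator S x *\<^sub>R area_density v x)"
      using area_density_integrable[OF W(1) v Sl SW] by (simp add: set_integrable_def)
    then show "(\<lambda>x. indicator S x *\<^sub>R area_density v x) \<in> borel_measurable lebesgue" by auto
    have "set_integrable lebesgue (S \<inter> T k) (area_density v)" for k
      using Sl Tl SW by (intro area_density_integrable[OF W(1) v]) auto
    then show "(\<lambda>x. indicator (S \<inter> T k) x *\<^sub>R area_density v x) \<in> borel_measurable lebesgue" for k
      by (auto simp: set_integrable_def)
    show "integrable lebesgue (\<lambda>x. norm (indicator S x *\<^sub>R area_density v x))" using i by (rule integrable_norm)
    show "AE x in lebesgue. norm (indicator (S \<inter> T k) x *\<^sub>R area_density v x) \<le> norm (indicator S x *\<^sub>R area_density v x)" for k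
      by (auto simp: indicator_def)
    have "\<forall>\<^sub>F k in sequentially. (indicator (S \<inter> T k) x *\<^sub>R area_density v x) = indicator S x *\<^sub>R area_density v x" for x
    proof (cases "x \<in> S")
      case True
      then have x: "x \<in> W" "c < \<bar>u0 x - v x\<bar>" by (auto simp: S_def)
      have "(\<lambda>k. \<bar>u k x - v x\<bar>) \<longlonglongrightarrow> \<bar>u0 x - v x\<bar>" by (intro tendsto_intros u0lim x)
      then have "\<forall>\<^sub>F k in sequentially. c < \<bar>u k x - v x\<bar>" using x(2) by (rule order_tendstoD)
      then show ?thesis
      proof eventually_elim
        case (elim k)
        have "c / 4 < D x" using diff[OF x(1)] x(2) c by linarith
        then have "x \<in> T k" using elim x by (auto simp: T_def)
        then show ?case using True by simp
      qed
    qed simp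
    then show "AE x in lebesgue. (\<lambda>k. indicator (S \<inter> T k) x *\<^sub>R area_density v x) \<longlonglongrightarrow> indicator S x *\<^sub>R area_density v x"
      by (intro AE_I2 tendsto_eventually) auto
  qed
  have "area S v \<le> area S u0 + measure lebesgue L"
  proof (rule field_le_epsilon)
    fix r :: real assume r: "0 < r"
    have KU: "K \<subseteq> U" using KW W(3) by blast
    have "\<forall>\<^sub>F k in sequentially. \<forall>x\<in>K. dist (u k x) (u0 x) < c / 4"
      using uniform_limitD[OF ul[OF cK KU], of "c / 4"] c by simp
    moreover obtain B where B: "\<And>x. x \<in> W \<Longrightarrow> norm x \<le> B" using W(2) unfolding bounded_iff by blast
    have "\<forall>\<^sub>F k in sequentially. B < \<rho> k" using \<rho> by (simp add: filterlim_at_top_dense)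
    moreover have "\<forall>\<^sub>F k in sequentially. e k < r / 3" using e r by (intro order_tendstoD(2)) auto
    moreover have "\<forall>\<^sub>F k in sequentially. area S (u k) \<le> area S u0 + r / 3"
      unfolding area_def using area_upper_semicontinuous[OF U ul cK KU _ SK, of "r / 3"] Sl r by auto
    moreover have "\<forall>\<^sub>F k in sequentially. area S v - r / 3 < area (S \<inter> T k) v"
      using STlim r by (intro order_tendstoD(1)) auto
    ultimately have "\<forall>\<^sub>F k in sequentially. area S v \<le> area S u0 + measure lebesgue L + r"
    proof eventually_elim
      case (elim k)
      have near: "\<bar>u k x - u0 x\<bar> \<le> c / 4" if "x \<in> K" for x using elim(1) that by (auto simp: dist_real_def intro: less_imp_le)
      have ball: "W \<subseteq> ball 0 (\<rho> k)" using B elim(2) by (force simp: dist_norm)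
      have "area (S \<inter> T k) v \<le> area (T k) v"
        using Sl Tl by (intro area_mono[OF W(1) v]) (auto simp: T_def)
      also have "\<dots> \<le> area (T k) (u k) + e k" by (rule key[OF near ball])
      \<comment> \<open>Points of \<open>T k\<close> outside \<open>S\<close> lie in
        \<open>L\<close>, where the density is at most one. This is the source of the measure
        term.\<close>
      also have "area (T k) (u k) \<le> area S (u k) + measure lebesgue L"
        using Sl Tl Ll Tsub[OF near ball] W(3)
        by (intro area_le_add_measure[OF U(1) U(2)]) (auto simp: T_def S_def L_def)
      finally show ?case using elim(3,4,5) by linarith
    qed
    then show "area S v \<le> area S u0 + measure lebesgue L + r" by (simp add: eventually_const)
  qed
  then show ?thesis by (simp add: S_def L_def)
qed (simp add: area_def set_lebesgue_integral_def)

text \<open>Take \<open>c = 1 / Suc n\<close>. On \<open>Z\<close> the functions agree and so do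
  their areas; on \<open>S n\<close> the level comparison applies; \<open>L n\<close> enters once
  through that comparison and once through its own area, and its measure tends to 0 because the sets
  \<open>L n\<close> shrink to the empty set.\<close>

lemma limit_area_maximizing:
  fixes u :: "nat \<Rightarrow> 'a::euclidean_space \<Rightarrow> real"
  assumes U: "open U" "\<And>k. seg_lipschitz U (u k)" "seg_lipschitz U u0"
    and ul: "\<And>K. compact K \<Longrightarrow> K \<subseteq> U \<Longrightarrow> uniform_limit K u u0 sequentially"
    and e: "e \<longlonglongrightarrow> 0" and \<rho>: "filterlim \<rho> at_top sequentially"
    and almost: "\<And>k K w. compact K \<Longrightarrow> K \<subseteq> U \<inter> ball 0 (\<rho> k) \<Longrightarrow> seg_lipschitz U w \<Longrightarrow>
        (\<And>x. x \<in> U - K \<Longrightarrow> w x = u k x) \<Longrightarrow> area K w \<le> area K (u k) + e k"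
  shows "area_maximizing U u0"
  unfolding area_maximizing_def
proof (intro conjI allI impI)
  show "weakly_spacelike U u0" using weakly_spacelike_iff U by blast
  fix W v
  assume "open W \<and> connected W \<and> bounded W \<and> W \<subseteq> U"
    and "weakly_spacelike W v \<and> bdry_values W (\<lambda>x. v x - u0 x) (\<lambda>_. 0)"
  then have W: "open W" "bounded W" "W \<subseteq> U" and v: "seg_lipschitz W v"
    and bd: "bdry_values W (\<lambda>x. v x - u0 x) (\<lambda>_. 0)" using weakly_spacelike_iff by auto
  define S where "S n = {x\<in>W. 1 / real (Suc n) < \<bar>u0 x - v x\<bar>}" for n
  define L where "L n = {x\<in>W. 0 < \<bar>u0 x - v x\<bar> \<and> \<bar>u0 x - v x\<bar> \<le> 1 / real (Suc n)}" for n
  define Z where "Z = {x\<in>W. u0 x = v x}"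
  have u0W: "seg_lipschitz W u0" using U(3) W(3) by (rule seg_lipschitz_subset)
  have cont: "continuous_on W u0" "continuous_on W v"
    using seg_lipschitz_continuous_on[OF W(1)] u0W v by auto
  have lmeas: "X \<in> lmeasurable" if "X \<in> sets lebesgue" "X \<subseteq> W" for X
    using that W(2) bounded_subset bounded_set_imp_lmeasurable by blast
  define G where "G c = W \<inter> (\<lambda>x. \<bar>u0 x - v x\<bar>) -` {c<..}" for c
  have op: "open (G c)" for c unfolding G_def
    by (intro continuous_open_preimage W continuous_intros cont open_greaterThan)
  have "S n = G (1 / real (Suc n))" for n by (auto simp: S_def G_def)
  then have Sl: "S n \<in> lmeasurable" for n using op by (intro lmeas) (auto simp: S_def)
  have "L n = G 0 - G (1 / real (Suc n))" for n by (auto simp: L_def G_def)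
  then have Ll: "L n \<in> lmeasurable" for n using op by (intro lmeas) (auto simp: L_def)
  have "Z = W - G 0" by (auto simp: Z_def G_def)
  then have Zl: "Z \<in> lmeasurable" using op W(1) by (intro lmeas) auto
  have ZW: "Z \<subseteq> W" "S n \<subseteq> W" "L n \<subseteq> W" for n by (auto simp: Z_def S_def L_def)
  have dec: "area W f = area Z f + area (S n) f + area (L n) f" if "seg_lipschitz W f" for f n
  proof -
    have "area ((Z \<union> S n) \<union> L n) f = area (Z \<union> S n) f + area (L n) f"
      using Zl Sl Ll ZW that by (intro area_Un[OF W(1)]) (auto simp: Z_def S_def L_def)
    also have "area (Z \<union> S n) f = area Z f + area (S n) f"
      using Zl Sl Ll ZW that by (intro area_Un[OF W(1)]) (auto simp: Z_def S_def L_def)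
    also have "Z \<union> S n \<union> L n = W" by (auto simp: Z_def S_def L_def)
    finally show ?thesis .
  qed
  have Zeq: "area Z u0 = area Z v"
    using Zl ZW by (intro area_cong_eq[OF W(1) u0W W(1) v]) (auto simp: Z_def)
  have bound: "area W v \<le> area W u0 + 2 * measure lebesgue (L n)" for n
  proof -
    have "area (S n) v \<le> area (S n) u0 + measure lebesgue (L n)"
      unfolding S_def L_def
    proof (rule area_comparison_level[OF U ul e \<rho> _ W v bd])
      show "area K w \<le> area K (u k) + e k"
        if "compact K" "K \<subseteq> U \<inter> ball 0 (\<rho> k)" "seg_lipschitz U w" "\<And>x. x \<in> U - K \<Longrightarrow> w x = u k x" for k K w
        using that by (rule almost)
    qed auto
    moreover have "area (L n) v \<le> measure lebesgue (L n)" using Ll ZW by (intro area_le_measure[OF W(1) v])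
    moreover have "0 \<le> area (L n) u0" using ZW by (intro area_nonneg[OF W(1) u0W])
    ultimately show ?thesis using dec[OF v, of n] dec[OF u0W, of n] Zeq by linarith
  qed
  have "(\<lambda>n. LINT x|lebesgue. indicator (L n) x) \<longlonglongrightarrow> (LINT x|(lebesgue :: 'a measure). (0::real))"
  proof (rule integral_dominated_convergence)
    have "W \<in> lmeasurable" using W(1) by (intro lmeas) auto
    then show "integrable lebesgue (indicator W :: 'a \<Rightarrow> real)" by (auto simp: fmeasurable_def)
    show "(indicator (L n) :: 'a \<Rightarrow> real) \<in> borel_measurable lebesgue" for n using Ll by auto
    have "\<forall>\<^sub>F n in sequentially. indicator (L n) x = (0::real)" for x
    proof (cases "0 < \<bar>u0 x - v x\<bar>")
      case True
      have "(\<lambda>n. 1 / real (Suc n)) \<longlonglongrightarrow> 0" using LIMSEQ_inverse_real_of_nat by (simp add: divide_inverse)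
      then have "\<forall>\<^sub>F n in sequentially. 1 / real (Suc n) < \<bar>u0 x - v x\<bar>" using True by (rule order_tendstoD)
      then show ?thesis by eventually_elim (auto simp: L_def)
    qed (simp add: L_def)
    then show "AE x in lebesgue. (\<lambda>n. indicator (L n) x :: real) \<longlonglongrightarrow> 0"
      by (intro AE_I2 tendsto_eventually) auto
    show "AE x in lebesgue. norm (indicator (L n) x :: real) \<le> indicator W x" for n
      by (auto simp: indicator_def L_def)
  qed simp
  then have "(\<lambda>n. measure lebesgue (L n)) \<longlonglongrightarrow> 0" using Ll by (simp add: fmeasurable_def)
  then have "(\<lambda>n. area W u0 + 2 * measure lebesgue (L n)) \<longlonglongrightarrow> area W u0 + 2 * 0" by (intro tendsto_intros)
  then show "area W v \<le> area W u0" using LIMSEQ_le_const[of _ _ "area W v"] bound by auto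
qed

subsection \<open>Existence between barriers\<close>

text \<open>The segment bound already provides equicontinuity at interior points, so only local
  boundedness is assumed. The compact sets \<open>C i\<close> exhaust \<open>U\<close>, and a
  diagonal sequence serves all of them.\<close>

lemma seg_lipschitz_subsequence:
  fixes u :: "nat \<Rightarrow> 'a::euclidean_space \<Rightarrow> real"
  assumes U: "open U" and seg: "\<And>k. seg_lipschitz U (u k)"
    and bdd: "\<And>K. compact K \<Longrightarrow> K \<subseteq> U \<Longrightarrow> \<exists>M. \<forall>x\<in>K. \<forall>k. \<bar>u k x\<bar> \<le> M"
  obtains r u0 where "strict_mono (r :: nat \<Rightarrow> nat)" "seg_lipschitz U u0"
    "\<And>K. compact K \<Longrightarrow> K \<subseteq> U \<Longrightarrow> uniform_limit K (\<lambda>n. u (r n)) u0 sequentially"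
proof -
  obtain C :: "nat \<Rightarrow> 'a set" where C: "\<And>n. compact (C n)" "\<And>n. C n \<subseteq> U"
    and "\<And>n. C n \<subseteq> interior (C (Suc n))" "\<Union> (range C) = U"
    and CK: "\<And>K. \<lbrakk>compact K; K \<subseteq> U\<rbrakk> \<Longrightarrow> \<exists>N. \<forall>n\<ge>N. K \<subseteq> C n"
    by (rule open_Union_compact_subsets[OF U]) blast
  define P where "P i s \<longleftrightarrow> (\<exists>g. uniform_limit (C i) (\<lambda>n. u (s n)) g sequentially)" for i :: nat and s :: "nat \<Rightarrow> nat"
  have sub: "\<exists>k. strict_mono (k :: nat \<Rightarrow> nat) \<and> P i (r \<circ> k)" for i r
  proof -
    obtain M where M: "\<And>x k. x \<in> C i \<Longrightarrow> \<bar>u k x\<bar> \<le> M" using bdd[OF C(1) C(2)] by blast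
    have eq: "\<exists>d. 0 < d \<and> (\<forall>n y. y \<in> C i \<and> norm (x - y) < d \<longrightarrow> norm (u (r n) x - u (r n) y) < e)"
      if x: "x \<in> C i" and e: "0 < e" for x e
    proof -
      obtain d where d: "d > 0" "ball x d \<subseteq> U" using U C(2) x openE by blast
      have "norm (u (r n) x - u (r n) y) < e" if "norm (x - y) < min d e" for n y
      proof -
        have "closed_segment x y \<subseteq> ball x d" using that d(1) by (intro closed_segment_subset) (auto simp: dist_norm)
        then have "\<bar>u (r n) x - u (r n) y\<bar> \<le> norm (x - y)" using seg_lipschitzD[OF seg] d(2) by blast
        then show ?thesis using that by simp
      qed
      then show ?thesis using d(1) e by (intro exI[of _ "min d e"]) auto
    qed
    obtain g k where g: "strict_mono (k :: nat \<Rightarrow> nat)"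
      "\<And>e. 0 < e \<Longrightarrow> \<exists>N. \<forall>n x. n \<ge> N \<and> x \<in> C i \<longrightarrow> norm (u (r (k n)) x - g x) < e"
      using Arzela_Ascoli[OF C(1)[of i], of "\<lambda>n. u (r n)" M] M eq by (metis real_norm_def)
    have "uniform_limit (C i) (\<lambda>n. u ((r \<circ> k) n)) g sequentially"
      unfolding uniform_limit_sequentially_iff dist_norm o_def using g(2) by blast
    then show ?thesis using g(1) unfolding P_def by blast
  qed
  have PP: "P i (r \<circ> k2)"
    if P1: "P i (r \<circ> k1)" and k12: "\<And>j. N \<le> j \<Longrightarrow> \<exists>j'. j \<le> j' \<and> k2 j = k1 j'" for i r k1 k2 N
  proof -
    obtain g where g: "uniform_limit (C i) (\<lambda>n. u (r (k1 n))) g sequentially" using P1 by (auto simp: P_def)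
    have "uniform_limit (C i) (\<lambda>n. u (r (k2 n))) g sequentially"
      unfolding uniform_limit_sequentially_iff
    proof (intro allI impI)
      fix e :: real assume "0 < e"
      then obtain M where M: "\<And>n x. n \<ge> M \<Longrightarrow> x \<in> C i \<Longrightarrow> dist (u (r (k1 n)) x) (g x) < e"
        using g unfolding uniform_limit_sequentially_iff by blast
      have "dist (u (r (k2 n)) x) (g x) < e" if n: "n \<ge> max M N" "x \<in> C i" for n x
      proof -
        obtain j' where "n \<le> j'" "k2 n = k1 j'" using k12[of n] n by auto
        then show ?thesis using M[of j' x] n by auto
      qed
      then show "\<exists>M. \<forall>n\<ge>M. \<forall>x\<in>C i. dist (u (r (k2 n)) x) (g x) < e" by blast
    qed
    then show ?thesis by (auto simp: P_def)
  qed
  obtain r where r: "strict_mono (r :: nat \<Rightarrow> nat)" "\<And>i. P i (id \<circ> r)"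
  proof (rule subsequence_diagonalization_lemma[of P id])
    show "\<exists>k. strict_mono (k :: nat \<Rightarrow> nat) \<and> P i (r \<circ> k)" for i r by (rule sub)
    show "P i (r \<circ> k2)"
      if "P i (r \<circ> k1)" "\<And>j. N \<le> j \<Longrightarrow> \<exists>j'. j \<le> j' \<and> k2 j = k1 j'" for i r k1 k2 N
      using that by (rule PP)
  qed blast
  obtain g where g: "\<And>i. uniform_limit (C i) (\<lambda>n. u (r n)) (g i) sequentially"
    using r(2) unfolding P_def by (metis id_comp)
  \<comment> \<open>A pointwise limit glues the limits \<open>g i\<close> into one function,
    independent of \<open>i\<close>.\<close>
  define u0 where "u0 x = lim (\<lambda>n. u (r n) x)" for x
  have gu0: "g i x = u0 x" if "x \<in> C i" for i x
    unfolding u0_def using tendsto_uniform_limitI[OF g that] by (simp add: limI)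
  have ul: "uniform_limit K (\<lambda>n. u (r n)) u0 sequentially" if K: "compact K" "K \<subseteq> U" for K
  proof -
    obtain N where "K \<subseteq> C N" using CK[OF K] by blast
    then have "uniform_limit K (\<lambda>n. u (r n)) (g N) sequentially" using g uniform_limit_on_subset by blast
    moreover have "\<And>x. x \<in> K \<Longrightarrow> g N x = u0 x" using gu0 \<open>K \<subseteq> C N\<close> by blast
    ultimately show ?thesis using uniform_limit_cong' by (metis (no_types, lifting))
  qed
  have "seg_lipschitz U u0"
    unfolding seg_lipschitz_def
  proof (intro allI impI)
    fix x y assume xy: "closed_segment x y \<subseteq> U"
    have lim: "(\<lambda>n. u (r n) z) \<longlonglongrightarrow> u0 z" if "z \<in> U" for z
      using tendsto_uniform_limitI[OF ul[of "{z}"], of z] that by auto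
    have "x \<in> U" "y \<in> U" using xy by auto
    then have "(\<lambda>n. \<bar>u (r n) x - u (r n) y\<bar>) \<longlonglongrightarrow> \<bar>u0 x - u0 y\<bar>" by (intro tendsto_intros lim)
    then show "\<bar>u0 x - u0 y\<bar> \<le> norm (x - y)"
      by (rule LIMSEQ_le_const2) (use seg_lipschitzD[OF seg xy] in auto)
  qed
  then show ?thesis using that r(1) ul by blast
qed

text \<open>The segment bound extends to the boundary endpoint. The resulting modulus is the same
  for every such \<open>w\<close>, which is why boundary values survive the passage to the
  limit.\<close>

lemma bdry_values_bound:
  assumes w: "seg_lipschitz U w" "bdry_values U w g" "y \<in> frontier U"
    and x: "x \<noteq> y" "x \<in> U" "open_segment y x \<subseteq> U"
  shows "\<bar>w x - g y\<bar> \<le> norm (x - y)"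
proof -
  have "(w \<longlongrightarrow> g y) (at y within open_segment y x)" using assms by (auto simp: bdry_values_def)
  moreover have "\<bar>w x - w p\<bar> \<le> 1 * norm (x - p)" if p: "p \<in> open_segment y x" for p
  proof -
    have "closed_segment x p \<subseteq> closed_segment y x"
      using p by (simp add: subset_closed_segment open_segment_def)
    moreover have "y \<notin> closed_segment x p"
      using dist_in_closed_segment[of y x p] dist_in_open_segment[OF p] by (auto simp: dist_commute)
    ultimately have "closed_segment x p \<subseteq> U" using x(2,3) by (auto simp: open_segment_def)
    then show ?thesis using seg_lipschitzD[OF w(1)] by simp
  qed
  ultimately show ?thesis using segment_limit_bound[of y x w "g y" x 1] x(1) by simp
qed

lemma first_hit:
  fixes x y :: "'a::euclidean_space"
  assumes "closed T" "x \<notin> T" "y \<in> T"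
  obtains z where "z \<in> closed_segment x y" "z \<in> T" "closed_segment x z - {z} \<subseteq> - T"
proof -
  have "compact (T \<inter> closed_segment x y)" using assms(1) by (intro closed_Int_compact) auto
  moreover have "T \<inter> closed_segment x y \<noteq> {}" using assms(3) by auto
  ultimately obtain z where z: "z \<in> T \<inter> closed_segment x y"
    "\<And>p. p \<in> T \<inter> closed_segment x y \<Longrightarrow> dist x z \<le> dist x p"
    using distance_attains_inf[of "T \<inter> closed_segment x y" x] compact_imp_closed by blast
  have "p \<notin> T" if p: "p \<in> closed_segment x z" "p \<noteq> z" for p
  proof
    assume "p \<in> T"
    moreover have "p \<in> closed_segment x y" using p(1) z(1) subset_closed_segment[of x z x y] by auto
    ultimately have "dist x z \<le> dist x p" using z(2) by blast
    moreover have "dist x z = dist x p + dist p z"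
      using p(1) by (simp add: between_mem_segment[symmetric] between)
    ultimately show False using p(2) by simp
  qed
  then show ?thesis using z(1) by (intro that[of z]) auto
qed

text \<open>Go from \<open>x\<close> towards \<open>y\<close> up to the first point \<open>z\<close>
  that lies in \<open>A\<close> or has norm at least \<open>R\<close>. Since \<open>p\<close> is
  1-Lipschitz and gains its maximal amount over the whole segment, it also gains exactly
  \<open>norm (z - x)\<close> up to \<open>z\<close>, whereas \<open>w\<close> can change by at most
  that much. So the bound at \<open>z\<close> carries back to \<open>x\<close>.\<close>

lemma barrier_hit_bounds:
  fixes p :: "'a::euclidean_space \<Rightarrow> real"
  assumes A: "closed A" and p1: "\<And>x y. \<bar>p x - p y\<bar> \<le> norm (x - y)"
    and w: "seg_lipschitz (- A) w" "bdry_values (- A) w g"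
    and g: "\<And>y. y \<in> frontier A \<Longrightarrow> p y + m \<le> g y \<and> g y \<le> p y + M"
    and far: "\<And>x. x \<notin> A \<Longrightarrow> R \<le> norm x \<Longrightarrow> p x + m \<le> w x \<and> w x \<le> p x + M"
    and x: "x \<notin> A" and y: "y \<in> A \<or> R \<le> norm y"
  shows "p y - p x = norm (y - x) \<Longrightarrow> p x + m \<le> w x"
    and "p x - p y = norm (y - x) \<Longrightarrow> w x \<le> p x + M"
proof -
  define T where "T = A \<union> {y. R \<le> norm y}"
  have T: "closed T" unfolding T_def using A by (intro closed_Un closed_Collect_le continuous_intros)
  have yT: "y \<in> T" using y by (auto simp: T_def)
  \<comment> \<open>\<open>W\<close> is the value attached to the stopping point: \<open>w x\<close>
    if the walk does not start, \<open>g z\<close> on the boundary of \<open>A\<close>, and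
    \<open>w z\<close> far away.\<close>
  have "\<exists>z W. z \<in> closed_segment x y \<and> \<bar>w x - W\<bar> \<le> norm (z - x) \<and> p z + m \<le> W \<and> W \<le> p z + M"
  proof (cases "x \<in> T")
    case True
    then have "R \<le> norm x" using x by (auto simp: T_def)
    then show ?thesis using far[OF x] by (intro exI[of _ x] exI[of _ "w x"]) auto
  next
    case False
    obtain z where z: "z \<in> closed_segment x y" "z \<in> T" "closed_segment x z - {z} \<subseteq> - T"
      using first_hit[OF T False yT] by blast
    have sub: "closed_segment x z - {z} \<subseteq> - A" using z(3) by (auto simp: T_def)
    have zx: "z \<noteq> x" using False z(2) by auto
    show ?thesis
    proof (cases "z \<in> A")
      case True
      have seg: "open_segment z x \<subseteq> - A" using sub by (auto simp: open_segment_def closed_segment_commute)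
      have "z \<in> closure (- A)" using closure_mono[OF seg] zx by auto
      then have "z \<in> frontier (- A)" using True by (simp add: frontier_def interior_closure)
        (metis closure_subset subsetD)?
      then have "\<bar>w x - g z\<bar> \<le> norm (x - z)" using seg zx x by (intro bdry_values_bound[OF w]) auto
      moreover have "z \<in> frontier A" using \<open>z \<in> frontier (- A)\<close> by simp
      ultimately show ?thesis using z(1) g by (metis norm_minus_commute)
    next
      case False
      then have R: "R \<le> norm z" using z(2) by (auto simp: T_def)
      have "closed_segment x z \<subseteq> - A" using sub False by auto
      then have "\<bar>w x - w z\<bar> \<le> norm (z - x)" using seg_lipschitzD[OF w(1)] by (metis norm_minus_commute)
      then show ?thesis using z(1) far[OF False R] by blast
    qed
  qed
  then obtain z W where z: "z \<in> closed_segment x y" "\<bar>w x - W\<bar> \<le> norm (z - x)" "p z + m \<le> W" "W \<le> p z + M" by blast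
  have "dist x y = dist x z + dist z y" using z(1) by (simp add: between_mem_segment[symmetric] between)
  then have d: "norm (y - x) = norm (z - x) + norm (y - z)" by (simp add: dist_norm norm_minus_commute)
  show "p x + m \<le> w x" if "p y - p x = norm (y - x)"
    using that d p1[of y z] p1[of z x] z(2,3) by (simp add: abs_le_iff)
  show "w x \<le> p x + M" if "p x - p y = norm (y - x)"
    using that d p1[of y z] p1[of z x] z(2,4) by (simp add: abs_le_iff)
qed

text \<open>The last two assumptions say that from every point outside \<open>A\<close> a segment along which \<open>p\<close> increases
  (decreases) with slope one leads to \<open>A\<close> or arbitrarily far away. The \<open>k\<close>-th approximation is prescribed to
  be \<open>\<phi>\<close> outside the ball of radius \<open>k\<close>; along such segments the bounds on \<open>\<phi>\<close> and \<open>g\<close> carry over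
  to it.\<close>

theorem area_maximizing_between_barriers:
  fixes A :: "'a::euclidean_space set" and p :: "'a \<Rightarrow> real"
  assumes A: "A \<noteq> {}" "bounded A" "closed A" and adm: "admissible A g"
    and p1: "\<And>x y. \<bar>p x - p y\<bar> \<le> norm (x - y)"
    and fwd: "\<And>x R. x \<notin> A \<Longrightarrow> \<exists>y. (y \<in> A \<or> R \<le> norm y) \<and> p y - p x = norm (y - x)"
    and bwd: "\<And>x R. x \<notin> A \<Longrightarrow> \<exists>y. (y \<in> A \<or> R \<le> norm y) \<and> p x - p y = norm (y - x)"
  shows "\<exists>u. area_maximizing (- A) u \<and> bdry_values (- A) u g \<and>
            extrema_on (\<lambda>x. override_on u g (frontier A) x - p x) (- A \<union> frontier A) (frontier A)"
proof -
  define U where "U = - A"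
  have U: "open U" using A(3) by (simp add: U_def open_Compl)
  have frU: "frontier U = frontier A" by (simp add: U_def)
  have frA: "frontier A \<subseteq> A" using A(3) by (rule frontier_subset_closed)
  have frne: "frontier A \<noteq> {}" using A frontier_eq_empty not_bounded_UNIV by metis
  obtain \<psi> where gb: "bounded (g ` frontier A)" and \<psi>: "seg_lipschitz U \<psi>" "bdry_values U \<psi> g"
    using adm weakly_spacelike_iff[OF U] unfolding admissible_def U_def by blast
  define F where "F = (\<lambda>y. g y - p y) ` frontier A"
  have Fb: "bounded F"
  proof -
    obtain B1 where B1: "\<And>y. y \<in> frontier A \<Longrightarrow> \<bar>g y\<bar> \<le> B1" using gb unfolding bounded_iff by auto
    obtain B2 where B2: "\<And>y. y \<in> A \<Longrightarrow> norm y \<le> B2" using A(2) unfolding bounded_iff by auto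
    have "\<bar>g y - p y\<bar> \<le> B1 + (\<bar>p 0\<bar> + B2)" if "y \<in> frontier A" for y
      using B1[OF that] B2[of y] p1[of y 0] frA that by (auto simp: abs_le_iff)
    then show ?thesis unfolding F_def bounded_iff by auto
  qed
  \<comment> \<open>The best constants with \<open>p + m \<le> g \<le> p + M\<close> on the
    boundary. Their optimality turns the bounds on \<open>u0 - p\<close> into equalities of suprema
    and infima.\<close>
  define m where "m = Inf F"
  define M where "M = Sup F"
  have g: "p y + m \<le> g y \<and> g y \<le> p y + M" if "y \<in> frontier A" for y
  proof -
    have "g y - p y \<in> F" using that by (auto simp: F_def)
    then have "m \<le> g y - p y" "g y - p y \<le> M" unfolding m_def M_def
      using Fb by (auto intro!: cInf_lower cSup_upper bounded_imp_bdd_below bounded_imp_bdd_above)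
    then show ?thesis by linarith
  qed
  define \<phi> where "\<phi> x = max (p x + m) (min (p x + M) (\<psi> x))" for x
  have mM: "m \<le> M" using frne g by fastforce
  have \<phi>b: "p x + m \<le> \<phi> x" "\<phi> x \<le> p x + M" for x using mM by (auto simp: \<phi>_def)
  have \<phi>seg: "seg_lipschitz U \<phi>"
    unfolding seg_lipschitz_def
  proof (intro allI impI)
    fix x y assume "closed_segment x y \<subseteq> U"
    then have "\<bar>\<psi> x - \<psi> y\<bar> \<le> norm (x - y)" using seg_lipschitzD[OF \<psi>(1)] by blast
    then show "\<bar>\<phi> x - \<phi> y\<bar> \<le> norm (x - y)" using p1[of x y] unfolding \<phi>_def by (smt (verit))
  qed
  have pc: "isCont p y" for y
  proof -
    have "1-lipschitz_on UNIV p" using p1 by (intro lipschitz_onI) (auto simp: dist_norm)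
    then show ?thesis using lipschitz_on_continuous_on continuous_on_eq_continuous_at open_UNIV by blast
  qed
  have \<phi>bd: "bdry_values U \<phi> g"
    unfolding bdry_values_def
  proof (intro ballI allI impI)
    fix y z assume y: "y \<in> frontier U" and z: "z \<noteq> y \<and> open_segment y z \<subseteq> U"
    have "(\<psi> \<longlongrightarrow> g y) (at y within open_segment y z)" using \<psi>(2) y z by (auto simp: bdry_values_def)
    moreover have "(p \<longlongrightarrow> p y) (at y within open_segment y z)"
      using pc[of y] tendsto_within_subset unfolding isCont_def by blast
    ultimately have "(\<phi> \<longlongrightarrow> max (p y + m) (min (p y + M) (g y))) (at y within open_segment y z)"
      unfolding \<phi>_def by (intro tendsto_intros)
    moreover have "max (p y + m) (min (p y + M) (g y)) = g y" using g[of y] y frU by auto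
    ultimately show "(\<phi> \<longlongrightarrow> g y) (at y within open_segment y z)" by simp
  qed
  \<comment> \<open>The barrier bounds are not imposed but derived in \<open>\<K>b\<close>. Thus a
    compact perturbation of \<open>u k\<close> inside the ball remains in the class even before
    anything is known about its size.\<close>
  define \<K> where "\<K> k = {w. seg_lipschitz U w \<and> bdry_values U w g \<and> (\<forall>x\<in>U. real k \<le> norm x \<longrightarrow> w x = \<phi> x)}" for k
  have \<K>b: "p x + m \<le> w x" "w x \<le> p x + M" if w: "w \<in> \<K> k" and x: "x \<in> U" for w k x
  proof -
    have x': "x \<notin> A" using x by (simp add: U_def)
    have ws: "seg_lipschitz (- A) w" "bdry_values (- A) w g" using w by (auto simp: \<K>_def U_def)
    have far: "p z + m \<le> w z \<and> w z \<le> p z + M" if "z \<notin> A" "real k \<le> norm z" for z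
      using w that \<phi>b by (auto simp: \<K>_def U_def)
    note hit = barrier_hit_bounds[OF A(3) p1 ws g far x']
    show "p x + m \<le> w x" using fwd[OF x', of "real k"] hit(1) by blast
    show "w x \<le> p x + M" using bwd[OF x', of "real k"] hit(2) by blast
  qed
  define B where "B k = ball 0 (real k) \<inter> U" for k
  have Bl: "B k \<in> lmeasurable" for k
    unfolding B_def using U by (intro bounded_set_imp_lmeasurable) (auto intro: bounded_subset[OF bounded_ball])
  have BU: "B k \<subseteq> U" for k by (simp add: B_def)
  \<comment> \<open>The class contains \<open>\<phi>\<close>, and the areas are bounded by the
    measure of \<open>B k\<close>, so the supremum is finite and some member comes within
    \<open>1 / Suc k\<close> of it.\<close>
  have "\<exists>w\<in>\<K> k. \<forall>w'\<in>\<K> k. area (B k) w' \<le> area (B k) w + 1 / Suc k" for k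
  proof -
    define X where "X = area (B k) ` \<K> k"
    have "\<phi> \<in> \<K> k" using \<phi>seg \<phi>bd by (auto simp: \<K>_def)
    then have ne: "X \<noteq> {}" by (auto simp: X_def)
    have "area (B k) w \<le> measure lebesgue (B k)" if "w \<in> \<K> k" for w
      using that by (intro area_le_measure[OF U _ Bl BU]) (auto simp: \<K>_def)
    then have bdd: "bdd_above X" unfolding X_def by (intro bdd_aboveI2) auto
    have "Sup X - 1 / Suc k < Sup X" by simp
    then obtain a where "a \<in> X" "Sup X - 1 / Suc k < a" using less_cSup_iff[OF ne bdd] by blast
    then obtain w where w: "w \<in> \<K> k" "Sup X - 1 / Suc k < area (B k) w" by (auto simp: X_def)
    have "area (B k) w' \<le> Sup X" if "w' \<in> \<K> k" for w'
      using that by (intro cSup_upper bdd) (auto simp: X_def)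
    then show ?thesis using w by (intro bexI[of _ w]) force+
  qed
  then obtain u where u: "\<And>k. u k \<in> \<K> k" "\<And>k w. w \<in> \<K> k \<Longrightarrow> area (B k) w \<le> area (B k) (u k) + 1 / Suc k" by metis
  have useg: "seg_lipschitz U (u k)" and ubd: "bdry_values U (u k) g" for k using u(1)[of k] by (auto simp: \<K>_def)
  have bddK: "\<exists>c. \<forall>x\<in>K. \<forall>k. \<bar>u k x\<bar> \<le> c" if K: "compact K" "K \<subseteq> U" for K
  proof -
    obtain b where b: "\<And>x. x \<in> K \<Longrightarrow> norm x \<le> b" using K(1) compact_imp_bounded bounded_iff by metis
    have "\<bar>u k x\<bar> \<le> \<bar>p 0\<bar> + b + \<bar>m\<bar> + \<bar>M\<bar>" if x: "x \<in> K" for k x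
      using \<K>b[OF u(1), of x k] K(2) x b[OF x] p1[of x 0] by (auto simp: abs_le_iff subset_iff)
    then show ?thesis by blast
  qed
  obtain r u0 where r: "strict_mono (r :: nat \<Rightarrow> nat)" and u0: "seg_lipschitz U u0"
    and ul: "\<And>K. compact K \<Longrightarrow> K \<subseteq> U \<Longrightarrow> uniform_limit K (\<lambda>n. u (r n)) u0 sequentially"
    by (rule seg_lipschitz_subsequence[OF U useg bddK]) blast+
  have lim: "(\<lambda>n. u (r n) x) \<longlonglongrightarrow> u0 x" if "x \<in> U" for x
    using tendsto_uniform_limitI[OF ul[of "{x}"], of x] that by auto
  have "area_maximizing U u0"
  proof (rule limit_area_maximizing[OF U useg u0 ul, where e = "\<lambda>n. 1 / Suc (r n)" and \<rho> = "\<lambda>n. real (r n)"])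
    show "(\<lambda>n. 1 / real (Suc (r n))) \<longlonglongrightarrow> 0"
      using LIMSEQ_subseq_LIMSEQ[OF LIMSEQ_inverse_real_of_nat r] by (simp add: o_def divide_inverse)
    show "filterlim (\<lambda>n. real (r n)) at_top sequentially"
      using filterlim_compose[OF filterlim_real_sequentially filterlim_subseq[OF r]] .
    fix n K w
    assume K: "compact K" "K \<subseteq> U \<inter> ball 0 (real (r n))" and w: "seg_lipschitz U w"
      and eq: "\<And>x. x \<in> U - K \<Longrightarrow> w x = u (r n) x"
    define k where "k = r n"
    have clK: "closed K" using K(1) by (rule compact_imp_closed)
    \<comment> \<open>A boundary point lies in \<open>A\<close> and hence has a neighbourhood that
      misses the compact set \<open>K\<close>, where \<open>w\<close> still equals
      \<open>u k\<close>.\<close>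
    have "bdry_values U w g"
      unfolding bdry_values_def
    proof (intro ballI allI impI)
      fix y z assume y: "y \<in> frontier U" and z: "z \<noteq> y \<and> open_segment y z \<subseteq> U"
      have "(u k \<longlongrightarrow> g y) (at y within open_segment y z)" using ubd y z by (auto simp: bdry_values_def)
      moreover have "\<forall>\<^sub>F x in at y within open_segment y z. u k x = w x"
      proof -
        have "y \<in> - K" using y frU frA K(2) by (auto simp: U_def)
        then have "\<forall>\<^sub>F x in nhds y. x \<in> - K" using clK by (intro eventually_nhds_in_open) auto
        then have "\<forall>\<^sub>F x in at y within open_segment y z. x \<in> - K \<and> x \<in> open_segment y z"
          by (auto simp: eventually_at_filter elim: eventually_mono)
        then show ?thesis by eventually_elim (use eq z in \<open>auto simp: k_def\<close>)
      qed
      ultimately show "(w \<longlongrightarrow> g y) (at y within open_segment y z)" by (rule Lim_transform_eventually)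
    qed
    moreover have "w x = \<phi> x" if "x \<in> U" "real k \<le> norm x" for x
    proof -
      have "x \<notin> K" using K(2) that by (auto simp: k_def)
      then show ?thesis using eq[of x] that u(1)[of k] by (auto simp: \<K>_def k_def)
    qed
    ultimately have "w \<in> \<K> k" using w by (auto simp: \<K>_def)
    then have "area (B k) w \<le> area (B k) (u k) + 1 / Suc k" by (rule u(2))
    moreover have KB: "K \<subseteq> B k" using K(2) by (auto simp: B_def k_def)
    have Kl: "K \<in> lmeasurable" using K(1) by (rule lmeasurable_compact)
    have split: "area (B k) f = area K f + area (B k - K) f" if "seg_lipschitz U f" for f
    proof -
      have "area (K \<union> (B k - K)) f = area K f + area (B k - K) f"
        using Kl Bl BU KB that by (intro area_Un[OF U]) auto
      then show ?thesis using KB by (simp add: Un_absorb1)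
    qed
    moreover have "area (B k - K) w = area (B k - K) (u k)"
      using Kl Bl BU[of k] eq by (intro area_cong_eq[OF U w U useg]) (auto simp: k_def)
    ultimately show "area K w \<le> area K (u (r n)) + 1 / real (Suc (r n))"
      using split[OF w] split[OF useg[of k]] by (simp add: k_def)
  qed
  moreover have "bdry_values U u0 g"
    unfolding bdry_values_def
  proof (intro ballI allI impI)
    fix y z assume y: "y \<in> frontier U" and z: "z \<noteq> y \<and> open_segment y z \<subseteq> U"
    \<comment> \<open>The bound does not depend on \<open>n\<close>, so it holds for
      \<open>u0\<close> and squeezes it to \<open>g y\<close>.\<close>
    have b: "\<bar>u0 x - g y\<bar> \<le> norm (x - y)" if x: "x \<in> open_segment y z" for x
    proof -
      have xU: "x \<in> U" using x z by blast
      have seg: "open_segment y x \<subseteq> U"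
        using x z by (meson order_trans subset_co_segment subset_oc_segment ends_in_segment(1) segment_open_subset_closed subset_open_segment subsetD)
      have "x \<noteq> y" using x by (auto simp: open_segment_def)
      then have "\<bar>u (r n) x - g y\<bar> \<le> norm (x - y)" for n
        using bdry_values_bound[OF useg ubd y _ xU seg] by blast
      moreover have "(\<lambda>n. \<bar>u (r n) x - g y\<bar>) \<longlonglongrightarrow> \<bar>u0 x - g y\<bar>" by (intro tendsto_intros lim xU)
      ultimately show ?thesis by (intro LIMSEQ_le_const2) auto
    qed
    show "(u0 \<longlongrightarrow> g y) (at y within open_segment y z)"
    proof (rule Lim_null_comparison[THEN LIM_zero_cancel])
      show "\<forall>\<^sub>F x in at y within open_segment y z. norm (u0 x - g y) \<le> norm (x - y)"
        using b by (auto simp: eventually_at_filter)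
      show "((\<lambda>x. norm (x - y)) \<longlongrightarrow> 0) (at y within open_segment y z)"
        by (auto intro!: tendsto_eq_intros)
    qed
  qed
  moreover have "extrema_on (\<lambda>x. override_on u0 g (frontier A) x - p x) (U \<union> frontier A) (frontier A)"
  proof -
    define f where "f x = override_on u0 g (frontier A) x - p x" for x
    have u0b: "p x + m \<le> u0 x" "u0 x \<le> p x + M" if "x \<in> U" for x
      using LIMSEQ_le_const[OF lim[OF that], of "p x + m"] LIMSEQ_le_const2[OF lim[OF that], of "p x + M"]
        \<K>b[OF u(1) that] by auto
    have fT: "f ` frontier A = F" by (auto simp: f_def F_def)
    have fb: "m \<le> f x" "f x \<le> M" if "x \<in> U \<union> frontier A" for x
      using that g[of x] u0b[of x] by (cases "x \<in> frontier A"; force simp: f_def)+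
    have fbd: "bounded (f ` (U \<union> frontier A))"
      unfolding bounded_iff using fb by (intro exI[of _ "\<bar>m\<bar> + \<bar>M\<bar>"]) (force simp: abs_le_iff)
    have ne: "f ` (U \<union> frontier A) \<noteq> {}" using frne by auto
    have "(SUP x\<in>U \<union> frontier A. f x) = M"
    proof (rule antisym)
      show "(SUP x\<in>U \<union> frontier A. f x) \<le> M" using ne fb by (intro cSUP_least) auto
      show "M \<le> (SUP x\<in>U \<union> frontier A. f x)" unfolding M_def fT[symmetric]
        using frne fbd by (intro cSup_subset_mono bounded_imp_bdd_above) auto
    qed
    moreover have "(INF x\<in>U \<union> frontier A. f x) = m"
    proof (rule antisym)
      show "m \<le> (INF x\<in>U \<union> frontier A. f x)" using ne fb by (intro cINF_greatest) auto
      show "(INF x\<in>U \<union> frontier A. f x) \<le> m" unfolding m_def fT[symmetric]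
        using frne fbd by (intro cInf_superset_mono bounded_imp_bdd_below) auto
    qed
    moreover have "attains_max_on f (U \<union> frontier A) (frontier A)" if mx: "attains_max_on f (frontier A) (frontier A)"
    proof -
      obtain y where y: "y \<in> frontier A" "\<And>x. x \<in> frontier A \<Longrightarrow> f x \<le> f y" using mx by (auto simp: attains_max_on_def)
      have "M \<le> f y" unfolding M_def fT[symmetric] using y frne by (intro cSup_least) auto
      then show ?thesis using fb(2) y(1) order_trans unfolding attains_max_on_def by blast
    qed
    moreover have "attains_min_on f (U \<union> frontier A) (frontier A)" if mn: "attains_min_on f (frontier A) (frontier A)"
    proof -
      obtain y where y: "y \<in> frontier A" "\<And>x. x \<in> frontier A \<Longrightarrow> f y \<le> f x" using mn by (auto simp: attains_min_on_def)
      have "f y \<le> m" unfolding m_def fT[symmetric] using y frne by (intro cInf_greatest) auto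
      then show ?thesis using fb(1) y(1) order_trans unfolding attains_min_on_def by blast
    qed
    ultimately show ?thesis
      unfolding extrema_on_def f_def[symmetric] fT using fbd by (simp add: m_def M_def)
  qed
  ultimately show ?thesis unfolding U_def by blast
qed

section \<open>Directions of unit slope for the cones and the linear functions\<close>

lemma ray_from_point:
  fixes x x0 :: "'a::euclidean_space"
  obtains y where "R \<le> norm y" "norm (y - x0) - norm (x - x0) = norm (y - x)"
proof -
  obtain b :: 'a where b: "norm b = 1" using norm_Basis nonempty_Basis by blast
  \<comment> \<open>The direction away from \<open>x0\<close>; at the apex itself every direction
    has unit slope.\<close>
  define e where "e = (if x = x0 then b else (1 / norm (x - x0)) *\<^sub>R (x - x0))"
  have e: "norm e = 1" "x - x0 = norm (x - x0) *\<^sub>R e" using b by (auto simp: e_def)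
  define t where "t = \<bar>R\<bar> + norm x"
  have t: "0 \<le> t" by (simp add: t_def)
  define y where "y = x + t *\<^sub>R e"
  have "norm (y - x) = t" using e t by (simp add: y_def)
  moreover have "y - x0 = (norm (x - x0) + t) *\<^sub>R e" using e(2) by (simp add: y_def algebra_simps)
  then have "norm (y - x0) = norm (x - x0) + t" using e(1) t by simp
  moreover have "R \<le> norm y" using norm_triangle_ineq4[of y x] \<open>norm (y - x) = t\<close> by (simp add: t_def)
  ultimately show ?thesis using that by simp
qed

theorem theorem1p3:
  fixes A :: "(real ^ 'n) set" and g :: "real ^ 'n \<Rightarrow> real"
  assumes "A \<noteq> {}" and "bounded A" and "closed A"
    and "admissible A g"
  shows "(\<forall>x\<^sub>0\<in>A. \<exists>u. area_maximizing (- A) u \<and> bdry_values (- A) u g \<and>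
            extrema_on (\<lambda>x. override_on u g (frontier A) x - norm (x - x\<^sub>0))
              (- A \<union> frontier A) (frontier A)) \<and>
         (\<forall>x\<^sub>0\<in>A. \<exists>u. area_maximizing (- A) u \<and> bdry_values (- A) u g \<and>
            extrema_on (\<lambda>x. override_on u g (frontier A) x + norm (x - x\<^sub>0))
              (- A \<union> frontier A) (frontier A)) \<and>
         (\<forall>a. norm a = 1 \<longrightarrow> (\<exists>u. area_maximizing (- A) u \<and> bdry_values (- A) u g \<and>
            extrema_on (\<lambda>x. override_on u g (frontier A) x - a \<bullet> x)
              (- A \<union> frontier A) (frontier A)))"
proof -
  let ?Q = "\<lambda>p. \<exists>u. area_maximizing (- A) u \<and> bdry_values (- A) u g \<and>
     extrema_on (\<lambda>x. override_on u g (frontier A) x - p x) (- A \<union> frontier A) (frontier A)"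
  note main = area_maximizing_between_barriers[OF assms]
  have tri: "\<bar>norm (x - z) - norm (y - z)\<bar> \<le> norm (x - y)" for x y z :: "real ^ 'n"
    using norm_triangle_ineq3[of "x - z" "y - z"] by simp
  have ray: "\<exists>y. R \<le> norm y \<and> norm (y - z) - norm (x - z) = norm (y - x)" for x z :: "real ^ 'n" and R
    using ray_from_point by metis
  show ?thesis
  proof (intro conjI ballI allI impI)
    fix x\<^sub>0 assume x\<^sub>0: "x\<^sub>0 \<in> A"
    \<comment> \<open>The apex lies in \<open>A\<close>, so the segment towards it is the direction
      of descent of the cone; the direction of ascent is the ray to infinity.\<close>
    have apex: "(x\<^sub>0 \<in> A \<or> R \<le> norm x\<^sub>0) \<and> norm (x - x\<^sub>0) - norm (x\<^sub>0 - x\<^sub>0) = norm (x\<^sub>0 - x)" for x R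
      using x\<^sub>0 by (simp add: norm_minus_commute)
    show "?Q (\<lambda>x. norm (x - x\<^sub>0))"
    proof (rule main)
      show "\<exists>y. (y \<in> A \<or> R \<le> norm y) \<and> norm (y - x\<^sub>0) - norm (x - x\<^sub>0) = norm (y - x)" for x R using ray by blast
      show "\<exists>y. (y \<in> A \<or> R \<le> norm y) \<and> norm (x - x\<^sub>0) - norm (y - x\<^sub>0) = norm (y - x)" for x R using apex by blast
    qed (rule tri)
    \<comment> \<open>The second assertion uses the inverted cone as barrier; the roles of the apex
      and the ray are interchanged.\<close>
    have "?Q (\<lambda>x. - norm (x - x\<^sub>0))"
    proof (rule main)
      show "\<bar>- norm (x - x\<^sub>0) - - norm (y - x\<^sub>0)\<bar> \<le> norm (x - y)" for x y using tri[of x x\<^sub>0 y] by linarith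
      show "\<exists>y. (y \<in> A \<or> R \<le> norm y) \<and> - norm (y - x\<^sub>0) - - norm (x - x\<^sub>0) = norm (y - x)" for x R
        using apex[of R x] by (intro exI[of _ x\<^sub>0]) simp
      show "\<exists>y. (y \<in> A \<or> R \<le> norm y) \<and> - norm (x - x\<^sub>0) - - norm (y - x\<^sub>0) = norm (y - x)" for x R
      proof -
        obtain y where "R \<le> norm y" "norm (y - x\<^sub>0) - norm (x - x\<^sub>0) = norm (y - x)" using ray by blast
        then show ?thesis by (intro exI[of _ y]) simp
      qed
    qed
    then show "\<exists>u. area_maximizing (- A) u \<and> bdry_values (- A) u g \<and>
       extrema_on (\<lambda>x. override_on u g (frontier A) x + norm (x - x\<^sub>0)) (- A \<union> frontier A) (frontier A)"
      by simp
  next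
    fix a :: "real ^ 'n" assume a: "norm a = 1"
    have aa: "a \<bullet> a = 1" using a by (simp add: dot_square_norm)
    show "?Q (\<lambda>x. a \<bullet> x)"
    proof (rule main)
      show "\<bar>a \<bullet> x - a \<bullet> y\<bar> \<le> norm (x - y)" for x y
        using Cauchy_Schwarz_ineq2[of a "x - y"] a by (simp add: inner_diff_right)
      fix x :: "real ^ 'n" and R :: real
      \<comment> \<open>Long enough that both \<open>x + s *\<^sub>R a\<close> and
        \<open>x - s *\<^sub>R a\<close> have norm at least \<open>R\<close>.\<close>
      define s where "s = \<bar>R\<bar> + norm x"
      have s: "0 \<le> s" by (simp add: s_def)
      have "R \<le> norm (x + s *\<^sub>R a)" "R \<le> norm (x - s *\<^sub>R a)"
        using norm_triangle_ineq4[of "x + s *\<^sub>R a" x] norm_triangle_ineq4[of "x - s *\<^sub>R a" x] a s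
        by (auto simp: s_def)
      then show "\<exists>y. (y \<in> A \<or> R \<le> norm y) \<and> a \<bullet> y - a \<bullet> x = norm (y - x)"
        and "\<exists>y. (y \<in> A \<or> R \<le> norm y) \<and> a \<bullet> x - a \<bullet> y = norm (y - x)"
        using a aa s by (intro exI[of _ "x + s *\<^sub>R a"] exI[of _ "x - s *\<^sub>R a"]; simp add: inner_add_right inner_diff_right)+
    qed
  qed
qed

end
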